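(* For an arbitrary dominant coweight $\mu$ of $\mathfrak{sl}_n$ and any total ordering of the set $$\{e_{\alpha^\vee}^{(r)}\}_{\alpha^\vee\in\Delta^+}^{r\geq0}\cup\{f_{\alpha^\vee}^{(r)}\}_{\alpha^\vee\in\Delta^+}^{r\geq0}\cup\{h_i^{(s_i)}\}_{1\leq i\leq n-1}^{s_i\geq -b_i},$$ the ordered PBW monomials in these generators form a basis of $Y_{\mu,\hbar}$, which is a free $\mathbb{C}[\hbar]$-module.
   Context: Let $(c_{ij})_{i,j=1}^{n-1}$ be the Cartan matrix of $\mathfrak{sl}_n$, $\{\alpha^\vee_i\}$ its simple roots, $\Delta^+=\{\alpha^\vee_j+\alpha^\vee_{j+1}+\dots+\alpha^\vee_i\}_{1\leq j\leq i\leq n-1}$. Fix a dominant coweight $\mu$ and set $b_i=\alpha^\vee_i(\mu)\geq0$. Let $Y_{\mu,\hbar}$ be the associative $\mathbb{C}[\hbar]$-algebra generated by $\{e_i^{(r)},f_i^{(r)},h_i^{(s_i)}\}_{1\leq i\leq n-1}^{r\geq0,\ s_i\geq -b_i}$ with defining relations (for all admissible indices): $[h_i^{(s)},h_j^{(s')}]=0$; $[e_i^{(r)},f_j^{(r')}]=h_i^{(r+r')}$ if $i=j$ and $r+r'\geq -b_i$, and $=0$ otherwise; $[h_i^{(-b_i)},e_j^{(r)}]=c_{ij}e_j^{(r)}$; $[h_i^{(s+1)},e_j^{(r)}]-[h_i^{(s)},e_j^{(r+1)}]=\frac{c_{ij}\hbar}{2}(h_i^{(s)}e_j^{(r)}+e_j^{(r)}h_i^{(s)})$;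 $[h_i^{(-b_i)},f_j^{(r)}]=-c_{ij}f_j^{(r)}$; $[h_i^{(s+1)},f_j^{(r)}]-[h_i^{(s)},f_j^{(r+1)}]=-\frac{c_{ij}\hbar}{2}(h_i^{(s)}f_j^{(r)}+f_j^{(r)}h_i^{(s)})$; $[e_i^{(r+1)},e_j^{(r')}]-[e_i^{(r)},e_j^{(r'+1)}]=\frac{c_{ij}\hbar}{2}(e_i^{(r)}e_j^{(r')}+e_j^{(r')}e_i^{(r)})$; $[f_i^{(r+1)},f_j^{(r')}]-[f_i^{(r)},f_j^{(r'+1)}]=-\frac{c_{ij}\hbar}{2}(f_i^{(r)}f_j^{(r')}+f_j^{(r')}f_i^{(r)})$; $[e_i^{(r)},e_j^{(r')}]=0$ and $[f_i^{(r)},f_j^{(r')}]=0$ if $c_{ij}=0$; $[e_i^{(r_1)},[e_i^{(r_2)},e_j^{(r')}]]+[e_i^{(r_2)},[e_i^{(r_1)},e_j^{(r')}]]=0$ and the same with $f$ in place of $e$ if $c_{ij}=-1$. For $1\leq j\leq i\leq n-1$ and $r\geq0$ define $e^{(r)}_{\alpha^\vee_j+\dots+\alpha^\vee_i}=[\cdots[e_j^{(r)},e_{j+1}^{(0)}],\cdots,e_i^{(0)}]$ and $f^{(r)}_{\alpha^\vee_j+\dots+\alpha^\vee_i}=[f_i^{(0)},\cdots,[f_{j+1}^{(0)},f_j^{(r)}]\cdots]$. An ordered PBW monomial is a product of these generators (with repetitions) in non-decreasing order with respect to the chosen total ordering. *)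

theory Defs
  imports "HOL-Computational_Algebra.Polynomial" "HOL-Library.Function_Algebras"
begin

text \<open>E i r = e_i^{(r)}, F i r = f_i^{(r)}, H i s = h_i^{(s)}.\<close>
datatype gen = E nat nat | F nat nat | H nat int

text \<open>Scalars: the polynomial ring C[hbar], hbar = the indeterminate.\<close>
type_synonym scal = "complex poly"

text \<open>Elements of the free associative C[hbar]-algebra: coefficient functions on words
  (finitely supported when in free_alg).\<close>
type_synonym fel = "gen list \<Rightarrow> scal"

definition cartan :: "nat \<Rightarrow> nat \<Rightarrow> int" where
  "cartan i j = (if i = j then 2 else if i = Suc j \<or> j = Suc i then -1 else 0)"

definition idx :: "nat \<Rightarrow> nat \<Rightarrow> bool" where
  "idx n i \<longleftrightarrow> 1 \<le> i \<and> i \<le> n - 1"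

fun valid_gen :: "nat \<Rightarrow> (nat \<Rightarrow> nat) \<Rightarrow> gen \<Rightarrow> bool" where
  "valid_gen n b (E i r) = idx n i"
| "valid_gen n b (F i r) = idx n i"
| "valid_gen n b (H i s) = (idx n i \<and> s \<ge> - int (b i))"

definition free_alg :: "nat \<Rightarrow> (nat \<Rightarrow> nat) \<Rightarrow> fel set" where
  "free_alg n b = {f. finite {w. f w \<noteq> 0} \<and> (\<forall>w. f w \<noteq> 0 \<longrightarrow> (\<forall>x\<in>set w. valid_gen n b x))}"

definition fmul :: "fel \<Rightarrow> fel \<Rightarrow> fel" where
  "fmul f g = (\<lambda>w. \<Sum>k\<le>length w. f (take k w) * g (drop k w))"

definition fone :: fel where
  "fone = (\<lambda>w. if w = [] then 1 else 0)"

definition word :: "gen list \<Rightarrow> fel" where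
  "word u = (\<lambda>w. if w = u then 1 else 0)"

definition g :: "gen \<Rightarrow> fel" where
  "g x = word [x]"

definition sc :: "scal \<Rightarrow> fel \<Rightarrow> fel" where
  "sc c f = (\<lambda>w. c * f w)"

definition comm :: "fel \<Rightarrow> fel \<Rightarrow> fel" where
  "comm a b' = fmul a b' - fmul b' a"

definition acomm :: "fel \<Rightarrow> fel \<Rightarrow> fel" where
  "acomm a b' = fmul a b' + fmul b' a"

definition hb2 :: scal where
  "hb2 = [:0, 1/2:]"

definition rels :: "nat \<Rightarrow> (nat \<Rightarrow> nat) \<Rightarrow> fel set" where
  "rels n b =
    {comm (g (H i s)) (g (H j s')) | i j s s'.
        idx n i \<and> idx n j \<and> s \<ge> - int (b i) \<and> s' \<ge> - int (b j)}
  \<union> {comm (g (E i r)) (g (F j r')) - (if i = j then g (H i (int r + int r')) else 0) | i j r r'.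
        idx n i \<and> idx n j}
  \<union> {comm (g (H i (- int (b i)))) (g (E j r)) - sc (of_int (cartan i j)) (g (E j r)) | i j r.
        idx n i \<and> idx n j}
  \<union> {comm (g (H i (s + 1))) (g (E j r)) - comm (g (H i s)) (g (E j (Suc r)))
       - sc (of_int (cartan i j) * hb2) (acomm (g (H i s)) (g (E j r))) | i j s r.
        idx n i \<and> idx n j \<and> s \<ge> - int (b i)}
  \<union> {comm (g (H i (- int (b i)))) (g (F j r)) + sc (of_int (cartan i j)) (g (F j r)) | i j r.
        idx n i \<and> idx n j}
  \<union> {comm (g (H i (s + 1))) (g (F j r)) - comm (g (H i s)) (g (F j (Suc r)))
       + sc (of_int (cartan i j) * hb2) (acomm (g (H i s)) (g (F j r))) | i j s r.
        idx n i \<and> idx n j \<and> s \<ge> - int (b i)}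
  \<union> {comm (g (E i (Suc r))) (g (E j r')) - comm (g (E i r)) (g (E j (Suc r')))
       - sc (of_int (cartan i j) * hb2) (acomm (g (E i r)) (g (E j r'))) | i j r r'.
        idx n i \<and> idx n j}
  \<union> {comm (g (F i (Suc r))) (g (F j r')) - comm (g (F i r)) (g (F j (Suc r')))
       + sc (of_int (cartan i j) * hb2) (acomm (g (F i r)) (g (F j r'))) | i j r r'.
        idx n i \<and> idx n j}
  \<union> {comm (g (E i r)) (g (E j r')) | i j r r'. idx n i \<and> idx n j \<and> cartan i j = 0}
  \<union> {comm (g (F i r)) (g (F j r')) | i j r r'. idx n i \<and> idx n j \<and> cartan i j = 0}
  \<union> {comm (g (E i r1)) (comm (g (E i r2)) (g (E j r')))
       + comm (g (E i r2)) (comm (g (E i r1)) (g (E j r'))) | i j r1 r2 r'.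
        idx n i \<and> idx n j \<and> cartan i j = -1}
  \<union> {comm (g (F i r1)) (comm (g (F i r2)) (g (F j r')))
       + comm (g (F i r2)) (comm (g (F i r1)) (g (F j r'))) | i j r1 r2 r'.
        idx n i \<and> idx n j \<and> cartan i j = -1}"

inductive_set tideal :: "nat \<Rightarrow> (nat \<Rightarrow> nat) \<Rightarrow> fel set \<Rightarrow> fel set" for n b R where
  base: "r \<in> R \<Longrightarrow> r \<in> tideal n b R"
| zero: "0 \<in> tideal n b R"
| add: "x \<in> tideal n b R \<Longrightarrow> y \<in> tideal n b R \<Longrightarrow> x + y \<in> tideal n b R"
| smul: "x \<in> tideal n b R \<Longrightarrow> sc c x \<in> tideal n b R"
| lmul: "x \<in> tideal n b R \<Longrightarrow> a \<in> free_alg n b \<Longrightarrow> fmul a x \<in> tideal n b R"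
| rmul: "x \<in> tideal n b R \<Longrightarrow> a \<in> free_alg n b \<Longrightarrow> fmul x a \<in> tideal n b R"

definition rel_ideal :: "nat \<Rightarrow> (nat \<Rightarrow> nat) \<Rightarrow> fel set" where
  "rel_ideal n b = tideal n b (rels n b)"

text \<open>PE j i r = e^{(r)}_{alpha_j + ... + alpha_i}, PF j i r = f^{(r)}_{alpha_j+...+alpha_i},
  PH i s = h_i^{(s)}.\<close>
datatype pbw = PE nat nat nat | PF nat nat nat | PH nat int

fun valid_pbw :: "nat \<Rightarrow> (nat \<Rightarrow> nat) \<Rightarrow> pbw \<Rightarrow> bool" where
  "valid_pbw n b (PE j i r) = (1 \<le> j \<and> j \<le> i \<and> i \<le> n - 1)"
| "valid_pbw n b (PF j i r) = (1 \<le> j \<and> j \<le> i \<and> i \<le> n - 1)"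
| "valid_pbw n b (PH i s) = (idx n i \<and> s \<ge> - int (b i))"

definition pbw_gens :: "nat \<Rightarrow> (nat \<Rightarrow> nat) \<Rightarrow> pbw set" where
  "pbw_gens n b = {p. valid_pbw n b p}"

definition eroot :: "nat \<Rightarrow> nat \<Rightarrow> nat \<Rightarrow> fel" where
  "eroot j i r = foldl (\<lambda>acc k. comm acc (g (E k 0))) (g (E j r)) [Suc j..<Suc i]"

definition froot :: "nat \<Rightarrow> nat \<Rightarrow> nat \<Rightarrow> fel" where
  "froot j i r = foldl (\<lambda>acc k. comm (g (F k 0)) acc) (g (F j r)) [Suc j..<Suc i]"

fun pbw_el :: "pbw \<Rightarrow> fel" where
  "pbw_el (PE j i r) = eroot j i r"
| "pbw_el (PF j i r) = froot j i r"
| "pbw_el (PH i s) = g (H i s)"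

definition pbw_mon :: "pbw list \<Rightarrow> fel" where
  "pbw_mon ps = foldr (\<lambda>p acc. fmul (pbw_el p) acc) ps fone"

definition ordered_pbw :: "nat \<Rightarrow> (nat \<Rightarrow> nat) \<Rightarrow> (pbw \<times> pbw) set \<Rightarrow> pbw list \<Rightarrow> bool" where
  "ordered_pbw n b ord ps \<longleftrightarrow> set ps \<subseteq> pbw_gens n b \<and> sorted_wrt (\<lambda>x y. (x, y) \<in> ord) ps"

end

theory Submission
  imports Defs "HOL-Computational_Algebra.Formal_Power_Series" "HOL-Library.Multiset"
begin

text \<open>Spanning. Modulo \<open>hbar\<close> the generators satisfy the relations of a Lie subalgebra of
  $\mathfrak{sl}_n[t]$ (with $e_i^{(r)}$, $f_i^{(r)}$, $h_i^{(s)}$ playing the roles of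
  $E_i t^r$, $F_i t^{r+b_i}$, $H_i t^{s+b_i}$). Commutators with generators map the span of
  the root vectors and the $h_i^{(s)}$ to itself, so this span is closed under brackets and products
  can be sorted. All relations are homogeneous for a grading by natural numbers in which \<open>hbar\<close> has
  degree 1, so spanning modulo \<open>hbar\<close> implies spanning by induction on the degree.

  Independence. For distinct complex numbers $z_1, \dots, z_k$ the algebra acts on the $k$-fold tensor
  power of the vector representation by operators that are polynomial in \<open>hbar\<close>. A linear
  relation may be divided by a power of \<open>hbar\<close> until it survives at \<open>hbar = 0\<close>, where the
  operators become those of $\mathfrak{sl}_n[t]$ on a tensor product of evaluation modules.
  There one adds a site with a variable evaluation point and pairs its factor with a functional that
  vanishes on the identity and is dual to one basis element; this lowers the length of the leading
  monomials by one, and an induction shows that all leading coefficients vanish.\<close>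

section \<open>The free algebra\<close>

text \<open>The presented algebra may a priori have \<open>hbar\<close>-torsion, so a relation
  cannot be divided by \<open>hbar\<close> inside it. Division becomes legitimate after acting on
  functions of configurations, where the number \<open>t\<close> standing for \<open>hbar\<close>
  can be cancelled as long as it is nonzero. The defining relations are checked only for
  \<open>t\<close> different from 0 and from all differences of evaluation points, since the
  exchange factors between sites must be invertible in the cubic relations; \<open>t = 0\<close> is
  then reached as a limit, which exists because \<open>t\<close> never enters a denominator. The
  shift by \<open>b\<close> only affects exponents: \<open>F i r\<close> and \<open>H i s\<close>
  act as the modes \<open>r + b i\<close> and \<open>s + b i\<close> of the unshifted algebra, so
  one family of representations serves all dominant coweights. The number of sites has to be
  unbounded, because products of several root vectors can coincide or vanish on one evaluation
  module. In the spanning half, repeated reduction modulo \<open>hbar\<close> by itself gives only a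
  formal power series in \<open>hbar\<close>; the grading bounds the number of rounds.\<close>

declare zero_fun_apply [simp del] plus_fun_apply [simp del] minus_apply [simp del] uminus_apply [simp del]

lemmas fun_app = zero_fun_apply plus_fun_apply minus_apply uminus_apply

text \<open>Two cuts of a word give a sum over triples of lengths adding up to
  \<open>length w\<close>, so the triangular reindexing for products of power series applies. The
  third factor is indexed by its length, hence the drop counted from the end of the word.\<close>

lemma fmul_assoc: "fmul (fmul p q) r = fmul p (fmul q r)"
proof
  fix w :: "gen list"
  let ?n = "length w"
  have "fmul (fmul p q) r w =
      (\<Sum>j=0..?n. \<Sum>i=0..j. p (take i w) * q (take (j - i) (drop i w)) * r (drop (?n - (?n - j)) w))"
    by (auto simp: fmul_def sum_distrib_right atLeast0AtMost min_def take_drop intro!: sum.cong)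
  also have "\<dots> = (\<Sum>j=0..?n. \<Sum>i=0..?n-j. p (take j w) * q (take i (drop j w)) * r (drop (?n - (?n - j - i)) w))"
    by (rule fps_mult_assoc_lemma[of "\<lambda>i j k. p (take i w) * q (take j (drop i w)) * r (drop (?n - k) w)" ?n ?n])
  also have "\<dots> = fmul p (fmul q r) w"
    by (auto simp: fmul_def sum_distrib_left atLeast0AtMost mult.assoc add.commute intro!: sum.cong)
  finally show "fmul (fmul p q) r w = fmul p (fmul q r) w" .
qed

lemma fmul_add_left: "fmul (p + q) r = fmul p r + fmul q r"
  and fmul_add_right: "fmul p (q + r) = fmul p q + fmul p r"
  and fmul_diff_left: "fmul (p - q) r = fmul p r - fmul q r"
  and fmul_diff_right: "fmul p (q - r) = fmul p q - fmul p r"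
  and fmul_zero_left [simp]: "fmul 0 p = 0"
  and fmul_zero_right [simp]: "fmul p 0 = 0"
  by (auto simp: fun_app fmul_def fun_eq_iff algebra_simps sum.distrib sum_subtractf sum_negf)

lemma fmul_sc_left: "fmul (sc c p) q = sc c (fmul p q)"
  and fmul_sc_right: "fmul p (sc c q) = sc c (fmul p q)"
  by (auto simp: fun_app fmul_def sc_def fun_eq_iff algebra_simps sum_distrib_left)

lemma sc_add: "sc c (p + q) = sc c p + sc c q"
  and sc_diff: "sc c (p - q) = sc c p - sc c q"
  and sc_add_left: "sc (c + d) p = sc c p + sc d p"
  and sc_sc [simp]: "sc c (sc d p) = sc (c * d) p"
  and sc_zero [simp]: "sc c 0 = 0"
  and sc_0 [simp]: "sc 0 p = 0"
  and sc_1 [simp]: "sc 1 p = p"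
  and sc_minus1: "sc (-1) p = - p"
  by (auto simp: fun_app sc_def fun_eq_iff algebra_simps)

lemma sc_sum: "sc c (\<Sum>i\<in>A. p i) = (\<Sum>i\<in>A. sc c (p i))"
  by (induction A rule: infinite_finite_induct) (auto simp: sc_add)

lemma fun_sum_apply: "(\<Sum>i\<in>A. p i) x = (\<Sum>i\<in>A. p i x)"
  for p :: "'i \<Rightarrow> 'a \<Rightarrow> 'b::comm_monoid_add"
  by (induction A rule: infinite_finite_induct) (auto simp: fun_app)

lemma fmul_word_word: "fmul (word u) (word v) = word (u @ v)"
proof
  fix w :: "gen list"
  have *: "word u (take k w) * word v (drop k w) = (if k = length u then word (u @ v) w else 0)"
    if "k \<le> length w" for k
  proof (cases "k = length u")
    case True
    then show ?thesis using append_eq_conv_conj[of u v w] by (auto simp: word_def)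
  next
    case False
    then have "take k w \<noteq> u" using that by auto
    then show ?thesis using False by (simp add: word_def)
  qed
  have "fmul (word u) (word v) w = (\<Sum>k\<le>length w. if k = length u then word (u @ v) w else 0)"
    unfolding fmul_def by (intro sum.cong) (auto simp: *)
  also have "\<dots> = word (u @ v) w" by (auto simp: word_def)
  finally show "fmul (word u) (word v) w = word (u @ v) w" .
qed

lemma fone_eq_word: "fone = word []"
  by (simp add: fone_def word_def)

lemma free_alg_0 [simp]: "0 \<in> free_alg n b"
  by (simp add: free_alg_def fun_app)

lemma free_alg_add:
  assumes "p \<in> free_alg n b" "q \<in> free_alg n b"
  shows "p + q \<in> free_alg n b"
proof -
  have "{w. (p + q) w \<noteq> 0} \<subseteq> {w. p w \<noteq> 0} \<union> {w. q w \<noteq> 0}"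
    by (auto simp: fun_app)
  then show ?thesis using assms
    unfolding free_alg_def by (blast intro: finite_subset finite_UnI)
qed

lemma free_alg_sc: "p \<in> free_alg n b \<Longrightarrow> sc c p \<in> free_alg n b"
  unfolding free_alg_def by (auto simp: sc_def elim: finite_subset[rotated])

lemma free_alg_uminus: "p \<in> free_alg n b \<Longrightarrow> - p \<in> free_alg n b"
  unfolding free_alg_def by (auto simp: fun_app)

lemma free_alg_diff: "p \<in> free_alg n b \<Longrightarrow> q \<in> free_alg n b \<Longrightarrow> p - q \<in> free_alg n b"
  using free_alg_add[OF _ free_alg_uminus, of p n b q] by (metis diff_conv_add_uminus)

lemma free_alg_sum: "(\<And>i. i \<in> A \<Longrightarrow> p i \<in> free_alg n b) \<Longrightarrow> (\<Sum>i\<in>A. p i) \<in> free_alg n b"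
  by (induction A rule: infinite_finite_induct) (simp_all add: free_alg_add)

lemma free_alg_word: "(\<forall>x\<in>set u. valid_gen n b x) \<Longrightarrow> word u \<in> free_alg n b"
proof -
  assume a: "\<forall>x\<in>set u. valid_gen n b x"
  have 1: "word u w \<noteq> 0 \<longleftrightarrow> w = u" for w
    by (simp add: word_def)
  show ?thesis using a by (simp add: free_alg_def 1)
qed

lemma free_alg_g: "valid_gen n b x \<Longrightarrow> g x \<in> free_alg n b"
  unfolding g_def by (rule free_alg_word) auto

lemma free_alg_fone [simp]: "fone \<in> free_alg n b"
  by (simp add: fone_eq_word free_alg_word)

lemma fel_expand:
  assumes "finite {w. p w \<noteq> 0}"
  shows "p = (\<Sum>w\<in>{w. p w \<noteq> 0}. sc (p w) (word w))"
proof
  fix w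
  have "(\<Sum>u\<in>{u. p u \<noteq> 0}. sc (p u) (word u)) w = (\<Sum>u\<in>{u. p u \<noteq> 0}. if u = w then p u else 0)"
    unfolding fun_sum_apply by (intro sum.cong) (auto simp: sc_def word_def)
  also have "\<dots> = p w" using assms by simp
  finally show "p w = (\<Sum>u\<in>{u. p u \<noteq> 0}. sc (p u) (word u)) w" ..
qed

lemma free_alg_induct [consumes 1, case_names word add]:
  assumes p: "p \<in> free_alg n b"
    and word: "\<And>c w. (\<forall>x\<in>set w. valid_gen n b x) \<Longrightarrow> P (sc c (word w))"
    and add: "\<And>p q. p \<in> free_alg n b \<Longrightarrow> q \<in> free_alg n b \<Longrightarrow> P p \<Longrightarrow> P q \<Longrightarrow> P (p + q)"
  shows "P p"
proof -
  have P0: "P 0" using word[of "[]" 0] by simp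
  have fin: "finite {w. p w \<noteq> 0}" and val: "\<And>w. p w \<noteq> 0 \<Longrightarrow> \<forall>x\<in>set w. valid_gen n b x"
    using p by (auto simp: free_alg_def)
  have "P (\<Sum>w\<in>A. sc (p w) (word w))" if "finite A" "A \<subseteq> {w. p w \<noteq> 0}" for A
    using that
  proof (induction A)
    case empty
    then show ?case using P0 by simp
  next
    case (insert w A)
    have mem: "sc (p u) (word u) \<in> free_alg n b" if "u \<in> insert w A" for u
      using that insert.prems val by (intro free_alg_sc free_alg_word) blast
    have "P (sc (p w) (word w) + (\<Sum>w\<in>A. sc (p w) (word w)))"
    proof (rule add)
      show "P (sc (p w) (word w))" using insert.prems val by (intro word) blast
    qed (use insert mem in \<open>simp_all add: free_alg_sum\<close>)
    then show ?case using insert by simp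
  qed
  from this[OF fin] show ?thesis by (simp flip: fel_expand[OF fin])
qed

lemma free_alg_fmul: "p \<in> free_alg n b \<Longrightarrow> q \<in> free_alg n b \<Longrightarrow> fmul p q \<in> free_alg n b"
proof (induction p rule: free_alg_induct)
  case (word c w)
  note w = word(1)
  show ?case using word(2)
  proof (induction q rule: free_alg_induct)
    case (word d u)
    then have "word (w @ u) \<in> free_alg n b" using w by (intro free_alg_word) auto
    then show ?case by (simp add: fmul_sc_left fmul_sc_right fmul_word_word free_alg_sc)
  qed (simp add: fmul_add_right free_alg_add)
qed (simp add: fmul_add_left free_alg_add)

lemma fmul_fone_left [simp]: "fmul fone p = p"
proof
  fix w :: "gen list"
  have "fmul fone p w = (\<Sum>k\<le>length w. if k = 0 then p w else 0)"
    unfolding fmul_def fone_def by (intro sum.cong) auto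
  then show "fmul fone p w = p w" by simp
qed

lemma fmul_fone_right [simp]: "fmul p fone = p"
proof
  fix w :: "gen list"
  have "fmul p fone w = (\<Sum>k\<le>length w. if k = length w then p w else 0)"
    unfolding fmul_def fone_def by (intro sum.cong) auto
  then show "fmul p fone w = p w" by simp
qed

lemma free_alg_comm: "p \<in> free_alg n b \<Longrightarrow> q \<in> free_alg n b \<Longrightarrow> comm p q \<in> free_alg n b"
  by (simp add: comm_def free_alg_diff free_alg_fmul)

lemma free_alg_acomm: "p \<in> free_alg n b \<Longrightarrow> q \<in> free_alg n b \<Longrightarrow> acomm p q \<in> free_alg n b"
  by (simp add: acomm_def free_alg_add free_alg_fmul)

lemmas free_alg_closed =
  free_alg_add free_alg_diff free_alg_uminus free_alg_sc free_alg_fmul free_alg_comm free_alg_acomm free_alg_g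

lemma rels_free_alg: "rels n b \<subseteq> free_alg n b"
  unfolding rels_def by (auto intro!: free_alg_closed)

lemma rel_ideal_free_alg: "p \<in> rel_ideal n b \<Longrightarrow> p \<in> free_alg n b"
  unfolding rel_ideal_def
  by (induction rule: tideal.induct)
    (simp_all add: free_alg_add free_alg_sc free_alg_fmul subsetD[OF rels_free_alg])

lemma eroot_free_alg:
  assumes "valid_pbw n b (PE j i r)"
  shows "eroot j i r \<in> free_alg n b"
proof -
  have fold: "foldl (\<lambda>acc k. comm acc (g (E k 0))) acc ks \<in> free_alg n b"
    if "acc \<in> free_alg n b" "\<forall>k\<in>set ks. idx n k" for acc ks
    using that by (induction ks arbitrary: acc) (simp_all add: free_alg_comm free_alg_g)
  have "g (E j r) \<in> free_alg n b"
    using assms by (intro free_alg_g) (auto simp: idx_def)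
  from fold[OF this, of "[Suc j..<Suc i]"] show ?thesis
    using assms by (auto simp: eroot_def idx_def simp del: upt_Suc)
qed

lemma froot_free_alg:
  assumes "valid_pbw n b (PF j i r)"
  shows "froot j i r \<in> free_alg n b"
proof -
  have fold: "foldl (\<lambda>acc k. comm (g (F k 0)) acc) acc ks \<in> free_alg n b"
    if "acc \<in> free_alg n b" "\<forall>k\<in>set ks. idx n k" for acc ks
    using that by (induction ks arbitrary: acc) (simp_all add: free_alg_comm free_alg_g)
  have "g (F j r) \<in> free_alg n b"
    using assms by (intro free_alg_g) (auto simp: idx_def)
  from fold[OF this, of "[Suc j..<Suc i]"] show ?thesis
    using assms by (auto simp: froot_def idx_def simp del: upt_Suc)
qed

lemma pbw_el_free_alg: "valid_pbw n b x \<Longrightarrow> pbw_el x \<in> free_alg n b"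
  by (cases x) (auto simp: eroot_free_alg froot_free_alg free_alg_g)

lemma pbw_mon_simps [simp]:
  "pbw_mon [] = fone" "pbw_mon (x # xs) = fmul (pbw_el x) (pbw_mon xs)"
  by (simp_all add: pbw_mon_def)

lemma pbw_mon_free_alg: "set xs \<subseteq> pbw_gens n b \<Longrightarrow> pbw_mon xs \<in> free_alg n b"
  by (induction xs) (simp_all add: pbw_gens_def pbw_el_free_alg free_alg_fmul)

section \<open>The classical current algebra\<close>

text \<open>Modulo \<open>hbar\<close> all brackets of root vectors have integer coefficients, so
  integral combinations suffice and the abstract current algebra needs no scalar
  multiplication.\<close>

inductive_set zspan :: "'a::ab_group_add set \<Rightarrow> 'a set" for A where
  zero [intro, simp]: "0 \<in> zspan A"
| base: "x \<in> A \<Longrightarrow> x \<in> zspan A"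
| add: "x \<in> zspan A \<Longrightarrow> y \<in> zspan A \<Longrightarrow> x + y \<in> zspan A"
| uminus: "x \<in> zspan A \<Longrightarrow> - x \<in> zspan A"

lemma zspan_diff: "x \<in> zspan A \<Longrightarrow> y \<in> zspan A \<Longrightarrow> x - y \<in> zspan A"
  using zspan.add[OF _ zspan.uminus, of x A y] by simp

lemma zspan_image:
  assumes "x \<in> zspan A" "\<And>x y. \<phi> (x + y) = \<phi> x + \<phi> y" "\<And>x. x \<in> A \<Longrightarrow> \<phi> x \<in> zspan B"
  shows "\<phi> x \<in> zspan B"
proof -
  have 0: "\<phi> 0 = 0" using assms(2)[of 0 0] by simp
  have m: "\<phi> (- x) = - \<phi> x" for x
    using assms(2)[of x "- x"] 0 by (simp add: eq_neg_iff_add_eq_0 add.commute)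
  show ?thesis using assms(1)
    by induction (auto simp: 0 m assms(2,3) intro: zspan.intros)
qed

lemma zspan_trans: "x \<in> zspan A \<Longrightarrow> (\<And>x. x \<in> A \<Longrightarrow> x \<in> zspan B) \<Longrightarrow> x \<in> zspan B"
  by (rule zspan_image[where \<phi> = "\<lambda>x. x" and A = A]) simp_all

definition adjacent :: "nat \<Rightarrow> nat \<Rightarrow> bool" where
  "adjacent i j \<longleftrightarrow> j = Suc i \<or> i = Suc j"

text \<open>Here \<open>h i m\<close> stands for $h_i^{(m-b_i)}$. The axioms are invariant under
  reversing the bracket and exchanging \<open>e\<close> with \<open>f\<close>.\<close>

locale shifted_current =
  fixes br :: "'a::ab_group_add \<Rightarrow> 'a \<Rightarrow> 'a"
    and e f h :: "nat \<Rightarrow> nat \<Rightarrow> 'a" and I :: "nat \<Rightarrow> bool" and b :: "nat \<Rightarrow> nat"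
  assumes br_add_left: "br (x + y) z = br x z + br y z"
    and br_add_right: "br x (y + z) = br x y + br x z"
    and br_anti: "br x y = - br y x"
    and jacobi: "br (br x y) z = br x (br y z) + br (br x z) y"
    and no_2_torsion: "x + x = 0 \<Longrightarrow> x = 0"
    and I_convex: "I i \<Longrightarrow> I j \<Longrightarrow> i \<le> k \<Longrightarrow> k \<le> j \<Longrightarrow> I k"
    and hh: "I i \<Longrightarrow> I j \<Longrightarrow> br (h i m) (h j m') = 0"
    and ef_same: "I i \<Longrightarrow> br (e i r) (f i s) = h i (r + s + b i)"
    and ef_diff: "I i \<Longrightarrow> I j \<Longrightarrow> i \<noteq> j \<Longrightarrow> br (e i r) (f j s) = 0"
    and he_same: "I i \<Longrightarrow> br (h i m) (e i r) = e i (r + m) + e i (r + m)"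
    and he_adj: "I i \<Longrightarrow> I j \<Longrightarrow> adjacent i j \<Longrightarrow> br (h i m) (e j r) = - e j (r + m)"
    and he_far: "I i \<Longrightarrow> I j \<Longrightarrow> i \<noteq> j \<Longrightarrow> \<not> adjacent i j \<Longrightarrow> br (h i m) (e j r) = 0"
    and fh_same: "I i \<Longrightarrow> br (f i r) (h i m) = f i (r + m) + f i (r + m)"
    and fh_adj: "I i \<Longrightarrow> I j \<Longrightarrow> adjacent i j \<Longrightarrow> br (f j r) (h i m) = - f j (r + m)"
    and fh_far: "I i \<Longrightarrow> I j \<Longrightarrow> i \<noteq> j \<Longrightarrow> \<not> adjacent i j \<Longrightarrow> br (f j r) (h i m) = 0"
    and ee_shift: "I i \<Longrightarrow> I j \<Longrightarrow> br (e i (Suc r)) (e j s) = br (e i r) (e j (Suc s))"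
    and ff_shift: "I i \<Longrightarrow> I j \<Longrightarrow> br (f i (Suc r)) (f j s) = br (f i r) (f j (Suc s))"
    and ee_far: "I i \<Longrightarrow> I j \<Longrightarrow> i \<noteq> j \<Longrightarrow> \<not> adjacent i j \<Longrightarrow> br (e i r) (e j s) = 0"
    and ff_far: "I i \<Longrightarrow> I j \<Longrightarrow> i \<noteq> j \<Longrightarrow> \<not> adjacent i j \<Longrightarrow> br (f i r) (f j s) = 0"
    and serre_e: "I i \<Longrightarrow> I j \<Longrightarrow> adjacent i j \<Longrightarrow>
      br (e i r) (br (e i s) (e j t)) + br (e i s) (br (e i r) (e j t)) = 0"
    and serre_f: "I i \<Longrightarrow> I j \<Longrightarrow> adjacent i j \<Longrightarrow>
      br (f i r) (br (f i s) (f j t)) + br (f i s) (br (f i r) (f j t)) = 0"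
begin

lemma br_zero_left [simp]: "br 0 x = 0" and br_zero_right [simp]: "br x 0 = 0"
  using br_add_left[of 0 0 x] br_add_right[of x 0 0] by auto

lemma br_uminus_right: "br x (- y) = - br x y"
  using br_add_right[of x y "- y"] by (simp add: eq_neg_iff_add_eq_0 add.commute)

lemma br_zspan_left:
  assumes "x \<in> zspan A" "\<And>a. a \<in> A \<Longrightarrow> br a y \<in> zspan B"
  shows "br x y \<in> zspan B"
  using assms by (rule zspan_image[where \<phi> = "\<lambda>x. br x y", OF _ br_add_left])

lemma br_zspan_right:
  assumes "x \<in> zspan A" "\<And>a. a \<in> A \<Longrightarrow> br y a \<in> zspan B"
  shows "br y x \<in> zspan B"
  using assms by (rule zspan_image[where \<phi> = "\<lambda>x. br y x", OF _ br_add_right])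

lemma br_0_sym: "br x y = 0 \<Longrightarrow> br y x = 0"
  using br_anti[of y x] by simp

lemma br_reverse: "br (br x y) z = br z (br y x)"
  using br_anti[of "br x y" z] br_anti[of x y] by (simp add: br_uminus_right)

text \<open>Root vectors built from \<open>f\<close> nest new generators on the left, those built
  from \<open>e\<close> on the right. Reversing the bracket turns one construction into the other,
  so only positive roots need computation.\<close>

lemma opposite: "shifted_current (\<lambda>x y. br y x) f e h I b"
proof
  show "br z (br y x) = br (br z y) x + br y (br z x)" for x y z
    using jacobi[of z y x] br_anti[of y "br z x"] by simp
  show "br (br (f j t) (f i s)) (f i r) + br (br (f j t) (f i r)) (f i s) = 0"
    if "I i" "I j" "adjacent i j" for i j r s t
    using serre_f[OF that, of r s t] by (simp add: br_reverse)
  show "br (br (e j t) (e i s)) (e i r) + br (br (e j t) (e i r)) (e i s) = 0"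
    if "I i" "I j" "adjacent i j" for i j r s t
    using serre_e[OF that, of r s t] by (simp add: br_reverse)
  show "br (f j s) (f i (Suc r)) = br (f j (Suc s)) (f i r)" if "I i" "I j" for i j r s
    using ff_shift[OF that(2,1), of s r] by simp
  show "br (e j s) (e i (Suc r)) = br (e j (Suc s)) (e i r)" if "I i" "I j" for i j r s
    using ee_shift[OF that(2,1), of s r] by simp
  show "I k" if "I i" "I j" "i \<le> k" "k \<le> j" for i j k
    using I_convex that .
  show "br y x = - br x y" for x y
    by (rule br_anti)
  show "x = 0" if "x + x = 0" for x :: 'a
    by (rule no_2_torsion) fact
qed (simp_all add: br_add_left br_add_right hh ef_same ef_diff he_same he_adj he_far
    fh_same fh_adj fh_far ee_far ff_far adjacent_def add.commute disj_commute)

section \<open>Brackets of positive root vectors with simple root vectors\<close>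

fun er :: "nat \<Rightarrow> nat \<Rightarrow> nat \<Rightarrow> 'a" where
  "er j i r = foldl (\<lambda>x k. br x (e k 0)) (e j r) [Suc j..<Suc i]"

declare er.simps [simp del]

lemma er_same [simp]: "er j j r = e j r"
  by (simp add: er.simps)

lemma er_Suc: "j \<le> i \<Longrightarrow> er j (Suc i) r = br (er j i r) (e (Suc i) 0)"
  by (simp add: er.simps)

lemma jacobi_left: "br x z = 0 \<Longrightarrow> br (br x y) z = br x (br y z)"
  and jacobi_right: "br y z = 0 \<Longrightarrow> br (br x y) z = br (br x z) y"
  using jacobi[of x y z] by simp_all

lemma e_shift: "I i \<Longrightarrow> I j \<Longrightarrow> br (e i r) (e j s) = br (e i (r + s)) (e j 0)"
proof (induction s arbitrary: r)
  case (Suc s)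
  then show ?case using ee_shift[of i j r s] by simp
qed simp

lemma e_shift': "I i \<Longrightarrow> I j \<Longrightarrow> br (e i r) (e j s) = br (e i 0) (e j (r + s))"
proof (induction r arbitrary: s)
  case (Suc r)
  then show ?case using ee_shift[of i j r s] by simp
qed simp

text \<open>Moving the whole index to the first factor makes the bracket symmetric in
  \<open>r\<close> and \<open>s\<close>; it is also antisymmetric, and there is no
  2-torsion.\<close>

lemma ee_same: assumes "I i" shows "br (e i r) (e i s) = 0"
proof (rule no_2_torsion)
  have "br (e i r) (e i s) = br (e i s) (e i r)"
    using e_shift[OF assms assms, of r s] e_shift[OF assms assms, of s r] by (simp add: add.commute)
  then show "br (e i r) (e i s) + br (e i r) (e i s) = 0"
    using br_anti[of "e i r" "e i s"] by (metis add.right_inverse)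
qed

text \<open>The double bracket depends on \<open>s\<close> and \<open>t\<close> only through
  \<open>s + t\<close>. The symmetrized relation with both outer indices 0 kills the terms
  \<open>T 0 N\<close>, by absence of 2-torsion; with one outer index 0 it then kills the
  rest.\<close>

lemma serre_e_strong:
  assumes "I i" "I j" "adjacent i j"
  shows "br (e i r) (br (e i s) (e j t)) = 0"
proof -
  define T where "T r N = br (e i r) (br (e i 0) (e j N))" for r N
  have T: "br (e i r) (br (e i s) (e j t)) = T r (s + t)" for r s t
    by (simp only: T_def e_shift'[OF assms(1,2), of s t])
  have S: "T r (s + t) + T s (r + t) = 0" for r s t
    using serre_e[OF assms, of r s t] by (simp add: T)
  have "T 0 N = 0" for N
    by (rule no_2_torsion) (use S[of 0 0 N] in simp)
  with S[of r 0 "s + t"] show ?thesis by (simp add: T)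
qed

lemma er_far:
  assumes "j \<le> i" "I j" "I i" "I k" "Suc k < j \<or> Suc i < k"
  shows "br (er j i r) (e k s) = 0"
  using assms
proof (induction i rule: dec_induct)
  case base
  then show ?case by (auto intro!: ee_far simp: adjacent_def)
next
  case (step i)
  then have I: "I i" using I_convex[of j "Suc i" i] by simp
  have "br (e (Suc i) 0) (e k s) = 0"
    using step.prems step.hyps by (intro ee_far) (auto simp: adjacent_def)
  moreover have "br (er j i r) (e k s) = 0"
    using step I by auto
  ultimately show ?case using step.hyps by (simp add: er_Suc jacobi[of "er j i r" "e (Suc i) 0"])
qed

text \<open>Only the total index matters: an index on the last factor is handed to its left
  neighbour by \<open>e_shift\<close>, because the remaining factors commute with the last
  one.\<close>

lemma er_append:
  assumes "j \<le> i" "I j" "I (Suc i)"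
  shows "br (er j i r) (e (Suc i) s) = er j (Suc i) (r + s)"
  using assms
proof (induction i arbitrary: s rule: dec_induct)
  case base
  then show ?case using e_shift[of j "Suc j" r s] by (simp add: er_Suc)
next
  case (step i)
  have I: "I (Suc i)" "I i"
    using step.prems step.hyps I_convex[of j "Suc (Suc i)" "Suc i"] I_convex[of j "Suc (Suc i)" "i"] by simp_all
  have far: "br (er j i r) (e (Suc (Suc i)) t) = 0" for t
    using step I by (intro er_far) auto
  have "br (er j (Suc i) r) (e (Suc (Suc i)) s) = br (er j i r) (br (e (Suc i) 0) (e (Suc (Suc i)) s))"
    using step.hyps by (simp add: er_Suc jacobi_left[OF far])
  also have "\<dots> = br (er j i r) (br (e (Suc i) s) (e (Suc (Suc i)) 0))"
    using I step.prems e_shift[of "Suc i" "Suc (Suc i)" 0 s] by simp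
  also have "\<dots> = br (br (er j i r) (e (Suc i) s)) (e (Suc (Suc i)) 0)"
    by (simp add: jacobi_left[OF far])
  also have "\<dots> = er j (Suc (Suc i)) (r + s)"
    using step I by (simp add: er_Suc)
  finally show ?case .
qed

lemma er_prepend:
  assumes "Suc k \<le> i" "I k" "I i"
  shows "br (e k s) (er (Suc k) i r) = er k i (r + s)"
  using assms
proof (induction i rule: dec_induct)
  case base
  then show ?case using er_append[of k k s r] by (simp add: add.commute)
next
  case (step i)
  have I: "I i" using step I_convex[of k "Suc i" i] by simp
  have far: "br (e k s) (e (Suc i) 0) = 0"
    using step by (intro ee_far) (auto simp: adjacent_def)
  then show ?case using step I jacobi_left[OF far, of "er (Suc k) i r"] by (simp add: er_Suc)
qed

lemma er_left:
  assumes "Suc j \<le> i" "I j" "I i"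
  shows "br (er j i r) (e j s) = 0"
  using assms
proof (induction i rule: dec_induct)
  case base
  have "br (e j s) (br (e j r) (e (Suc j) 0)) = 0"
    using base by (intro serre_e_strong) (auto simp: adjacent_def)
  then show ?case by (simp add: er_Suc br_0_sym)
next
  case (step i)
  have I: "I i" using step I_convex[of j "Suc i" i] by simp
  have far: "br (e (Suc i) 0) (e j s) = 0"
    using step by (intro ee_far) (auto simp: adjacent_def)
  then show ?case using step I jacobi_right[OF far, of "er j i r"] by (simp add: er_Suc)
qed

lemma serre_e_strong':
  assumes "I i" "I j" "adjacent i j"
  shows "br (br (e j t) (e i s)) (e i r) = 0"
  using serre_e_strong[OF assms, of r s t] by (simp add: br_reverse)

text \<open>Since \<open>er j l\<close> commutes with the last generator, the bracket reduces to the
  strong Serre relation for the last two simple roots.\<close>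

lemma er_right:
  assumes "j \<le> m" "I j" "I (Suc m)"
  shows "br (er j (Suc m) r) (e (Suc m) s) = 0"
proof (cases "j = m")
  case True
  then show ?thesis using assms by (simp add: er_Suc serre_e_strong' adjacent_def)
next
  case False
  then obtain l where l: "m = Suc l" "j \<le> l" using assms(1) by (cases m) auto
  have I: "I l" "I m" using assms l I_convex[of j "Suc m" "l"] I_convex[of j "Suc m" "m"] by auto
  have far: "br (er j l r) (e (Suc m) t) = 0" for t
    using assms I l by (intro er_far) auto
  have "br (br (er j l r) (br (e m 0) (e (Suc m) 0))) (e (Suc m) s)
      = br (er j l r) (br (br (e m 0) (e (Suc m) 0)) (e (Suc m) s))"
    by (rule jacobi_left[OF far])
  moreover have "br (br (e m 0) (e (Suc m) 0)) (e (Suc m) s) = 0"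
    using assms I by (intro serre_e_strong') (auto simp: adjacent_def)
  moreover have "er j (Suc m) r = br (er j l r) (br (e m 0) (e (Suc m) 0))"
    using assms l jacobi_left[OF far[of 0], of "e m 0"] by (simp add: er_Suc)
  ultimately show ?thesis by simp
qed

text \<open>The sum of the two roots is not a root, yet no single Serre relation says so. With
  \<open>A = [a, B]\<close>, expanding \<open>[[A, C], B]\<close> by Jacobi in two ways gives both
  \<open>U\<close> and \<open>- U\<close> for \<open>U = [A, [C, B]]\<close>, because
  \<open>[A, B]\<close>, \<open>[a, C]\<close> and \<open>[[B, C], B]\<close> vanish.\<close>

lemma er_mid:
  assumes "Suc k \<le> i" "j < k" "I j" "I i"
  shows "br (er j i r) (e k s) = 0"
  using assms
proof (induction i rule: dec_induct)
  case base
  obtain l where l: "k = Suc l" "j \<le> l" using base by (cases k) auto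
  have I: "I k" "I l" using base l I_convex[of j "Suc k" "k"] I_convex[of j "Suc k" "l"] by auto
  define a A B where "a = er j l r" and "A = er j k r" and "B = e k 0"
  \<comment> \<open>The index \<open>s\<close> of \<open>e k s\<close> is carried by
    \<open>C\<close> instead, so that \<open>B\<close> has index 0 as in \<open>A\<close>;
    \<open>e_shift\<close> justifies the exchange at the end.\<close>
  define C where "C = e (Suc k) s"
  have A: "A = br a B" unfolding A_def a_def B_def using l by (simp add: er_Suc)
  have aC: "br a C = 0" unfolding a_def C_def using base I l by (intro er_far) auto
  have AB: "br A (e k t) = 0" for t
    unfolding A_def using er_right[of j l] l I base by simp
  have BCB: "br (br B C) B = 0"
    using br_0_sym[OF serre_e_strong[of k "Suc k" 0 0 s]] I base by (simp add: adjacent_def B_def C_def)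
  define U where "U = br A (br C B)"
  have "br (br A C) B = U"
    using AB[of 0] unfolding U_def by (subst jacobi) (simp add: B_def)
  moreover have "br A C = br a (br B C)"
    unfolding A by (rule jacobi_left[OF aC])
  moreover have "br (br a (br B C)) B = - U"
    unfolding U_def using br_anti[of C B] by (subst jacobi) (simp add: BCB A br_uminus_right)
  ultimately have "- U = U" by simp
  then have "U + U = 0" by (metis add.right_inverse)
  then have "U = 0" by (rule no_2_torsion)
  moreover have "br (er j (Suc k) r) (e k s) = br A (br (e (Suc k) 0) (e k s))"
    using base AB[of s] by (subst er_Suc) (simp_all add: A_def[symmetric] jacobi[of A "e (Suc k) 0"])
  moreover have "br (e (Suc k) 0) (e k s) = br C B"
    unfolding C_def B_def using e_shift[of "Suc k" k 0 s] I base by simp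
  ultimately show ?case by (simp add: U_def)
next
  case (step i)
  have I: "I i" "I k" using step I_convex[of j "Suc i" "i"] I_convex[of j "Suc i" "k"] by simp_all
  have far: "br (e (Suc i) 0) (e k s) = 0"
    using step I by (intro ee_far) (auto simp: adjacent_def)
  then show ?case using step I jacobi_right[OF far, of "er j i r"] by (simp add: er_Suc)
qed

section \<open>Brackets of positive root vectors with Cartan and negative generators\<close>

lemma e_h: assumes "I i" "I k" shows "br (e i r) (h k m) \<in> zspan {e i (r + m)}"
proof -
  have "br (h k m) (e i r) \<in> zspan {e i (r + m)}"
    using he_same[of k m r] he_adj[of k i m r] he_far[of k i m r] assms
    by (cases "k = i"; cases "adjacent k i") (auto intro: zspan.intros)
  then show ?thesis by (subst br_anti) (rule zspan.uminus)
qed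

lemma er_h:
  assumes "j \<le> i" "I j" "I i" "I k"
  shows "br (er j i r) (h k m) \<in> zspan {er j i (r + m)}"
  using assms
proof (induction i rule: dec_induct)
  case base
  then show ?case by (simp add: e_h)
next
  case (step i)
  have I: "I i" using step I_convex[of j "Suc i" i] by simp
  have "br (er j i r) (br (e (Suc i) 0) (h k m)) \<in> zspan {er j (Suc i) (r + m)}"
    by (rule br_zspan_right[OF e_h]) (use step in \<open>simp_all add: er_append zspan.base\<close>)
  moreover have "br (br (er j i r) (h k m)) (e (Suc i) 0) \<in> zspan {er j (Suc i) (r + m)}"
    by (rule br_zspan_left[OF step.IH]) (use step I in \<open>simp_all add: er_append zspan.base\<close>)
  ultimately show ?case using step by (simp add: er_Suc jacobi[of "er j i r" "e (Suc i) 0"] zspan.add)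
qed

lemma er_f_out:
  assumes "j \<le> i" "I j" "I i" "I k" "k < j \<or> i < k"
  shows "br (er j i r) (f k s) = 0"
  using assms
proof (induction i rule: dec_induct)
  case base
  then show ?case using ef_diff[of j k r s] by auto
next
  case (step i)
  have "I i" using step I_convex[of j "Suc i" i] by simp
  moreover have "br (e (Suc i) 0) (f k s) = 0" using step by (intro ef_diff) auto
  ultimately show ?case using step by (auto simp: er_Suc jacobi[of "er j i r" "e (Suc i) 0"])
qed

text \<open>Only the last factor meets \<open>f (Suc m)\<close>, producing a Cartan element that
  rescales the shorter root vector and shifts its index.\<close>

lemma er_f_right:
  assumes "j \<le> m" "I j" "I (Suc m)"
  shows "br (er j (Suc m) r) (f (Suc m) s) \<in> zspan {er j m (r + (s + b (Suc m)))}"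
proof -
  have I: "I m" using assms I_convex[of j "Suc m" m] by simp
  have "br (er j m r) (f (Suc m) s) = 0" using assms I by (intro er_f_out) auto
  then have "br (er j (Suc m) r) (f (Suc m) s) = br (er j m r) (h (Suc m) (s + b (Suc m)))"
    using assms by (simp add: er_Suc jacobi[of "er j m r" "e (Suc m) 0"] ef_same)
  then show ?thesis using er_h[of j m "Suc m" r] assms I by simp
qed

lemma er_f_left:
  assumes "Suc j \<le> i" "I j" "I i"
  shows "br (er j i r) (f j s) \<in> zspan {er (Suc j) i (r + s + b j)}"
  using assms
proof (induction i rule: dec_induct)
  case base
  have "br (er j (Suc j) r) (f j s) = - e (Suc j) (r + s + b j)"
    using base by (simp add: er_Suc jacobi[of "e j r" "e (Suc j) 0"] ef_same ef_diff he_adj adjacent_def)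
  then show ?case by (auto intro: zspan.intros)
next
  case (step i)
  have I: "I i" "I (Suc j)" using step I_convex[of j "Suc i" "i"] I_convex[of j "Suc i" "Suc j"] by simp_all
  have far: "br (e (Suc i) 0) (f j s) = 0" using step by (intro ef_diff) auto
  have "br (br (er j i r) (f j s)) (e (Suc i) 0) \<in> zspan {er (Suc j) (Suc i) (r + s + b j)}"
    by (rule br_zspan_left[OF step.IH]) (use step I in \<open>simp_all add: er_append zspan.base\<close>)
  then show ?case using step jacobi_right[OF far, of "er j i r"] by (simp add: er_Suc)
qed

text \<open>Removing an interior simple root leaves two disconnected intervals: \<open>f k\<close>
  cuts \<open>er j k\<close> down to \<open>er j (k - 1)\<close>, which commutes with
  \<open>e (Suc k) 0\<close>.\<close>

lemma er_f_mid:
  assumes "Suc k \<le> i" "j < k" "I j" "I i"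
  shows "br (er j i r) (f k s) = 0"
  using assms
proof (induction i rule: dec_induct)
  case base
  obtain l where l: "k = Suc l" "j \<le> l" using base by (cases k) auto
  have I: "I k" "I l" using base l I_convex[of j "Suc k" "k"] I_convex[of j "Suc k" "l"] by auto
  have far: "br (e (Suc k) 0) (f k s) = 0" using base I by (intro ef_diff) auto
  \<comment> \<open>\<open>zspan {}\<close> consists of 0 only, so the span lemmas can be used to
    prove vanishing.\<close>
  have "br (br (er j k r) (f k s)) (e (Suc k) 0) \<in> zspan {}"
    unfolding l(1) by (rule br_zspan_left[OF er_f_right]) (use l base I in \<open>simp_all add: er_far\<close>)
  then have "br (br (er j k r) (f k s)) (e (Suc k) 0) = 0"
    by (rule zspan.induct[of _ _ "\<lambda>x. x = 0"]) auto
  then show ?case using base jacobi_right[OF far, of "er j k r"] by (simp add: er_Suc)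
next
  case (step i)
  have I: "I i" "I k" using step I_convex[of j "Suc i" "i"] I_convex[of j "Suc i" "k"] by simp_all
  have far: "br (e (Suc i) 0) (f k s) = 0" using step I by (intro ef_diff) auto
  then show ?case using step I jacobi_right[OF far, of "er j i r"] by (simp add: er_Suc)
qed

section \<open>Closure of the span of the root vectors under brackets\<close>

definition eroots :: "'a set" where
  "eroots = {er j i r | j i r. j \<le> i \<and> I j \<and> I i}"

definition hs :: "'a set" where
  "hs = {h i m | i m. I i}"

lemma er_in_eroots: "j \<le> i \<Longrightarrow> I j \<Longrightarrow> I i \<Longrightarrow> er j i r \<in> eroots"
  and h_in_hs: "I i \<Longrightarrow> h i m \<in> hs"
  by (auto simp: eroots_def hs_def)

lemma e_in_eroots: "I i \<Longrightarrow> e i r \<in> eroots"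
  using er_in_eroots[of i i r] by simp

text \<open>The interval root plus the simple root \<open>k\<close> is again a root only if
  \<open>k\<close> extends the interval at one end; every other position of \<open>k\<close> gives
  0.\<close>

lemma eroots_e:
  assumes "x \<in> eroots" "I k" shows "br x (e k s) \<in> zspan eroots"
proof -
  obtain j i r where x: "x = er j i r" "j \<le> i" "I j" "I i" using assms by (auto simp: eroots_def)
  consider "Suc k < j \<or> Suc i < k" | "k = Suc i" | "j = Suc k" | "j < k" "Suc k \<le> i"
    | "j < k" "k = i" | "k = j" "Suc j \<le> i" | "k = j" "i = j"
    using x(2) by linarith
  then show ?thesis
  proof cases
    case 1
    then show ?thesis using x assms by (simp add: er_far)
  next
    case 2
    then show ?thesis using x assms by (simp add: er_append er_in_eroots zspan.base)
  next
    case 3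
    have "br (e k s) x = er k i (r + s)" using 3 x assms by (simp add: er_prepend)
    then have "br x (e k s) = - er k i (r + s)" by (subst br_anti) simp
    then show ?thesis using 3 x assms by (simp add: er_in_eroots zspan.base zspan.uminus)
  next
    case 4
    then show ?thesis using x assms by (simp add: er_mid)
  next
    case 5
    then show ?thesis using x assms er_right[of j "i - 1" r s] by simp
  next
    case 6
    then show ?thesis using x assms by (simp add: er_left)
  next
    case 7
    then show ?thesis using x assms by (simp add: ee_same)
  qed
qed

lemma eroots_h:
  assumes "x \<in> eroots" "I k" shows "br x (h k m) \<in> zspan eroots"
proof -
  obtain j i r where x: "x = er j i r" "j \<le> i" "I j" "I i" using assms by (auto simp: eroots_def)
  then have "br x (h k m) \<in> zspan {er j i (r + m)}" using assms by (simp add: er_h)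
  then show ?thesis by (rule zspan_trans) (use x in \<open>auto intro!: zspan.base er_in_eroots\<close>)
qed

lemma eroots_f:
  assumes "x \<in> eroots" "I k" shows "br x (f k s) \<in> zspan (eroots \<union> hs)"
proof -
  obtain j i r where x: "x = er j i r" "j \<le> i" "I j" "I i" using assms by (auto simp: eroots_def)
  consider "k < j \<or> i < k" | "j < k" "Suc k \<le> i"
    | "j \<le> i - 1" "k = Suc (i - 1)" "i = Suc (i - 1)" | "k = j" "Suc j \<le> i" | "k = j" "i = j"
    using x(2) by linarith
  then show ?thesis
  proof cases
    case 1
    then show ?thesis using x assms by (simp add: er_f_out)
  next
    case 2
    then show ?thesis using x assms by (simp add: er_f_mid)
  next
    case 3
    define m where "m = i - 1"
    have m: "j \<le> m" "k = Suc m" "i = Suc m" using 3 by (simp_all add: m_def)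
    then have "br x (f k s) \<in> zspan {er j m (r + (s + b (Suc m)))}"
      using x by (simp add: er_f_right)
    moreover have "I m" using m x I_convex[of j i m] by simp
    ultimately show ?thesis
      by (elim zspan_trans) (use m x in \<open>auto intro!: zspan.base er_in_eroots\<close>)
  next
    case 4
    then have "br x (f k s) \<in> zspan {er (Suc j) i (r + s + b j)}"
      using x by (simp add: er_f_left)
    moreover have "I (Suc j)" using 4 x I_convex[of j i "Suc j"] by simp
    ultimately show ?thesis
      by (elim zspan_trans) (use 4 x in \<open>auto intro!: zspan.base er_in_eroots\<close>)
  next
    case 5
    then show ?thesis using x by (auto simp: ef_same intro!: zspan.base h_in_hs)
  qed
qed

end

context shifted_current
begin

interpretation op: shifted_current "\<lambda>x y. br y x" f e h I b
  by (rule opposite)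

definition fr :: "nat \<Rightarrow> nat \<Rightarrow> nat \<Rightarrow> 'a" where
  "fr j i r = foldl (\<lambda>x k. br (f k 0) x) (f j r) [Suc j..<Suc i]"

lemma fr_eq: "op.er = fr"
  by (intro ext) (simp add: op.er.simps fr_def)

definition froots :: "'a set" where
  "froots = {fr j i r | j i r. j \<le> i \<and> I j \<and> I i}"

lemma op_eroots: "op.eroots = froots"
  by (simp add: op.eroots_def froots_def fr_eq)

definition roots :: "'a set" where
  "roots = eroots \<union> froots \<union> hs"

definition gens :: "'a set" where
  "gens = {e i r | i r. I i} \<union> {f i r | i r. I i} \<union> hs"

lemma gens_cases:
  assumes "y \<in> gens"
  obtains i r where "y = e i r" "I i" | i r where "y = f i r" "I i" | i m where "y = h i m" "I i"
  using assms by (auto simp: gens_def hs_def)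

lemma e_in_roots: "I i \<Longrightarrow> e i r \<in> roots" and f_in_roots: "I i \<Longrightarrow> f i r \<in> roots"
  using e_in_eroots op.e_in_eroots by (simp_all add: roots_def op_eroots)

lemma zspan_roots_mono: "x \<in> zspan A \<Longrightarrow> A \<subseteq> roots \<Longrightarrow> x \<in> zspan roots"
  by (erule zspan_trans) (auto intro: zspan.base)

lemma br_zspan_anti: "br y x \<in> zspan A \<Longrightarrow> br x y \<in> zspan A"
  by (subst br_anti) (rule zspan.uminus)

lemma eroots_gens:
  assumes x: "x \<in> eroots" and y: "y \<in> gens" shows "br x y \<in> zspan roots"
  using y
proof (cases rule: gens_cases)
  case (1 i r)
  show ?thesis unfolding 1(1)
    by (rule zspan_roots_mono[OF eroots_e[OF x 1(2)]]) (auto simp: roots_def)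
next
  case (2 i r)
  show ?thesis unfolding 2(1)
    by (rule zspan_roots_mono[OF eroots_f[OF x 2(2)]]) (auto simp: roots_def)
next
  case (3 i m)
  show ?thesis unfolding 3(1)
    by (rule zspan_roots_mono[OF eroots_h[OF x 3(2)]]) (auto simp: roots_def)
qed

lemma froots_gens:
  assumes "x \<in> froots" and y: "y \<in> gens" shows "br x y \<in> zspan roots"
proof (rule br_zspan_anti)
  have x: "x \<in> op.eroots" using assms(1) by (simp add: op_eroots)
  show "br y x \<in> zspan roots"
    using y
  proof (cases rule: gens_cases)
    case (1 i r)
    show ?thesis unfolding 1(1)
      by (rule zspan_roots_mono[OF op.eroots_f[OF x 1(2)]]) (auto simp: roots_def op_eroots)
  next
    case (2 i r)
    show ?thesis unfolding 2(1)
      by (rule zspan_roots_mono[OF op.eroots_e[OF x 2(2)]]) (auto simp: roots_def op_eroots)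
  next
    case (3 i m)
    show ?thesis unfolding 3(1)
      by (rule zspan_roots_mono[OF op.eroots_h[OF x 3(2)]]) (auto simp: roots_def op_eroots)
  qed
qed

lemma hs_gens:
  assumes "x \<in> hs" and y: "y \<in> gens" shows "br x y \<in> zspan roots"
proof -
  obtain k l where x: "x = h k l" "I k" using assms(1) by (auto simp: hs_def)
  show ?thesis
    using y
  proof (cases rule: gens_cases)
    case (1 i r)
    then have "br y x \<in> zspan roots"
      using zspan_roots_mono[OF e_h[of i k r l]] e_in_roots x by simp
    then show ?thesis by (rule br_zspan_anti)
  next
    case (2 i r)
    then show ?thesis using zspan_roots_mono[OF op.e_h[of i k l r]] f_in_roots x by simp
  next
    case (3 i m)
    then show ?thesis using x by (simp add: hh)
  qed
qed

lemma zspan_roots_gens: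
  assumes "x \<in> zspan roots" "y \<in> gens" shows "br x y \<in> zspan roots"
  using assms(1)
proof (rule br_zspan_left)
  show "br a y \<in> zspan roots" if "a \<in> roots" for a
    using that eroots_gens froots_gens hs_gens assms(2) unfolding roots_def by blast
qed

text \<open>By Jacobi the elements whose right bracket preserves the span are closed under brackets.
  Root vectors are iterated brackets of generators, so it is enough that the generators belong
  here.\<close>

definition normalizer :: "'a set" where
  "normalizer = {y. \<forall>x\<in>zspan roots. br x y \<in> zspan roots}"

lemma normalizer_br: "y \<in> normalizer \<Longrightarrow> z \<in> normalizer \<Longrightarrow> br y z \<in> normalizer"
proof -
  have "br x (br y z) = br (br x y) z - br (br x z) y" for x
    using jacobi[of x y z] by simp
  then show "y \<in> normalizer \<Longrightarrow> z \<in> normalizer \<Longrightarrow> br y z \<in> normalizer"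
    unfolding normalizer_def by (simp add: zspan_diff)
qed

lemma gens_normalizer: "gens \<subseteq> normalizer"
  using zspan_roots_gens unfolding normalizer_def by blast

lemma roots_normalizer: "roots \<subseteq> normalizer"
proof -
  have g: "e i r \<in> normalizer" "f i r \<in> normalizer" if "I i" for i r
    using gens_normalizer that by (auto simp: gens_def)
  have "er j i r \<in> normalizer" if "j \<le> i" "I j" "I i" for j i r
    using that
  proof (induction i rule: dec_induct)
    case (step i)
    then show ?case using I_convex[of j "Suc i" i] by (simp add: er_Suc normalizer_br g)
  qed (simp add: g)
  moreover have "fr j i r \<in> normalizer" if "j \<le> i" "I j" "I i" for j i r
    using that
  proof (induction i rule: dec_induct)
    case (step i)
    then show ?case using I_convex[of j "Suc i" i] op.er_Suc[of j i r]
      by (simp add: fr_eq normalizer_br g)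
  qed (use op.er_same[of j r] in \<open>simp add: fr_eq g\<close>)
  ultimately show ?thesis using gens_normalizer
    by (auto simp: roots_def eroots_def froots_def gens_def)
qed

theorem roots_closed: "x \<in> roots \<Longrightarrow> y \<in> roots \<Longrightarrow> br x y \<in> zspan roots"
  using roots_normalizer zspan.base[of x roots] unfolding normalizer_def by blast

end

section \<open>Straightening\<close>

text \<open>The type class provides a unit but not \<open>0 \<noteq> 1\<close>: at this stage
  nothing is known about the nontriviality of the quotient to which this is applied.\<close>

locale straightening =
  fixes x :: "'i \<Rightarrow> 'r::{ring,monoid_mult}" and P :: "'i set" and ord :: "('i \<times> 'i) set"
  assumes lin: "linear_order_on P ord"
    and commutator: "p \<in> P \<Longrightarrow> q \<in> P \<Longrightarrow> x p * x q - x q * x p \<in> zspan (x ` P)"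
begin

definition mon :: "'i list \<Rightarrow> 'r" where
  "mon ps = prod_list (map x ps)"

lemma mon_simps [simp]: "mon [] = 1" "mon (p # ps) = x p * mon ps"
  by (simp_all add: mon_def)

definition low :: "nat \<Rightarrow> 'r set" where
  "low d = zspan {mon qs | qs. set qs \<subseteq> P \<and> length qs < d}"

fun ins :: "'i \<Rightarrow> 'i list \<Rightarrow> 'i list" where
  "ins p [] = [p]"
| "ins p (q # qs) = (if (p, q) \<in> ord then p # q # qs else q # ins p qs)"

lemma set_ins [simp]: "set (ins p qs) = insert p (set qs)"
  by (induction qs) auto

lemma length_ins [simp]: "length (ins p qs) = Suc (length qs)"
  by (induction qs) auto

lemma ord_trans: "(p, q) \<in> ord \<Longrightarrow> (q, r) \<in> ord \<Longrightarrow> (p, r) \<in> ord"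
  and ord_total: "p \<in> P \<Longrightarrow> q \<in> P \<Longrightarrow> (p, q) \<notin> ord \<Longrightarrow> (q, p) \<in> ord"
  using lin unfolding order_on_defs by (auto dest: refl_onD transD simp: total_on_def) (metis refl_onD)

abbreviation ordered :: "'i list \<Rightarrow> bool" where
  "ordered \<equiv> sorted_wrt (\<lambda>p q. (p, q) \<in> ord)"

lemma ordered_ins: "ordered qs \<Longrightarrow> p \<in> P \<Longrightarrow> set qs \<subseteq> P \<Longrightarrow> ordered (ins p qs)"
proof (induction qs)
  case (Cons q qs)
  show ?case
  proof (cases "(p, q) \<in> ord")
    case True
    then show ?thesis using Cons.prems by (auto intro: ord_trans)
  next
    case False
    then show ?thesis using Cons ord_total[of p q] by auto
  qed
qed simp

lemma low_mult_left: "y \<in> low d \<Longrightarrow> p \<in> P \<Longrightarrow> x p * y \<in> low (Suc d)"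
  unfolding low_def
proof (erule zspan_image[where \<phi> = "\<lambda>y. x p * y"])
  fix y assume "p \<in> P" "y \<in> {mon qs |qs. set qs \<subseteq> P \<and> length qs < d}"
  then obtain qs where qs: "y = mon qs" "set (p # qs) \<subseteq> P" "length (p # qs) < Suc d" by auto
  then have "x p * y = mon (p # qs)" by simp
  then show "x p * y \<in> zspan {mon qs |qs. set qs \<subseteq> P \<and> length qs < Suc d}"
    using qs by (intro zspan.base) blast
qed (simp add: distrib_left)

text \<open>Passing \<open>p\<close> across \<open>q\<close> costs a commutator, which is linear in
  the basis elements and therefore yields monomials with one factor less.\<close>

lemma mon_ins:
  assumes "p \<in> P" "set qs \<subseteq> P"
  shows "mon (p # qs) - mon (ins p qs) \<in> low (Suc (length qs))"
  using assms(2)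
proof (induction qs)
  case Nil
  then show ?case by (simp add: low_def)
next
  case (Cons q qs)
  show ?case
  proof (cases "(p, q) \<in> ord")
    case True
    then show ?thesis by (simp add: low_def)
  next
    case False
    have "(x p * x q - x q * x p) * mon qs \<in> low (Suc (length (q # qs)))"
      unfolding low_def
    proof (rule zspan_image[where \<phi> = "\<lambda>y. y * mon qs", OF commutator])
      fix y assume "y \<in> x ` P"
      then obtain r where "r \<in> P" "y * mon qs = mon (r # qs)" by auto
      then show "y * mon qs \<in> zspan {mon qs' |qs'. set qs' \<subseteq> P \<and> length qs' < Suc (length (q # qs))}"
        using Cons.prems by (intro zspan.base CollectI exI[of _ "r # qs"]) auto
    qed (use assms Cons.prems in \<open>auto simp: distrib_right\<close>)
    moreover have "x q * (mon (p # qs) - mon (ins p qs)) \<in> low (Suc (length (q # qs)))"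
      using low_mult_left[OF Cons.IH, of q] Cons.prems by simp
    ultimately have "(x p * x q - x q * x p) * mon qs + x q * (mon (p # qs) - mon (ins p qs))
        \<in> low (Suc (length (q # qs)))"
      unfolding low_def by (rule zspan.add)
    then show ?thesis using False by (simp add: algebra_simps)
  qed
qed

definition isort :: "'i list \<Rightarrow> 'i list" where
  "isort ps = foldr ins ps []"

lemma isort_simps [simp]: "isort [] = []" "isort (p # ps) = ins p (isort ps)"
  by (simp_all add: isort_def)

lemma set_isort [simp]: "set (isort ps) = set ps"
  and length_isort [simp]: "length (isort ps) = length ps"
  by (induction ps) auto

lemma ordered_isort: "set ps \<subseteq> P \<Longrightarrow> ordered (isort ps)"
  by (induction ps) (auto intro!: ordered_ins)

lemma mon_isort: "set ps \<subseteq> P \<Longrightarrow> mon ps - mon (isort ps) \<in> low (length ps)"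
proof (induction ps)
  case Nil
  then show ?case by (simp add: low_def)
next
  case (Cons p ps)
  have "x p * (mon ps - mon (isort ps)) \<in> low (length (p # ps))"
    using low_mult_left[OF Cons.IH, of p] Cons.prems by simp
  moreover have "mon (p # isort ps) - mon (ins p (isort ps)) \<in> low (length (p # ps))"
    using mon_ins[of p "isort ps"] Cons.prems by simp
  ultimately have "x p * (mon ps - mon (isort ps)) + (mon (p # isort ps) - mon (ins p (isort ps)))
      \<in> low (length (p # ps))"
    unfolding low_def by (rule zspan.add)
  then show ?case by (simp add: algebra_simps)
qed

theorem mon_in_ordered_span:
  "set ps \<subseteq> P \<Longrightarrow> mon ps \<in> zspan {mon qs | qs. set qs \<subseteq> P \<and> ordered qs}"
proof (induction "length ps" arbitrary: ps rule: less_induct)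
  case less
  have "mon ps - mon (isort ps) \<in> zspan {mon qs | qs. set qs \<subseteq> P \<and> ordered qs}"
    using mon_isort[OF less.prems] unfolding low_def
    by (rule zspan_trans) (use less.hyps in auto)
  moreover have "mon (isort ps) \<in> zspan {mon qs | qs. set qs \<subseteq> P \<and> ordered qs}"
    using less.prems ordered_isort[OF less.prems]
    by (intro zspan.base CollectI exI[of _ "isort ps"]) auto
  ultimately have "(mon ps - mon (isort ps)) + mon (isort ps)
      \<in> zspan {mon qs | qs. set qs \<subseteq> P \<and> ordered qs}"
    by (rule zspan.add)
  then show ?case by simp
qed

end

section \<open>The quotient by the deformation parameter\<close>

lemmas rel_ideal_zero = tideal.zero[of n b "rels n b" for n b, folded rel_ideal_def]
  and rel_ideal_add = tideal.add[of _ n b "rels n b" for n b, folded rel_ideal_def]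
  and rel_ideal_smul = tideal.smul[of _ n b "rels n b" for n b, folded rel_ideal_def]
  and rel_ideal_lmul = tideal.lmul[of _ n b "rels n b" for n b, folded rel_ideal_def]
  and rel_ideal_rmul = tideal.rmul[of _ n b "rels n b" for n b, folded rel_ideal_def]
  and rel_ideal_base = tideal.base[of _ "rels n b" n b for n b, folded rel_ideal_def]

abbreviation hbar :: scal where
  "hbar \<equiv> [:0, 1:]"

definition classical_ideal :: "nat \<Rightarrow> (nat \<Rightarrow> nat) \<Rightarrow> fel set" where
  "classical_ideal n b = {p + sc hbar q | p q. p \<in> rel_ideal n b \<and> q \<in> free_alg n b}"

lemma classical_idealI: "p \<in> rel_ideal n b \<Longrightarrow> q \<in> free_alg n b \<Longrightarrow> p + sc hbar q \<in> classical_ideal n b"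
  unfolding classical_ideal_def by blast

lemma classical_idealE:
  assumes "x \<in> classical_ideal n b"
  obtains p q where "p \<in> rel_ideal n b" "q \<in> free_alg n b" "x = p + sc hbar q"
  using assms unfolding classical_ideal_def by blast

lemma rel_ideal_classical: "p \<in> rel_ideal n b \<Longrightarrow> p \<in> classical_ideal n b"
  using classical_idealI[of p n b 0] by simp

lemma hbar_classical: "q \<in> free_alg n b \<Longrightarrow> sc hbar q \<in> classical_ideal n b"
  using classical_idealI[OF rel_ideal_zero, of q n b] by simp

lemma classical_ideal_0: "0 \<in> classical_ideal n b"
  using rel_ideal_classical[OF rel_ideal_zero] .

lemma classical_ideal_add:
  assumes "x \<in> classical_ideal n b" "y \<in> classical_ideal n b"
  shows "x + y \<in> classical_ideal n b"
proof -
  obtain p q where 1: "p \<in> rel_ideal n b" "q \<in> free_alg n b" "x = p + sc hbar q"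
    using assms(1) by (rule classical_idealE)
  obtain p' q' where 2: "p' \<in> rel_ideal n b" "q' \<in> free_alg n b" "y = p' + sc hbar q'"
    using assms(2) by (rule classical_idealE)
  have "x + y = (p + p') + sc hbar (q + q')"
    by (simp add: 1 2 sc_add algebra_simps)
  then show ?thesis using 1 2 by (simp only: classical_idealI rel_ideal_add free_alg_add)
qed

lemma classical_ideal_sc: "x \<in> classical_ideal n b \<Longrightarrow> sc c x \<in> classical_ideal n b"
proof (elim classical_idealE)
  fix p q assume *: "p \<in> rel_ideal n b" "q \<in> free_alg n b" "x = p + sc hbar q"
  have "sc c x = sc c p + sc hbar (sc c q)" by (simp add: * sc_add mult.commute)
  then show ?thesis using * by (simp only: classical_idealI rel_ideal_smul free_alg_sc)
qed

lemma classical_ideal_uminus: "x \<in> classical_ideal n b \<Longrightarrow> - x \<in> classical_ideal n b"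
  using classical_ideal_sc[of x n b "-1"] by (simp only: sc_minus1)

lemma classical_ideal_diff:
  "x \<in> classical_ideal n b \<Longrightarrow> y \<in> classical_ideal n b \<Longrightarrow> x - y \<in> classical_ideal n b"
  using classical_ideal_add[OF _ classical_ideal_uminus, of x n b y] by (metis diff_conv_add_uminus)

lemma classical_ideal_lmul:
  "x \<in> classical_ideal n b \<Longrightarrow> a \<in> free_alg n b \<Longrightarrow> fmul a x \<in> classical_ideal n b"
  by (elim classical_idealE)
    (simp only: fmul_add_right fmul_sc_right classical_idealI rel_ideal_lmul free_alg_fmul)

lemma classical_ideal_rmul:
  "x \<in> classical_ideal n b \<Longrightarrow> a \<in> free_alg n b \<Longrightarrow> fmul x a \<in> classical_ideal n b"
  by (elim classical_idealE)
    (simp only: fmul_add_left fmul_sc_left classical_idealI rel_ideal_rmul free_alg_fmul)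

text \<open>A type cannot depend on \<open>n\<close> and \<open>b\<close>, so the quotients by all the ideals
  are packed into one product ring; \<open>cls n b\<close> embeds the factor at \<open>(n, b)\<close>.\<close>

definition cong_rel :: "(nat \<times> (nat \<Rightarrow> nat) \<Rightarrow> fel) \<Rightarrow> (nat \<times> (nat \<Rightarrow> nat) \<Rightarrow> fel) \<Rightarrow> bool" where
  "cong_rel p q \<longleftrightarrow> (\<forall>n b. p (n, b) \<in> free_alg n b \<and> q (n, b) \<in> free_alg n b \<and>
     p (n, b) - q (n, b) \<in> classical_ideal n b)"

\<comment> \<open>The quotient is partial because only families of elements of the free algebras are
  representatives.\<close>
quotient_type classical = "nat \<times> (nat \<Rightarrow> nat) \<Rightarrow> fel" / partial: cong_rel
proof (rule part_equivpI)
  show "\<exists>x. cong_rel x x"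
    by (rule exI[of _ "\<lambda>_. 0"]) (simp add: cong_rel_def classical_ideal_0)
  show "symp cong_rel"
  proof (rule sympI)
    fix x y assume "cong_rel x y"
    then show "cong_rel y x"
      unfolding cong_rel_def using classical_ideal_uminus by (metis minus_diff_eq)
  qed
  show "transp cong_rel"
  proof (rule transpI)
    fix x y z assume *: "cong_rel x y" "cong_rel y z"
    have "x nb - z nb = (x nb - y nb) + (y nb - z nb)" for nb by simp
    then show "cong_rel x z"
      using * unfolding cong_rel_def by (metis classical_ideal_add)
  qed
qed

instantiation classical :: "{ring, monoid_mult}"
begin

lift_definition zero_classical :: classical is "\<lambda>_. 0"
  by (simp add: cong_rel_def classical_ideal_0)

lift_definition one_classical :: classical is "\<lambda>_. fone"
  by (simp add: cong_rel_def classical_ideal_0)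

lift_definition plus_classical :: "classical \<Rightarrow> classical \<Rightarrow> classical" is "\<lambda>p q nb. p nb + q nb"
  unfolding cong_rel_def by (simp only: free_alg_add add_diff_add classical_ideal_add simp_thms)

lift_definition uminus_classical :: "classical \<Rightarrow> classical" is "\<lambda>p nb. - p nb"
  unfolding cong_rel_def by (simp add: free_alg_uminus) (metis classical_ideal_uminus minus_diff_eq)

lift_definition minus_classical :: "classical \<Rightarrow> classical \<Rightarrow> classical" is "\<lambda>p q nb. p nb - q nb"
proof -
  fix p p' q q' assume *: "cong_rel p p'" "cong_rel q q'"
  have "(p nb - q nb) - (p' nb - q' nb) = (p nb - p' nb) - (q nb - q' nb)" for nb
    by simp
  then show "cong_rel (\<lambda>nb. p nb - q nb) (\<lambda>nb. p' nb - q' nb)"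
    using * unfolding cong_rel_def by (metis free_alg_diff classical_ideal_diff)
qed

lift_definition times_classical :: "classical \<Rightarrow> classical \<Rightarrow> classical" is "\<lambda>p q nb. fmul (p nb) (q nb)"
proof -
  fix p p' q q' assume *: "cong_rel p p'" "cong_rel q q'"
  have "fmul (p nb) (q nb) - fmul (p' nb) (q' nb) =
      fmul (p nb - p' nb) (q nb) + fmul (p' nb) (q nb - q' nb)" for nb
    by (simp add: fmul_diff_left fmul_diff_right)
  then show "cong_rel (\<lambda>nb. fmul (p nb) (q nb)) (\<lambda>nb. fmul (p' nb) (q' nb))"
    using * unfolding cong_rel_def
    by (simp only: free_alg_fmul classical_ideal_add classical_ideal_lmul classical_ideal_rmul simp_thms)
qed

instance
proof
  fix x y z :: classical
  show "x + y + z = x + (y + z)"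
    by transfer (simp add: cong_rel_def free_alg_closed classical_ideal_0 add.assoc)
  show "x + y = y + x"
    by transfer (simp add: cong_rel_def free_alg_closed classical_ideal_0 add.commute)
  show "0 + x = x"
    by transfer (simp add: cong_rel_def free_alg_closed classical_ideal_0)
  show "- x + x = 0"
    by transfer (simp add: cong_rel_def free_alg_closed classical_ideal_0)
  show "x - y = x + - y"
    by transfer (simp add: cong_rel_def free_alg_closed classical_ideal_0)
  show "x * y * z = x * (y * z)"
    by transfer (simp add: cong_rel_def free_alg_closed classical_ideal_0 fmul_assoc)
  show "1 * x = x" "x * 1 = x"
    by (transfer, simp add: cong_rel_def free_alg_closed classical_ideal_0)+
  show "(x + y) * z = x * z + y * z"
    by transfer (simp add: cong_rel_def free_alg_closed classical_ideal_0 fmul_add_left)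
  show "x * (y + z) = x * y + x * z"
    by transfer (simp add: cong_rel_def free_alg_closed classical_ideal_0 fmul_add_right)
qed

end

lemma classical_no_2_torsion: "x + x = 0 \<Longrightarrow> x = 0" for x :: classical
proof transfer
  fix x assume *: "cong_rel x x" "cong_rel (\<lambda>nb. x nb + x nb) (\<lambda>_. 0)"
  have "x nb = sc [:1/2:] (x nb + x nb)" for nb
    unfolding sc_add sc_add_left[symmetric] by (simp flip: one_pCons)
  then show "cong_rel x (\<lambda>_. 0)"
    using * unfolding cong_rel_def by (metis classical_ideal_sc diff_zero)
qed

lift_definition cls :: "nat \<Rightarrow> (nat \<Rightarrow> nat) \<Rightarrow> fel \<Rightarrow> classical" is
  "\<lambda>n b x nb. if nb = (n, b) \<and> x \<in> free_alg n b then x else 0"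
  by (auto simp: cong_rel_def classical_ideal_0)

context
  fixes n :: nat and b :: "nat \<Rightarrow> nat"
begin

lemma cls_eq_iff:
  assumes "x \<in> free_alg n b" "y \<in> free_alg n b"
  shows "cls n b x = cls n b y \<longleftrightarrow> x - y \<in> classical_ideal n b"
  using assms by transfer (auto simp: cong_rel_def classical_ideal_0)

lemma cls_zero: "cls n b 0 = 0"
  by transfer (auto simp: cong_rel_def classical_ideal_0)

lemma cls_add: "x \<in> free_alg n b \<Longrightarrow> y \<in> free_alg n b \<Longrightarrow> cls n b (x + y) = cls n b x + cls n b y"
  by transfer (auto simp: cong_rel_def classical_ideal_0 free_alg_closed)

lemma cls_uminus: "x \<in> free_alg n b \<Longrightarrow> cls n b (- x) = - cls n b x"
  by transfer (auto simp: cong_rel_def classical_ideal_0 free_alg_closed)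

lemma cls_diff: "x \<in> free_alg n b \<Longrightarrow> y \<in> free_alg n b \<Longrightarrow> cls n b (x - y) = cls n b x - cls n b y"
  by transfer (auto simp: cong_rel_def classical_ideal_0 free_alg_closed)

lemma cls_fmul: "x \<in> free_alg n b \<Longrightarrow> y \<in> free_alg n b \<Longrightarrow> cls n b (fmul x y) = cls n b x * cls n b y"
  by transfer (auto simp: cong_rel_def classical_ideal_0 free_alg_closed)

lemma cls_comm:
  "x \<in> free_alg n b \<Longrightarrow> y \<in> free_alg n b \<Longrightarrow>
    cls n b (comm x y) = cls n b x * cls n b y - cls n b y * cls n b x"
  by (simp add: comm_def cls_diff cls_fmul free_alg_closed)

lemma cls_ideal: "x \<in> classical_ideal n b \<Longrightarrow> x \<in> free_alg n b \<Longrightarrow> cls n b x = 0"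
  using cls_eq_iff[of x 0] by (simp add: cls_zero)

end

section \<open>The current algebra relations in the quotient\<close>

lemma rels_intros:
  assumes "idx n i" "idx n j"
  shows "s \<ge> - int (b i) \<Longrightarrow> s' \<ge> - int (b j) \<Longrightarrow> comm (g (H i s)) (g (H j s')) \<in> rels n b"
    and "comm (g (E i r)) (g (F j r')) - (if i = j then g (H i (int r + int r')) else 0) \<in> rels n b"
    and "comm (g (H i (- int (b i)))) (g (E j r)) - sc (of_int (cartan i j)) (g (E j r)) \<in> rels n b"
    and "s \<ge> - int (b i) \<Longrightarrow> comm (g (H i (s + 1))) (g (E j r)) - comm (g (H i s)) (g (E j (Suc r)))
       - sc (of_int (cartan i j) * hb2) (acomm (g (H i s)) (g (E j r))) \<in> rels n b"
    and "comm (g (H i (- int (b i)))) (g (F j r)) + sc (of_int (cartan i j)) (g (F j r)) \<in> rels n b"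
    and "s \<ge> - int (b i) \<Longrightarrow> comm (g (H i (s + 1))) (g (F j r)) - comm (g (H i s)) (g (F j (Suc r)))
       + sc (of_int (cartan i j) * hb2) (acomm (g (H i s)) (g (F j r))) \<in> rels n b"
    and "comm (g (E i (Suc r))) (g (E j r')) - comm (g (E i r)) (g (E j (Suc r')))
       - sc (of_int (cartan i j) * hb2) (acomm (g (E i r)) (g (E j r'))) \<in> rels n b"
    and "comm (g (F i (Suc r))) (g (F j r')) - comm (g (F i r)) (g (F j (Suc r')))
       + sc (of_int (cartan i j) * hb2) (acomm (g (F i r)) (g (F j r'))) \<in> rels n b"
    and "cartan i j = 0 \<Longrightarrow> comm (g (E i r)) (g (E j r')) \<in> rels n b"
    and "cartan i j = 0 \<Longrightarrow> comm (g (F i r)) (g (F j r')) \<in> rels n b"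
    and "cartan i j = -1 \<Longrightarrow> comm (g (E i r1)) (comm (g (E i r2)) (g (E j r')))
       + comm (g (E i r2)) (comm (g (E i r1)) (g (E j r'))) \<in> rels n b"
    and "cartan i j = -1 \<Longrightarrow> comm (g (F i r1)) (comm (g (F i r2)) (g (F j r')))
       + comm (g (F i r2)) (comm (g (F i r1)) (g (F j r'))) \<in> rels n b"
  using assms unfolding rels_def apply -
  subgoal by (rule UnI1, rule UnI1, rule UnI1, rule UnI1, rule UnI1, rule UnI1, rule UnI1, rule UnI1, rule UnI1, rule UnI1, rule UnI1, blast)
  subgoal by (rule UnI1, rule UnI1, rule UnI1, rule UnI1, rule UnI1, rule UnI1, rule UnI1, rule UnI1, rule UnI1, rule UnI1, rule UnI2, blast)
  subgoal by (rule UnI1, rule UnI1, rule UnI1, rule UnI1, rule UnI1, rule UnI1, rule UnI1, rule UnI1, rule UnI1, rule UnI2, blast)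
  subgoal by (rule UnI1, rule UnI1, rule UnI1, rule UnI1, rule UnI1, rule UnI1, rule UnI1, rule UnI1, rule UnI2, blast)
  subgoal by (rule UnI1, rule UnI1, rule UnI1, rule UnI1, rule UnI1, rule UnI1, rule UnI1, rule UnI2, blast)
  subgoal by (rule UnI1, rule UnI1, rule UnI1, rule UnI1, rule UnI1, rule UnI1, rule UnI2, blast)
  subgoal by (rule UnI1, rule UnI1, rule UnI1, rule UnI1, rule UnI1, rule UnI2, blast)
  subgoal by (rule UnI1, rule UnI1, rule UnI1, rule UnI1, rule UnI2, blast)
  subgoal by (rule UnI1, rule UnI1, rule UnI1, rule UnI2, blast)
  subgoal by (rule UnI1, rule UnI1, rule UnI2, blast)
  subgoal by (rule UnI1, rule UnI2, blast)
  subgoal by (rule UnI2, blast)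
  done

lemma hb2_factor: "of_int c * hb2 = hbar * [:of_int c / 2:]"
  by (simp add: hb2_def of_int_poly)

lemma hb2_classical: "q \<in> free_alg n b \<Longrightarrow> sc (of_int c * hb2) q \<in> classical_ideal n b"
  using hbar_classical[of "sc [:of_int c / 2:] q" n b] by (simp only: hb2_factor sc_sc free_alg_sc)

context
  fixes n :: nat and b :: "nat \<Rightarrow> nat"
begin

definition cur_e :: "nat \<Rightarrow> nat \<Rightarrow> classical" where "cur_e i r = cls n b (g (E i r))"
definition cur_f :: "nat \<Rightarrow> nat \<Rightarrow> classical" where "cur_f i r = cls n b (g (F i r))"
definition cur_h :: "nat \<Rightarrow> nat \<Rightarrow> classical" where "cur_h i m = cls n b (g (H i (int m - int (b i))))"

lemma cls_rel: "x \<in> rels n b \<Longrightarrow> cls n b x = 0"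
  using cls_ideal[of x n b] rel_ideal_classical[OF rel_ideal_base] subsetD[OF rels_free_alg] by simp

lemma cls_hb2: "q \<in> free_alg n b \<Longrightarrow> cls n b (sc (of_int c * hb2) q) = 0"
  by (rule cls_ideal) (simp_all only: hb2_classical free_alg_sc)

lemma valid_E: "idx n i \<Longrightarrow> g (E i r) \<in> free_alg n b"
  and valid_F: "idx n i \<Longrightarrow> g (F i r) \<in> free_alg n b"
  and valid_H: "idx n i \<Longrightarrow> s \<ge> - int (b i) \<Longrightarrow> g (H i s) \<in> free_alg n b"
  by (auto intro: free_alg_g)

lemmas valid_gens = valid_E valid_F valid_H
lemmas cls_simps = cls_add cls_diff cls_uminus cls_comm cls_hb2 cls_zero

abbreviation br :: "classical \<Rightarrow> classical \<Rightarrow> classical" where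
  "br x y \<equiv> x * y - y * x"

text \<open>The quotient ring carries no scalar multiplication, so the Cartan integers 2, -1 and 0
  are spelled out as additive operations.\<close>

definition cint :: "int \<Rightarrow> classical \<Rightarrow> classical" where
  "cint c x = (if c = 2 then x + x else if c = -1 then - x else 0)"

lemma cls_cartan:
  assumes "x \<in> free_alg n b"
  shows "cls n b (sc (of_int (cartan i j)) x) = cint (cartan i j) (cls n b x)"
proof -
  have "cls n b (sc 2 x) = cls n b x + cls n b x"
    using sc_add_left[of 1 1 x] assms by (simp only: one_add_one sc_1 cls_add)
  then show ?thesis using assms
    by (auto simp: cartan_def cint_def sc_minus1 cls_simps)
qed

lemma current_shift_e:
  assumes "idx n i" "idx n j" shows "br (cur_e i (Suc r)) (cur_e j s) = br (cur_e i r) (cur_e j (Suc s))"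
  using cls_rel[OF rels_intros(7)[OF assms, of r s b]] assms
  by (simp add: cls_simps free_alg_closed cur_e_def valid_gens)

lemma current_shift_f:
  assumes "idx n i" "idx n j" shows "br (cur_f i (Suc r)) (cur_f j s) = br (cur_f i r) (cur_f j (Suc s))"
  using cls_rel[OF rels_intros(8)[OF assms, of r s b]] assms
  by (simp add: cls_simps free_alg_closed cur_f_def valid_gens)

text \<open>Modulo \<open>hbar\<close> the shift relation moves one unit of index from
  \<open>h\<close> to \<open>e\<close>. Everything reduces to the lowest mode, whose bracket is
  given by the Cartan matrix.\<close>

lemma current_he:
  assumes "idx n i" "idx n j" shows "br (cur_h i m) (cur_e j r) = cint (cartan i j) (cur_e j (r + m))"
proof (induction m arbitrary: r)
  case 0
  then show ?case
    using cls_rel[OF rels_intros(3)[OF assms, of b r]] assms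
    by (simp add: cls_simps free_alg_closed cur_e_def cur_h_def valid_gens cls_cartan)
next
  case (Suc m)
  have eq: "int (Suc m) - int (b i) = int m - int (b i) + 1" by simp
  have "br (cur_h i (Suc m)) (cur_e j r) = br (cur_h i m) (cur_e j (Suc r))"
    using cls_rel[OF rels_intros(4)[OF assms, of b "int m - int (b i)" r]] assms
    unfolding cur_h_def eq by (simp add: cls_simps free_alg_closed cur_e_def valid_gens)
  then show ?case using Suc[of "Suc r"] by simp
qed

lemma current_hf:
  assumes "idx n i" "idx n j" shows "br (cur_f j r) (cur_h i m) = cint (cartan i j) (cur_f j (r + m))"
proof (induction m arbitrary: r)
  case 0
  then show ?case
    using cls_rel[OF rels_intros(5)[OF assms, of b r]] assms
    by (simp add: cls_simps free_alg_closed cur_f_def cur_h_def valid_gens cls_cartan algebra_simps)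
next
  case (Suc m)
  have eq: "int (Suc m) - int (b i) = int m - int (b i) + 1" by simp
  have "br (cur_h i (Suc m)) (cur_f j r) = br (cur_h i m) (cur_f j (Suc r))"
    using cls_rel[OF rels_intros(6)[OF assms, of b "int m - int (b i)" r]] assms
    unfolding cur_h_def eq by (simp add: cls_simps free_alg_closed cur_f_def valid_gens)
  then have "br (cur_f j r) (cur_h i (Suc m)) = br (cur_f j (Suc r)) (cur_h i m)"
    by (metis minus_diff_eq)
  then show ?case using Suc[of "Suc r"] by simp
qed

lemma current_ef:
  assumes "idx n i" "idx n j"
  shows "br (cur_e i r) (cur_f j s) = (if i = j then cur_h i (r + s + b i) else 0)"
  using cls_rel[OF rels_intros(2)[OF assms, of r s b]] assms
  by (auto simp: cls_simps free_alg_closed cur_e_def cur_f_def cur_h_def valid_gens)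

lemma cartan_adjacent: "cartan i j = -1 \<longleftrightarrow> adjacent i j"
  and cartan_far: "cartan i j = 0 \<longleftrightarrow> i \<noteq> j \<and> \<not> adjacent i j"
  and cartan_same: "cartan i i = 2"
  by (auto simp: cartan_def adjacent_def)

lemma classical_current: "shifted_current br cur_e cur_f cur_h (idx n) b"
proof
  show "br (cur_h i m) (cur_h j m') = 0" if "idx n i" "idx n j" for i j m m'
    using cls_rel[OF rels_intros(1)[OF that, of b "int m - int (b i)" "int m' - int (b j)"]] that
    by (simp add: cls_simps free_alg_closed cur_h_def valid_gens)
  show "br (cur_e i r) (cur_e j s) = 0" if "idx n i" "idx n j" "i \<noteq> j" "\<not> adjacent i j" for i j r s
    using cls_rel[OF rels_intros(9)[OF that(1,2), of r s b]] that
    by (simp add: cls_simps free_alg_closed cur_e_def valid_gens cartan_far)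
  show "br (cur_f i r) (cur_f j s) = 0" if "idx n i" "idx n j" "i \<noteq> j" "\<not> adjacent i j" for i j r s
    using cls_rel[OF rels_intros(10)[OF that(1,2), of r s b]] that
    by (simp add: cls_simps free_alg_closed cur_f_def valid_gens cartan_far)
  show "br (cur_e i r) (br (cur_e i s) (cur_e j t)) + br (cur_e i s) (br (cur_e i r) (cur_e j t)) = 0"
    if "idx n i" "idx n j" "adjacent i j" for i j r s t
    using cls_rel[OF rels_intros(11)[OF that(1,2), of r s t b]] that
    by (simp add: cls_simps free_alg_closed cur_e_def valid_gens cartan_adjacent)
  show "br (cur_f i r) (br (cur_f i s) (cur_f j t)) + br (cur_f i s) (br (cur_f i r) (cur_f j t)) = 0"
    if "idx n i" "idx n j" "adjacent i j" for i j r s t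
    using cls_rel[OF rels_intros(12)[OF that(1,2), of r s t b]] that
    by (simp add: cls_simps free_alg_closed cur_f_def valid_gens cartan_adjacent)
  show "x = 0" if "x + x = 0" for x :: classical
    using classical_no_2_torsion that .
  show "br (cur_e i (Suc r)) (cur_e j s) = br (cur_e i r) (cur_e j (Suc s))" if "idx n i" "idx n j" for i j r s
    using current_shift_e[OF that] .
  show "br (cur_f i (Suc r)) (cur_f j s) = br (cur_f i r) (cur_f j (Suc s))" if "idx n i" "idx n j" for i j r s
    using current_shift_f[OF that] .
  show "br (cur_h i m) (cur_e i r) = cur_e i (r + m) + cur_e i (r + m)" if "idx n i" for i m r
    using current_he[OF that that] by (simp add: cint_def cartan_same)
  show "br (cur_f i r) (cur_h i m) = cur_f i (r + m) + cur_f i (r + m)" if "idx n i" for i m r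
    using current_hf[OF that that] by (simp add: cint_def cartan_same)
  show "br (cur_h i m) (cur_e j r) = - cur_e j (r + m)" if "idx n i" "idx n j" "adjacent i j" for i j m r
    using current_he[OF that(1,2)] that(3) by (simp add: cint_def flip: cartan_adjacent)
  show "br (cur_f j r) (cur_h i m) = - cur_f j (r + m)" if "idx n i" "idx n j" "adjacent i j" for i j m r
    using current_hf[OF that(1,2)] that(3) by (simp add: cint_def flip: cartan_adjacent)
  show "br (cur_h i m) (cur_e j r) = 0" if "idx n i" "idx n j" "i \<noteq> j" "\<not> adjacent i j" for i j m r
    using current_he[OF that(1,2)] cartan_far[of i j] that(3,4) by (simp add: cint_def)
  show "br (cur_f j r) (cur_h i m) = 0" if "idx n i" "idx n j" "i \<noteq> j" "\<not> adjacent i j" for i j m r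
    using current_hf[OF that(1,2)] cartan_far[of i j] that(3,4) by (simp add: cint_def)
  show "br (cur_e i r) (cur_f i s) = cur_h i (r + s + b i)" if "idx n i" for i r s
    using current_ef[OF that that] by simp
  show "br (cur_e i r) (cur_f j s) = 0" if "idx n i" "idx n j" "i \<noteq> j" for i j r s
    using current_ef[OF that(1,2)] that(3) by simp
  show "idx n k" if "idx n i" "idx n j" "i \<le> k" "k \<le> j" for i j k
    using that by (auto simp: idx_def)
qed (simp_all add: algebra_simps)

interpretation cur: shifted_current br cur_e cur_f cur_h "idx n" b
  by (rule classical_current)

lemma cls_eroot: "idx n j \<Longrightarrow> idx n i \<Longrightarrow> j \<le> i \<Longrightarrow> cls n b (eroot j i r) = cur.er j i r"
proof -
  assume "idx n j" "idx n i" "j \<le> i"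
  moreover have "cls n b (foldl (\<lambda>acc k. comm acc (g (E k 0))) y ks) = foldl (\<lambda>x k. br x (cur_e k 0)) (cls n b y) ks"
    if "y \<in> free_alg n b" "\<forall>k\<in>set ks. idx n k" for y ks
    using that by (induction ks arbitrary: y) (simp_all add: cls_comm free_alg_comm valid_gens cur_e_def)
  from this[of "g (E j r)" "[Suc j..<Suc i]"] have "idx n j \<Longrightarrow> idx n i \<Longrightarrow> j \<le> i \<Longrightarrow> ?thesis"
    by (simp add: eroot_def cur.er.simps cur_e_def valid_gens idx_def del: upt_Suc)
  ultimately show ?thesis by blast
qed

lemma cls_froot: "idx n j \<Longrightarrow> idx n i \<Longrightarrow> j \<le> i \<Longrightarrow> cls n b (froot j i r) = cur.fr j i r"
proof -
  assume "idx n j" "idx n i" "j \<le> i"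
  moreover have "cls n b (foldl (\<lambda>acc k. comm (g (F k 0)) acc) y ks) = foldl (\<lambda>x k. br (cur_f k 0) x) (cls n b y) ks"
    if "y \<in> free_alg n b" "\<forall>k\<in>set ks. idx n k" for y ks
    using that by (induction ks arbitrary: y) (simp_all add: cls_comm free_alg_comm valid_gens cur_f_def)
  from this[of "g (F j r)" "[Suc j..<Suc i]"] have "idx n j \<Longrightarrow> idx n i \<Longrightarrow> j \<le> i \<Longrightarrow> ?thesis"
    by (simp add: froot_def cur.fr_def cur_f_def valid_gens idx_def del: upt_Suc)
  ultimately show ?thesis by blast
qed

section \<open>Ordered monomials modulo the deformation parameter\<close>

definition cpbw :: "pbw \<Rightarrow> classical" where
  "cpbw p = cls n b (pbw_el p)"

lemma cpbw_image: "cpbw ` pbw_gens n b = cur.roots"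
proof (intro equalityI subsetI)
  fix x assume "x \<in> cpbw ` pbw_gens n b"
  then obtain p where p: "valid_pbw n b p" "x = cpbw p" by (auto simp: pbw_gens_def)
  show "x \<in> cur.roots"
  proof (cases p)
    case (PE j i r)
    then have "x = cur.er j i r" "j \<le> i" "idx n j" "idx n i"
      using p by (auto simp: cpbw_def idx_def intro!: cls_eroot)
    then show ?thesis by (auto simp: cur.roots_def cur.eroots_def)
  next
    case (PF j i r)
    then have "x = cur.fr j i r" "j \<le> i" "idx n j" "idx n i"
      using p by (auto simp: cpbw_def idx_def intro!: cls_froot)
    then show ?thesis by (auto simp: cur.roots_def cur.froots_def)
  next
    case (PH i s)
    then have "x = cur_h i (nat (s + int (b i)))" "idx n i"
      using p by (auto simp: cpbw_def cur_h_def)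
    then show ?thesis by (auto simp: cur.roots_def cur.hs_def)
  qed
next
  fix x assume "x \<in> cur.roots"
  then consider j i r where "x = cur.er j i r" "j \<le> i" "idx n j" "idx n i"
    | j i r where "x = cur.fr j i r" "j \<le> i" "idx n j" "idx n i" | i m where "x = cur_h i m" "idx n i"
    unfolding cur.roots_def cur.eroots_def cur.froots_def cur.hs_def by blast
  then show "x \<in> cpbw ` pbw_gens n b"
  proof cases
    case 1
    then have "x = cpbw (PE j i r)" "valid_pbw n b (PE j i r)"
      by (auto simp: cpbw_def cls_eroot idx_def)
    then show ?thesis by (auto simp: pbw_gens_def)
  next
    case 2
    then have "x = cpbw (PF j i r)" "valid_pbw n b (PF j i r)"
      by (auto simp: cpbw_def cls_froot idx_def)
    then show ?thesis by (auto simp: pbw_gens_def)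
  next
    case 3
    then have "x = cpbw (PH i (int m - int (b i)))" "valid_pbw n b (PH i (int m - int (b i)))"
      by (auto simp: cpbw_def cur_h_def)
    then show ?thesis by (auto simp: pbw_gens_def)
  qed
qed

lemma straightening_cpbw:
  assumes "linear_order_on (pbw_gens n b) ord"
  shows "straightening cpbw (pbw_gens n b) ord"
proof
  show "cpbw p * cpbw q - cpbw q * cpbw p \<in> zspan (cpbw ` pbw_gens n b)"
    if "p \<in> pbw_gens n b" "q \<in> pbw_gens n b" for p q
    using cur.roots_closed[of "cpbw p" "cpbw q"] that cpbw_image by auto
qed fact

fun gen_pbw :: "gen \<Rightarrow> pbw" where
  "gen_pbw (E i r) = PE i i r" | "gen_pbw (F i r) = PF i i r" | "gen_pbw (H i s) = PH i s"

lemma pbw_el_gen_pbw: "pbw_el (gen_pbw x) = g x"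
  by (cases x) (simp_all add: eroot_def froot_def)

lemma gen_pbw_valid: "valid_gen n b x \<Longrightarrow> gen_pbw x \<in> pbw_gens n b"
  by (cases x) (auto simp: pbw_gens_def idx_def)

text \<open>\<open>cls n b fone\<close> is the idempotent of the factor at \<open>(n, b)\<close> and
  not the unit of the product ring, while an empty product is that unit; the extra factor cuts back
  to the relevant component.\<close>

lemma cls_pbw_mon:
  "set ps \<subseteq> pbw_gens n b \<Longrightarrow> cls n b fone * prod_list (map cpbw ps) = cls n b (pbw_mon ps)"
proof (induction ps)
  case (Cons p ps)
  have p: "pbw_el p \<in> free_alg n b" and ps: "pbw_mon ps \<in> free_alg n b"
    using Cons.prems pbw_mon_free_alg[of ps n b] by (simp_all add: pbw_gens_def pbw_el_free_alg)
  have "cls n b fone * cpbw p = cpbw p * cls n b fone"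
    using p by (simp add: cpbw_def flip: cls_fmul)
  then have "cls n b fone * prod_list (map cpbw (p # ps)) = cpbw p * (cls n b fone * prod_list (map cpbw ps))"
    by (simp flip: mult.assoc)
  also have "\<dots> = cpbw p * cls n b (pbw_mon ps)"
    using Cons by simp
  also have "\<dots> = cls n b (pbw_mon (p # ps))"
    using p ps by (simp add: cpbw_def cls_fmul)
  finally show ?case .
qed simp

lemma pbw_mon_gen_pbw: "pbw_mon (map gen_pbw w) = word w"
  by (induction w) (simp_all add: fone_eq_word pbw_el_gen_pbw g_def fmul_word_word)

lemma zspan_cls:
  assumes "y \<in> zspan (cls n b ` M)" "M \<subseteq> free_alg n b"
  shows "\<exists>m \<in> zspan M. m \<in> free_alg n b \<and> y = cls n b m"
  using assms(1)
proof induction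
  case zero
  then show ?case by (intro bexI[of _ 0]) (auto simp: cls_zero)
next
  case (base x)
  then show ?case using assms(2) by (auto intro: zspan.base)
next
  case (add x y)
  then obtain p q where "p \<in> zspan M" "p \<in> free_alg n b" "x = cls n b p"
    "q \<in> zspan M" "q \<in> free_alg n b" "y = cls n b q" by blast
  then show ?case by (intro bexI[of _ "p + q"]) (auto simp: cls_add free_alg_add intro: zspan.add)
next
  case (uminus x)
  then obtain p where "p \<in> zspan M" "p \<in> free_alg n b" "x = cls n b p" by blast
  then show ?case by (intro bexI[of _ "- p"]) (auto simp: cls_uminus free_alg_uminus intro: zspan.uminus)
qed

lemma word_classical_span:
  assumes ord: "linear_order_on (pbw_gens n b) ord" and w: "\<forall>x\<in>set w. valid_gen n b x"
  shows "\<exists>m \<in> zspan (pbw_mon ` {ps. ordered_pbw n b ord ps}). m \<in> free_alg n b \<and>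
    word w - m \<in> classical_ideal n b"
proof -
  interpret straightening cpbw "pbw_gens n b" ord
    by (rule straightening_cpbw[OF ord])
  let ?O = "{ps. ordered_pbw n b ord ps}"
  \<comment> \<open>A word is itself a monomial in simple root vectors and Cartan elements, so
    straightening applies to it.\<close>
  have valid: "set (map gen_pbw w) \<subseteq> pbw_gens n b"
    using w by (auto simp: gen_pbw_valid)
  have "cls n b fone * mon (map gen_pbw w) \<in> zspan (cls n b ` pbw_mon ` ?O)"
  proof (rule zspan_image[where \<phi> = "\<lambda>y. cls n b fone * y", OF mon_in_ordered_span[OF valid]])
    fix y assume "y \<in> {mon qs |qs. set qs \<subseteq> pbw_gens n b \<and> ordered qs}"
    then obtain qs where "y = mon qs" "set qs \<subseteq> pbw_gens n b" "ordered qs" by auto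
    then show "cls n b fone * y \<in> zspan (cls n b ` pbw_mon ` ?O)"
      by (auto simp: mon_def cls_pbw_mon ordered_pbw_def intro!: zspan.base)
  qed (rule distrib_left)
  then have "cls n b (word w) \<in> zspan (cls n b ` pbw_mon ` ?O)"
    using valid by (simp only: mon_def cls_pbw_mon pbw_mon_gen_pbw)
  moreover have "pbw_mon ` ?O \<subseteq> free_alg n b"
    by (auto simp: ordered_pbw_def pbw_mon_free_alg)
  ultimately obtain m where "m \<in> zspan (pbw_mon ` ?O)" "m \<in> free_alg n b" "cls n b (word w) = cls n b m"
    using zspan_cls by blast
  then show ?thesis using w by (auto simp: cls_eq_iff free_alg_word)
qed

end

section \<open>Grading and spanning\<close>

text \<open>Degrees for which all defining relations are homogeneous, where \<open>hbar\<close> has degree 1.\<close>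

fun gdeg :: "(nat \<Rightarrow> nat) \<Rightarrow> gen \<Rightarrow> nat" where
  "gdeg b (E i r) = r" | "gdeg b (F i r) = r + b i" | "gdeg b (H i s) = nat (s + int (b i))"

definition wdeg :: "(nat \<Rightarrow> nat) \<Rightarrow> gen list \<Rightarrow> nat" where
  "wdeg b w = sum_list (map (gdeg b) w)"

lemma wdeg_append: "wdeg b (u @ v) = wdeg b u + wdeg b v"
  by (simp add: wdeg_def)

lemma wdeg_split: "wdeg b (take k w) + wdeg b (drop k w) = wdeg b w"
  by (simp flip: wdeg_append)

definition homog :: "(nat \<Rightarrow> nat) \<Rightarrow> nat \<Rightarrow> fel \<Rightarrow> bool" where
  "homog b D p \<longleftrightarrow> (\<forall>w k. coeff (p w) k \<noteq> 0 \<longrightarrow> k + wdeg b w = D)"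

definition proj :: "(nat \<Rightarrow> nat) \<Rightarrow> nat \<Rightarrow> fel \<Rightarrow> fel" where
  "proj b D p = (\<lambda>w. if wdeg b w \<le> D then monom (coeff (p w) (D - wdeg b w)) (D - wdeg b w) else 0)"

lemma coeff_proj: "coeff (proj b D p w) k = (if k + wdeg b w = D then coeff (p w) k else 0)"
  by (auto simp: proj_def)

lemma fel_eqI: "(\<And>w k. coeff (p w) k = coeff (q w) k) \<Longrightarrow> p = q" for p q :: fel
  by (intro ext poly_eqI)

lemma proj_add: "proj b D (p + q) = proj b D p + proj b D q"
  by (rule fel_eqI) (simp add: coeff_proj fun_app)

lemma proj_homog: "homog b D (proj b D p)"
  by (simp add: homog_def coeff_proj)

lemma proj_of_homog: "homog b D p \<Longrightarrow> proj b D' p = (if D = D' then p else 0)"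
  by (rule fel_eqI) (auto simp: homog_def coeff_proj fun_app)

lemma proj_hbar: "proj b D (sc hbar p) = (if D = 0 then 0 else sc hbar (proj b (D - 1) p))"
proof (rule fel_eqI)
  fix w k
  show "coeff (proj b D (sc hbar p) w) k =
      coeff ((if D = 0 then 0 else sc hbar (proj b (D - 1) p)) w) k"
    by (cases k) (auto simp: coeff_proj sc_def fun_app)
qed

lemma proj_free_alg: "p \<in> free_alg n b \<Longrightarrow> proj b D p \<in> free_alg n b"
proof -
  assume p: "p \<in> free_alg n b"
  have sub: "p w \<noteq> 0" if "proj b D p w \<noteq> 0" for w
    using that by (auto simp: proj_def split: if_splits)
  then have "{w. proj b D p w \<noteq> 0} \<subseteq> {w. p w \<noteq> 0}" by blast
  then show ?thesis using p sub unfolding free_alg_def by (auto intro: finite_subset)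
qed

lemma proj_fmul: "proj b D (fmul p q) = (\<Sum>k\<le>D. fmul (proj b k p) (proj b (D - k) q))"
proof (rule fel_eqI)
  fix w m
  let ?p = "\<lambda>j i. coeff (p (take j w)) i" and ?q = "\<lambda>j i. coeff (q (drop j w)) (m - i)"
  \<comment> \<open>For a fixed cut of the word and a fixed split of the power of
    \<open>hbar\<close>, exactly one degree \<open>k\<close> of the left factor contributes, and
    only if the total degree is \<open>D\<close>.\<close>
  have inner: "(\<Sum>k\<le>D. coeff (proj b k p (take j w)) i * coeff (proj b (D - k) q (drop j w)) (m - i))
      = (if m + wdeg b w = D then ?p j i * ?q j i else 0)"
    if "j \<le> length w" "i \<le> m" for i j
  proof -
    have "coeff (proj b k p (take j w)) i * coeff (proj b (D - k) q (drop j w)) (m - i)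
        = (if k = i + wdeg b (take j w) then (if m + wdeg b w = D then ?p j i * ?q j i else 0) else 0)"
      if "k \<le> D" for k
      using that \<open>i \<le> m\<close> wdeg_split[of b j w] by (auto simp: coeff_proj)
    then have "(\<Sum>k\<le>D. coeff (proj b k p (take j w)) i * coeff (proj b (D - k) q (drop j w)) (m - i))
        = (\<Sum>k\<le>D. if k = i + wdeg b (take j w) then (if m + wdeg b w = D then ?p j i * ?q j i else 0) else 0)"
      by (intro sum.cong) auto
    also have "\<dots> = (if m + wdeg b w = D then ?p j i * ?q j i else 0)"
      using \<open>i \<le> m\<close> wdeg_split[of b j w] by (auto simp: sum.delta)
    finally show ?thesis .
  qed
  have "coeff ((\<Sum>k\<le>D. fmul (proj b k p) (proj b (D - k) q)) w) m
      = (\<Sum>k\<le>D. \<Sum>j\<le>length w. \<Sum>i\<le>m.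
          coeff (proj b k p (take j w)) i * coeff (proj b (D - k) q (drop j w)) (m - i))"
    by (simp add: fun_sum_apply fmul_def coeff_sum coeff_mult)
  also have "\<dots> = (\<Sum>j\<le>length w. \<Sum>i\<le>m. \<Sum>k\<le>D.
          coeff (proj b k p (take j w)) i * coeff (proj b (D - k) q (drop j w)) (m - i))"
    by (subst sum.swap, rule sum.cong[OF refl], rule sum.swap)
  also have "\<dots> = (\<Sum>j\<le>length w. \<Sum>i\<le>m. if m + wdeg b w = D then ?p j i * ?q j i else 0)"
    by (intro sum.cong refl inner) auto
  also have "\<dots> = coeff (proj b D (fmul p q) w) m"
    by (simp add: coeff_proj fmul_def coeff_sum coeff_mult)
  finally show "coeff (proj b D (fmul p q) w) m =
    coeff ((\<Sum>k\<le>D. fmul (proj b k p) (proj b (D - k) q)) w) m" ..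
qed

lemma homog_add: "homog b D p \<Longrightarrow> homog b D q \<Longrightarrow> homog b D (p + q)"
  and homog_diff: "homog b D p \<Longrightarrow> homog b D q \<Longrightarrow> homog b D (p - q)"
  and homog_0 [simp]: "homog b D 0"
  unfolding homog_def by (simp_all add: fun_app) (metis add_0, metis diff_zero eq_iff_diff_eq_0)

lemma homog_word: "homog b (wdeg b w) (word w)"
  by (simp add: homog_def word_def coeff_1)

lemma homog_g: "D = gdeg b x \<Longrightarrow> homog b D (g x)"
  using homog_word[of b "[x]"] by (simp add: g_def wdeg_def)

lemma homog_monom: "homog b D p \<Longrightarrow> homog b (k + D) (sc (monom c k) p)"
  unfolding homog_def
proof (intro allI impI)
  fix w m assume p: "\<forall>w k. coeff (p w) k \<noteq> 0 \<longrightarrow> k + wdeg b w = D"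
    and "coeff (sc (monom c k) p w) m \<noteq> 0"
  then have "k \<le> m" "coeff (p w) (m - k) \<noteq> 0"
    by (auto simp: sc_def coeff_monom_mult split: if_splits)
  with p have "k \<le> m" "m - k + wdeg b w = D" by auto
  then show "m + wdeg b w = k + D" by simp
qed

lemma homog_fmul:
  assumes "homog b D p" "homog b D' q"
  shows "homog b (D + D') (fmul p q)"
proof -
  have "proj b (D + D') (fmul p q) = (\<Sum>k\<le>D + D'. if k = D then fmul p q else 0)"
    unfolding proj_fmul
    by (intro sum.cong) (auto simp: proj_of_homog[OF assms(1)] proj_of_homog[OF assms(2)])
  then show ?thesis using proj_homog[of b "D + D'" "fmul p q"] by simp
qed

lemma homog_comm: "homog b D p \<Longrightarrow> homog b D' q \<Longrightarrow> D + D' = D'' \<Longrightarrow> homog b D'' (comm p q)"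
  and homog_acomm: "homog b D p \<Longrightarrow> homog b D' q \<Longrightarrow> D + D' = D'' \<Longrightarrow> homog b D'' (acomm p q)"
  using homog_fmul[of b D p D' q] homog_fmul[of b D' q D p]
  by (auto simp: comm_def acomm_def add.commute intro!: homog_diff homog_add)

lemma homog_hb2: "homog b D p \<Longrightarrow> D' = Suc D \<Longrightarrow> homog b D' (sc (of_int c * hb2) p)"
  using homog_monom[of b D p 1 "of_int c / 2"]
  by (simp only: hb2_factor monom_altdef) simp

lemma homog_int: "homog b D p \<Longrightarrow> homog b D (sc (of_int c) p)"
  using homog_monom[of b D p 0 "of_int c"] by (simp add: monom_0 of_int_poly)

lemma homog_comm_g: "D = gdeg b x + gdeg b y \<Longrightarrow> homog b D (comm (g x) (g y))"
  and homog_comm_comm_g: "D = gdeg b x + (gdeg b y + gdeg b z) \<Longrightarrow> homog b D (comm (g x) (comm (g y) (g z)))"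
  and homog_hb2_acomm_g:
    "D = Suc (gdeg b x + gdeg b y) \<Longrightarrow> homog b D (sc (of_int c * hb2) (acomm (g x) (g y)))"
  by (simp_all add: homog_comm[OF homog_g homog_g] homog_comm[OF homog_g homog_comm[OF homog_g homog_g]]
      homog_hb2[OF homog_acomm[OF homog_g homog_g]])

lemmas homog_intros = homog_add homog_diff homog_comm_g homog_comm_comm_g homog_hb2_acomm_g homog_int homog_g

lemma rels_homog: "x \<in> rels n b \<Longrightarrow> \<exists>D. homog b D x"
  unfolding rels_def
proof (elim UnE CollectE exE conjE, goal_cases)
  case (1 i j s s')
  show ?case unfolding 1 by (intro exI homog_intros) (rule refl)+
next
  case (2 i j r r')
  have "homog b (r + (r' + b j)) (comm (g (E i r)) (g (F j r')))"
    by (rule homog_comm[OF homog_g homog_g]) simp_all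
  moreover have "homog b (r + (r' + b j)) (if i = j then g (H i (int r + int r')) else 0)"
    by (auto intro!: homog_g)
  ultimately show ?case unfolding 2 by (intro exI homog_diff)
next
  case (3 i j r)
  show ?case unfolding 3
    by (intro exI[of _ r] homog_intros) auto
next
  case (4 i j s r)
  show ?case unfolding 4
    by (intro exI[of _ "Suc (nat (s + int (b i)) + r)"] homog_intros) (use 4 in auto)
next
  case (5 i j r)
  show ?case unfolding 5
    by (intro exI[of _ "r + b j"] homog_intros) auto
next
  case (6 i j s r)
  show ?case unfolding 6
    by (intro exI[of _ "Suc (nat (s + int (b i)) + r + b j)"] homog_intros) (use 6 in auto)
next
  case (7 i j r r')
  show ?case unfolding 7
    by (intro exI[of _ "Suc (r + r')"] homog_intros) auto
next
  case (8 i j r r')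
  show ?case unfolding 8
    by (intro exI[of _ "Suc (r + b i + r' + b j)"] homog_intros) auto
next
  case (9 i j r r')
  show ?case unfolding 9 by (intro exI homog_intros) (rule refl)+
next
  case (10 i j r r')
  show ?case unfolding 10 by (intro exI homog_intros) (rule refl)+
next
  case (11 i j r1 r2 r')
  show ?case unfolding 11
    by (intro exI[of _ "r1 + (r2 + r')"] homog_intros) auto
next
  case (12 i j r1 r2 r')
  show ?case unfolding 12
    by (intro exI[of _ "(r1 + b i) + ((r2 + b i) + (r' + b j))"] homog_intros) auto
qed

lemma proj_0 [simp]: "proj b D 0 = 0"
  by (rule fel_eqI) (simp add: coeff_proj fun_app)

lemma sc_eq_fmul: "sc c p = fmul (sc c fone) p"
  by (simp add: fmul_sc_left)

text \<open>A two-sided ideal with homogeneous generators contains the homogeneous components of its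
  elements. Scalars need not be homogeneous, so they are treated as left multiplication by a
  multiple of \<open>fone\<close>.\<close>

lemma proj_rel_ideal: "p \<in> rel_ideal n b \<Longrightarrow> proj b D p \<in> rel_ideal n b"
proof -
  have sum: "(\<Sum>k\<in>A. q k) \<in> rel_ideal n b" if "\<And>k. k \<in> A \<Longrightarrow> q k \<in> rel_ideal n b"
    for A :: "nat set" and q
    using that by (induction A rule: infinite_finite_induct) (auto simp: rel_ideal_zero rel_ideal_add)
  have l: "(\<Sum>k\<le>D. fmul (proj b k a) (proj b (D - k) x)) \<in> rel_ideal n b"
    if "a \<in> free_alg n b" "\<And>D. proj b D x \<in> rel_ideal n b" for a x D
    using that by (intro sum rel_ideal_lmul proj_free_alg)
  assume "p \<in> rel_ideal n b"
  then have "p \<in> tideal n b (rels n b)" by (simp add: rel_ideal_def)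
  then show ?thesis
  proof (induction arbitrary: D)
    case (base r)
    then obtain D' where "homog b D' r" using rels_homog by blast
    then show ?case using rel_ideal_base[OF base] by (simp add: proj_of_homog rel_ideal_zero)
  next
    case (smul x c)
    then show ?case
      unfolding sc_eq_fmul[of c x] proj_fmul by (intro l free_alg_sc free_alg_fone)
  next
    case (rmul x a)
    then show ?case
      unfolding proj_fmul by (intro sum rel_ideal_rmul proj_free_alg)
  qed (simp_all add: rel_ideal_zero proj_add rel_ideal_add proj_fmul l)
qed

lemma foldl_comm_homog:
  assumes "\<And>k. homog b (d k) (y k)"
  shows "homog b D p \<Longrightarrow> \<exists>D. homog b D (foldl (\<lambda>acc k. comm acc (y k)) p ks)"
    and "homog b D p \<Longrightarrow> \<exists>D. homog b D (foldl (\<lambda>acc k. comm (y k) acc) p ks)"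
proof (induction ks arbitrary: D p)
  case (Cons k ks)
  { case 1
    from Cons(1)[OF homog_comm[OF this assms refl]] show ?case by simp }
  { case 2
    from Cons(2)[OF homog_comm[OF assms this refl]] show ?case by simp }
qed auto

lemma pbw_el_homog: "\<exists>D. homog b D (pbw_el p)"
  using foldl_comm_homog[OF homog_g[OF refl] homog_g[OF refl], of b "\<lambda>k. E k 0"]
    foldl_comm_homog(2)[OF homog_g[OF refl] homog_g[OF refl], of b "\<lambda>k. F k 0"]
  by (cases p) (auto simp: eroot_def froot_def intro: homog_g)

lemma pbw_mon_homog: "\<exists>D. homog b D (pbw_mon ps)"
proof (induction ps)
  case Nil
  then show ?case using homog_word[of b "[]"] by (auto simp: fone_eq_word)
next
  case (Cons p ps)
  then show ?case using pbw_el_homog[of b p] homog_fmul by fastforce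
qed

section \<open>Spanning by ordered monomials\<close>

inductive_set pspan :: "nat \<Rightarrow> (nat \<Rightarrow> nat) \<Rightarrow> (pbw \<times> pbw) set \<Rightarrow> fel set" for n b ord where
  mon: "ordered_pbw n b ord ps \<Longrightarrow> pbw_mon ps \<in> pspan n b ord"
| ideal: "x \<in> rel_ideal n b \<Longrightarrow> x \<in> pspan n b ord"
| add: "x \<in> pspan n b ord \<Longrightarrow> y \<in> pspan n b ord \<Longrightarrow> x + y \<in> pspan n b ord"
| smul: "x \<in> pspan n b ord \<Longrightarrow> sc c x \<in> pspan n b ord"

lemma pspan_0: "0 \<in> pspan n b ord"
  by (rule pspan.ideal[OF rel_ideal_zero])

lemma pspan_sum: "(\<And>i. i \<in> A \<Longrightarrow> p i \<in> pspan n b ord) \<Longrightarrow> (\<Sum>i\<in>A. p i) \<in> pspan n b ord"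
  by (induction A rule: infinite_finite_induct) (auto simp: pspan_0 pspan.add)

lemma zspan_pspan: "x \<in> zspan A \<Longrightarrow> A \<subseteq> pspan n b ord \<Longrightarrow> x \<in> pspan n b ord"
proof (induction rule: zspan.induct)
  case (uminus x)
  then show ?case using pspan.smul[of x n b ord "-1"] by (simp only: sc_minus1)
qed (auto intro: pspan_0 pspan.add)

lemma proj_sc: "proj b D (sc c p) = (\<Sum>k\<le>D. sc (monom (coeff c k) k) (proj b (D - k) p))"
proof -
  have "proj b k (sc c fone) = sc (monom (coeff c k) k) fone" for k
    by (rule fel_eqI) (auto simp: coeff_proj sc_def fone_def wdeg_def)
  then show ?thesis unfolding sc_eq_fmul[of c p] proj_fmul by (simp add: fmul_sc_left)
qed

lemma proj_pspan: "p \<in> pspan n b ord \<Longrightarrow> proj b D p \<in> pspan n b ord"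
proof (induction arbitrary: D rule: pspan.induct)
  case (mon ps)
  obtain D' where "homog b D' (pbw_mon ps)" using pbw_mon_homog by blast
  then show ?case using pspan.mon[OF mon] by (simp add: proj_of_homog pspan_0)
next
  case (ideal x)
  then show ?case by (intro pspan.ideal proj_rel_ideal)
next
  case (smul x c)
  then show ?case unfolding proj_sc by (intro pspan_sum pspan.smul)
qed (simp add: proj_add pspan.add)

context
  fixes n :: nat and b :: "nat \<Rightarrow> nat" and ord :: "(pbw \<times> pbw) set"
  assumes ord: "linear_order_on (pbw_gens n b) ord"
begin

lemma classical_spanning:
  "x \<in> free_alg n b \<Longrightarrow> \<exists>p\<in>pspan n b ord. \<exists>y\<in>free_alg n b. x = p + sc hbar y"
proof (induction x rule: free_alg_induct)
  case (word c w)
  obtain m where m: "m \<in> zspan (pbw_mon ` {ps. ordered_pbw n b ord ps})" "word w - m \<in> classical_ideal n b"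
    using word_classical_span[OF ord word] by blast
  have mp: "m \<in> pspan n b ord"
    using m(1) by (rule zspan_pspan) (auto intro: pspan.mon)
  obtain p y where p: "p \<in> rel_ideal n b" "y \<in> free_alg n b" "word w - m = p + sc hbar y"
    using m(2) by (rule classical_idealE)
  have w: "word w = (m + p) + sc hbar y" using p(3) by (simp add: algebra_simps)
  \<comment> \<open>Only the constant term of the scalar is kept; the remainder carries a factor
    \<open>hbar\<close>.\<close>
  obtain a q where c: "c = pCons a q" by (cases c)
  have "sc c (word w) = sc [:a:] (word w) + sc hbar (sc q (word w))"
    unfolding sc_sc sc_add_left[symmetric] by (simp add: c)
  also have "sc [:a:] (word w) = sc [:a:] (m + p) + sc hbar (sc [:a:] y)"
    unfolding w sc_add by (simp add: mult.commute)
  finally have "sc c (word w) = sc [:a:] (m + p) + sc hbar (sc [:a:] y + sc q (word w))"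
    by (simp add: sc_add add.assoc)
  moreover have "sc [:a:] (m + p) \<in> pspan n b ord"
    by (rule pspan.smul[OF pspan.add[OF mp pspan.ideal[OF p(1)]]])
  moreover have "sc [:a:] y + sc q (word w) \<in> free_alg n b"
    using p(2) word by (intro free_alg_add free_alg_sc free_alg_word)
  ultimately show ?case by blast
next
  case (add x x')
  then obtain p y p' y' where "p \<in> pspan n b ord" "y \<in> free_alg n b" "x = p + sc hbar y"
    "p' \<in> pspan n b ord" "y' \<in> free_alg n b" "x' = p' + sc hbar y'" by blast
  then show ?case
    by (intro bexI[of _ "p + p'"] bexI[of _ "y + y'"]) (simp_all add: sc_add pspan.add free_alg_add)
qed

text \<open>Projecting \<open>x = p + sc hbar y\<close> to degree \<open>D\<close> replaces
  \<open>y\<close> by its component of degree \<open>D - 1\<close>, to which the induction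
  hypothesis applies; for \<open>D = 0\<close> the remainder vanishes.\<close>

lemma homog_spanning: "x \<in> free_alg n b \<Longrightarrow> homog b D x \<Longrightarrow> x \<in> pspan n b ord"
proof (induction D arbitrary: x rule: less_induct)
  case (less D)
  obtain p y where p: "p \<in> pspan n b ord" "y \<in> free_alg n b" "x = p + sc hbar y"
    using classical_spanning less.prems by blast
  have "x = proj b D x" using less.prems by (simp add: proj_of_homog)
  also have "\<dots> = proj b D p + proj b D (sc hbar y)" by (simp add: p proj_add)
  finally have x: "x = proj b D p + proj b D (sc hbar y)" .
  have "proj b D (sc hbar y) \<in> pspan n b ord"
  proof (cases D)
    case (Suc D')
    then have "proj b D' y \<in> pspan n b ord"
      using p(2) by (intro less.IH[of D']) (simp_all add: proj_homog proj_free_alg)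
    then show ?thesis using Suc by (simp add: proj_hbar pspan.smul)
  qed (simp add: proj_hbar pspan_0)
  then show ?case using proj_pspan[OF p(1), of D] unfolding x by (intro pspan.add)
qed

lemma spanning: "x \<in> free_alg n b \<Longrightarrow> x \<in> pspan n b ord"
proof (induction x rule: free_alg_induct)
  case (word c w)
  \<comment> \<open>A power of \<open>hbar\<close> times a word is homogeneous, so the scalar is
    split into its monomials.\<close>
  have "sc c (word w) = (\<Sum>k\<le>degree c. sc (monom (coeff c k) k) (word w))"
    by (subst poly_as_sum_of_monoms[of c, symmetric])
      (simp add: fun_eq_iff sc_def fun_sum_apply sum_distrib_right)
  also have "\<dots> \<in> pspan n b ord"
    using word
    by (intro pspan_sum homog_spanning[OF _ homog_monom[OF homog_word]] free_alg_sc free_alg_word)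
  finally show ?case .
qed (rule pspan.add)

end

lemma pspan_coefficients:
  assumes "x \<in> pspan n b ord"
  shows "\<exists>c :: pbw list \<Rightarrow> complex poly.
    finite {m. c m \<noteq> 0} \<and> (\<forall>m. c m \<noteq> 0 \<longrightarrow> ordered_pbw n b ord m) \<and>
    x - (\<Sum>m\<in>{m. c m \<noteq> 0}. sc (c m) (pbw_mon m)) \<in> rel_ideal n b"
  using assms
proof induction
  case (mon ps)
  have "{m. (if m = ps then 1 else (0 :: complex poly)) \<noteq> 0} = {ps}" by auto
  then show ?case using mon
    by (intro exI[of _ "\<lambda>m. if m = ps then 1 else 0"]) (simp add: rel_ideal_zero)
next
  case (ideal x)
  then show ?case by (intro exI[of _ "\<lambda>_. 0"]) simp
next
  case (add x y)
  then obtain c d where c: "finite {m. c m \<noteq> 0}" "\<forall>m. c m \<noteq> 0 \<longrightarrow> ordered_pbw n b ord m"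
      "x - (\<Sum>m\<in>{m. c m \<noteq> 0}. sc (c m) (pbw_mon m)) \<in> rel_ideal n b"
    and d: "finite {m. d m \<noteq> 0}" "\<forall>m. d m \<noteq> 0 \<longrightarrow> ordered_pbw n b ord m"
      "y - (\<Sum>m\<in>{m. d m \<noteq> 0}. sc (d m) (pbw_mon m)) \<in> rel_ideal n b" by blast
  let ?A = "{m. c m \<noteq> 0} \<union> {m. d m \<noteq> 0}" and ?cd = "\<lambda>m. c m + d m"
  have sub: "{m. ?cd m \<noteq> 0} \<subseteq> ?A" by auto
  have fin: "finite ?A" using c d by simp
  have "(\<Sum>m\<in>{m. ?cd m \<noteq> 0}. sc (?cd m) (pbw_mon m)) = (\<Sum>m\<in>?A. sc (?cd m) (pbw_mon m))"
    using fin sub by (intro sum.mono_neutral_left) auto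
  also have "\<dots> = (\<Sum>m\<in>?A. sc (c m) (pbw_mon m)) + (\<Sum>m\<in>?A. sc (d m) (pbw_mon m))"
    by (simp add: sc_add_left sum.distrib)
  also have "(\<Sum>m\<in>?A. sc (c m) (pbw_mon m)) = (\<Sum>m\<in>{m. c m \<noteq> 0}. sc (c m) (pbw_mon m))"
    using fin by (intro sum.mono_neutral_right) auto
  also have "(\<Sum>m\<in>?A. sc (d m) (pbw_mon m)) = (\<Sum>m\<in>{m. d m \<noteq> 0}. sc (d m) (pbw_mon m))"
    using fin by (intro sum.mono_neutral_right) auto
  finally have "x + y - (\<Sum>m\<in>{m. ?cd m \<noteq> 0}. sc (?cd m) (pbw_mon m)) =
     (x - (\<Sum>m\<in>{m. c m \<noteq> 0}. sc (c m) (pbw_mon m))) + (y - (\<Sum>m\<in>{m. d m \<noteq> 0}. sc (d m) (pbw_mon m)))"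
    by simp
  also have "\<dots> \<in> rel_ideal n b" using c d by (intro rel_ideal_add)
  finally show ?case
    using finite_subset[OF sub fin] sub c(2) d(2) by (intro exI[of _ ?cd]) blast
next
  case (smul x a)
  then obtain c where c: "finite {m. c m \<noteq> 0}" "\<forall>m. c m \<noteq> 0 \<longrightarrow> ordered_pbw n b ord m"
      "x - (\<Sum>m\<in>{m. c m \<noteq> 0}. sc (c m) (pbw_mon m)) \<in> rel_ideal n b" by blast
  have sub: "{m. a * c m \<noteq> 0} \<subseteq> {m. c m \<noteq> 0}" by auto
  have "(\<Sum>m\<in>{m. a * c m \<noteq> 0}. sc (a * c m) (pbw_mon m)) = (\<Sum>m\<in>{m. c m \<noteq> 0}. sc (a * c m) (pbw_mon m))"
    using c(1) sub by (intro sum.mono_neutral_left) auto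
  then have "sc a x - (\<Sum>m\<in>{m. a * c m \<noteq> 0}. sc (a * c m) (pbw_mon m)) =
      sc a (x - (\<Sum>m\<in>{m. c m \<noteq> 0}. sc (c m) (pbw_mon m)))"
    by (simp only: sc_diff sc_sum sc_sc)
  also have "\<dots> \<in> rel_ideal n b" using c by (intro rel_ideal_smul)
  finally show ?case
    using finite_subset[OF sub c(1)] sub c(2) by (intro exI[of _ "\<lambda>m. a * c m"]) blast
qed

section \<open>A representation by site operators\<close>

type_synonym vec = "(nat \<Rightarrow> nat) \<Rightarrow> complex"

text \<open>The module is a tensor product of vector representations with evaluation points
  \<open>z r\<close>, one for each site \<open>r < k\<close>. A configuration \<open>a\<close> assigns to the sites labels of basis
  vectors, and operators are matrices whose rows and columns are configurations, acting on
  functions of configurations from the left; so \<open>mv p q\<close> turns the label \<open>p\<close> of a site into \<open>q\<close>.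
  The weights are those of the equivariant cohomology of cotangent bundles of partial flag
  varieties in the fixed point basis; they are polynomial in \<open>t\<close>, the value of \<open>hbar\<close>.\<close>

locale site_rep =
  fixes k :: nat and z :: "nat \<Rightarrow> complex" and b :: "nat \<Rightarrow> nat" and t :: complex
begin

definition weight :: "nat \<Rightarrow> complex \<Rightarrow> nat set \<Rightarrow> nat \<Rightarrow> (nat \<Rightarrow> nat) \<Rightarrow> complex" where
  "weight p \<epsilon> S r a = (\<Prod>s\<in>S. if a s = p then 1 - \<epsilon> * t / (z r - z s) else 1)"

definition mv :: "nat \<Rightarrow> nat \<Rightarrow> complex \<Rightarrow> nat \<Rightarrow> vec \<Rightarrow> vec" where
  "mv p q \<epsilon> r v = (\<lambda>a. if a r = q then weight p \<epsilon> ({..<k} - {r}) r a * v (a(r := p)) else 0)"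

text \<open>The offset absorbs the half-integral multiples of \<open>t\<close> in the relations: for
  equal or neighbouring indices, \<open>xs i r - xs j s\<close> plus or minus
  \<open>cartan i j * t / 2\<close> is \<open>z r - z s\<close> up to an integral multiple of
  \<open>t\<close>.\<close>

definition xs :: "nat \<Rightarrow> nat \<Rightarrow> complex" where
  "xs i r = z r + of_nat i * t / 2"

definition sop :: "(nat \<Rightarrow> complex) \<Rightarrow> (nat \<Rightarrow> vec \<Rightarrow> vec) \<Rightarrow> vec \<Rightarrow> vec" where
  "sop w T v = (\<lambda>a. \<Sum>r<k. w r * T r v a)"

abbreviation me :: "nat \<Rightarrow> nat \<Rightarrow> vec \<Rightarrow> vec" where
  "me i \<equiv> mv (Suc i) i 1"

abbreviation mf :: "nat \<Rightarrow> nat \<Rightarrow> vec \<Rightarrow> vec" where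
  "mf i \<equiv> mv i (Suc i) (-1)"

text \<open>\<open>eta i a r\<close> is, up to the factor \<open>t\<close>, the residue at \<open>u = xs i r\<close> of the eigenvalue
  $\prod_s (1 + \mathit{eps}_i(a_s)\, t / (u - x_{i,s}))$ of the Cartan current.\<close>

definition eps :: "nat \<Rightarrow> nat \<Rightarrow> complex" where
  "eps i l = (if l = i then 1 else if l = Suc i then -1 else 0)"

definition eta :: "nat \<Rightarrow> (nat \<Rightarrow> nat) \<Rightarrow> nat \<Rightarrow> complex" where
  "eta i a r = eps i (a r) * (\<Prod>s\<in>{..<k} - {r}. 1 + eps i (a s) * t / (z r - z s))"

text \<open>By partial fractions, \<open>t * lam i m a\<close> is the coefficient of
  \<open>1 / u ^ (m + 1)\<close> in the eigenvalue of the Cartan current.\<close>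

definition lam :: "nat \<Rightarrow> nat \<Rightarrow> (nat \<Rightarrow> nat) \<Rightarrow> complex" where
  "lam i m a = (\<Sum>r<k. xs i r ^ m * eta i a r)"

fun act :: "gen \<Rightarrow> vec \<Rightarrow> vec" where
  "act (E i m) v = sop (\<lambda>r. xs i r ^ m) (me i) v"
| "act (F i m) v = sop (\<lambda>r. xs i r ^ (m + b i)) (mf i) v"
| "act (H i s) v = (\<lambda>a. lam i (nat (s + int (b i))) a * v a)"

lemma mv_scale: "mv p q \<epsilon> r (\<lambda>a. c * v a) a = c * mv p q \<epsilon> r v a"
  by (simp add: mv_def)

lemma mv_sum: "mv p q \<epsilon> r (\<lambda>a. \<Sum>s\<in>S. w s * v s a) a = (\<Sum>s\<in>S. w s * mv p q \<epsilon> r (v s) a)"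
  by (simp add: mv_def sum_distrib_left mult.left_commute)

lemma mv_same: "p \<noteq> q' \<Longrightarrow> mv p q \<epsilon> r (mv p' q' \<epsilon>' r v) a = 0"
  by (simp add: mv_def)

lemma weight_upd: "r \<notin> S \<Longrightarrow> weight p \<epsilon> S s (a(r := l)) = weight p \<epsilon> S s a"
  unfolding weight_def by (intro prod.cong) auto

lemma weight_insert:
  "finite S \<Longrightarrow> s \<notin> S \<Longrightarrow>
    weight p \<epsilon> (insert s S) r a = (if a s = p then 1 - \<epsilon> * t / (z r - z s) else 1) * weight p \<epsilon> S r a"
  unfolding weight_def by simp

text \<open>The two orders of composition share all factors that involve further sites; these are
  collected in \<open>C\<close>. What remains are the mutual weights of \<open>r\<close> and
  \<open>s\<close>, so two-site relations become rational identities in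
  \<open>z r - z s\<close>.\<close>

lemma mv_pair:
  assumes "r < k" "s < k" "r \<noteq> s"
  obtains C where
    "mv p q \<epsilon> r (mv p' q' \<epsilon>' s v) a =
      (if q' = p then 1 - \<epsilon> * t / (z r - z s) else 1) * (if p = p' then 1 - \<epsilon>' * t / (z s - z r) else 1) * C"
    "mv p' q' \<epsilon>' s (mv p q \<epsilon> r v) a =
      (if q = p' then 1 - \<epsilon>' * t / (z s - z r) else 1) * (if p = p' then 1 - \<epsilon> * t / (z r - z s) else 1) * C"
proof -
  define R where "R = {..<k} - {r, s}"
  define C where "C = (if a r = q \<and> a s = q' then
     weight p \<epsilon> R r a * weight p' \<epsilon>' R s a * v (a(r := p, s := p')) else 0)"
  have R: "{..<k} - {r} = insert s R" "{..<k} - {s} = insert r R" "finite R" "r \<notin> R" "s \<notin> R"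
    using assms by (auto simp: R_def)
  have tw: "a(s := p', r := p) = a(r := p, s := p')" using assms by (simp add: fun_upd_twist)
  show thesis
  proof (rule that[of C])
    show "mv p q \<epsilon> r (mv p' q' \<epsilon>' s v) a =
      (if q' = p then 1 - \<epsilon> * t / (z r - z s) else 1) * (if p = p' then 1 - \<epsilon>' * t / (z s - z r) else 1) * C"
      using assms R unfolding mv_def R C_def by (auto simp: weight_insert weight_upd)
    show "mv p' q' \<epsilon>' s (mv p q \<epsilon> r v) a =
      (if q = p' then 1 - \<epsilon>' * t / (z s - z r) else 1) * (if p = p' then 1 - \<epsilon> * t / (z r - z s) else 1) * C"
      using assms R unfolding mv_def R C_def by (auto simp: weight_insert weight_upd tw)
  qed
qed

lemma sop_sop: "sop w (mv p q \<epsilon>) (sop w' T v) a = (\<Sum>r<k. \<Sum>s<k. w r * w' s * mv p q \<epsilon> r (T s v) a)"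
  unfolding sop_def by (simp add: mv_sum sum_distrib_left mult.assoc)

end

text \<open>Distinct points make the denominators nonzero, \<open>t \<noteq> 0\<close> allows
  \<open>t\<close> to be cancelled, and the last condition, applied to both orders of a pair, makes
  the exchange factors of two moves of the same kind invertible.\<close>

locale generic_site_rep = site_rep +
  assumes distinct: "r < k \<Longrightarrow> s < k \<Longrightarrow> r \<noteq> s \<Longrightarrow> z r \<noteq> z s"
    and t_nz: "t \<noteq> 0"
    and generic: "r < k \<Longrightarrow> s < k \<Longrightarrow> z r - z s \<noteq> t"
begin

text \<open>This is the quadratic relation before summation over sites. On a single site a product
  is nonzero only for neighbouring indices in one order, and then its scalar factor vanishes; on two
  sites it is an identity between the mutual weights.\<close>

lemma me_me:
  assumes "r < k" "s < k"
  shows "(xs i r - xs j s - of_int (cartan i j) * t / 2) * me i r (me j s v) a =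
    (xs i r - xs j s + of_int (cartan i j) * t / 2) * me j s (me i r v) a"
proof (cases "r = s")
  case True
  then show ?thesis
    by (cases "i = j \<or> j = Suc i \<or> i = Suc j")
      (auto simp: mv_same cartan_def xs_def field_simps)
next
  case False
  have z: "z r - z s \<noteq> 0" "z s - z r \<noteq> 0" using distinct[OF assms False] by auto
  from assms False show ?thesis
    by (rule mv_pair[of r s "Suc i" i 1 "Suc j" j 1 v a])
      (use z in \<open>auto simp: cartan_def xs_def divide_simps; simp add: algebra_simps\<close>)
qed

lemma mf_mf:
  assumes "r < k" "s < k"
  shows "(xs i r - xs j s + of_int (cartan i j) * t / 2) * mf i r (mf j s v) a =
    (xs i r - xs j s - of_int (cartan i j) * t / 2) * mf j s (mf i r v) a"
proof (cases "r = s")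
  case True
  then show ?thesis
    by (cases "i = j \<or> j = Suc i \<or> i = Suc j")
      (auto simp: mv_same cartan_def xs_def field_simps)
next
  case False
  have z: "z r - z s \<noteq> 0" "z s - z r \<noteq> 0" using distinct[OF assms False] by auto
  from assms False show ?thesis
    by (rule mv_pair[of r s i "Suc i" "-1" j "Suc j" "-1" v a])
      (use z in \<open>auto simp: cartan_def xs_def divide_simps; simp add: algebra_simps\<close>)
qed

text \<open>On one site the weights of the two moves multiply to the Cartan residue. On two sites
  the opposite signs in \<open>me\<close> and \<open>mf\<close> make the mutual factors agree, so
  the moves commute.\<close>

lemma me_mf:
  assumes "r < k" "s < k"
  shows "me i r (mf j s v) a - mf j s (me i r v) a = (if i = j \<and> r = s then eta i a r * v a else 0)"
proof (cases "r = s")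
  case True
  show ?thesis
  proof (cases "i = j")
    case False
    then show ?thesis using True by (simp add: mv_same)
  next
    case ij: True
    define R where "R = {..<k} - {r}"
    have R: "r \<notin> R" by (simp add: R_def)
    have w: "weight (Suc i) 1 R r a * weight i (-1) R r a = (\<Prod>s\<in>R. 1 + eps i (a s) * t / (z r - z s))"
      unfolding weight_def prod.distrib[symmetric] by (intro prod.cong) (auto simp: eps_def)
    then have w': "weight i (-1) R r a * weight (Suc i) 1 R r a = (\<Prod>s\<in>R. 1 + eps i (a s) * t / (z r - z s))"
      by (simp add: mult.commute)
    define P where "P = (\<Prod>s\<in>R. 1 + eps i (a s) * t / (z r - z s))"
    have "me i r (mf i r v) a = (if a r = i then P * v a else 0)"
      unfolding mv_def R_def[symmetric] weight_upd[OF R] P_def w[symmetric]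
      by (auto simp: fun_upd_idem)
    moreover have "mf i r (me i r v) a = (if a r = Suc i then P * v a else 0)"
      unfolding mv_def R_def[symmetric] weight_upd[OF R] P_def w'[symmetric]
      by (auto simp: fun_upd_idem)
    moreover have "eta i a r = eps i (a r) * P"
      unfolding eta_def R_def[symmetric] P_def ..
    ultimately show ?thesis using True ij by (simp add: eps_def)
  qed
next
  case False
  have z: "z r - z s \<noteq> 0" "z s - z r \<noteq> 0" using distinct[OF assms False] by auto
  from assms False show ?thesis
    by (rule mv_pair[of r s "Suc i" i 1 j "Suc j" "-1" v a])
      (use z False in \<open>auto simp: divide_simps; simp add: algebra_simps\<close>)
qed

text \<open>The site form of the relations between Cartan generators and the others: it records how
  the residues respond to a changed label, cleared of denominators.\<close>

lemma eta_move:
  assumes "p < k" "r < k" "a r = j"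
  shows "eta i a p * (xs i p - xs j r - of_int (cartan i j) * t / 2) =
    eta i (a(r := Suc j)) p * (xs i p - xs j r + of_int (cartan i j) * t / 2)"
proof (cases "p = r")
  case True
  define P where "P = (\<Prod>s\<in>{..<k} - {r}. 1 + eps i (a s) * t / (z r - z s))"
  have P: "(\<Prod>s\<in>{..<k} - {r}. 1 + eps i ((a(r := Suc j)) s) * t / (z r - z s)) = P"
    unfolding P_def by (intro prod.cong) auto
  show ?thesis unfolding eta_def True P P_def[symmetric]
    using assms by (auto simp: eps_def cartan_def xs_def field_simps)
next
  case False
  define R where "R = {..<k} - {p, r}"
  have R: "{..<k} - {p} = insert r R" "finite R" "r \<notin> R" using assms False by (auto simp: R_def)
  define P where "P = (\<Prod>s\<in>R. 1 + eps i (a s) * t / (z p - z s))"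
  have P: "(\<Prod>s\<in>R. 1 + eps i ((a(r := Suc j)) s) * t / (z p - z s)) = P"
    unfolding P_def using R by (intro prod.cong) auto
  have z: "z p - z r \<noteq> 0" using distinct[OF assms(1,2) False] by auto
  have 1: "eta i a p = eps i (a p) * ((1 + eps i j * t / (z p - z r)) * P)"
    unfolding eta_def R(1) prod.insert[OF R(2,3)] P_def assms(3) ..
  have 2: "eta i (a(r := Suc j)) p = eps i (a p) * ((1 + eps i (Suc j) * t / (z p - z r)) * P)"
    unfolding eta_def R(1) prod.insert[OF R(2,3)] P using False by simp
  have 3: "(1 + eps i j * t / (z p - z r)) * (xs i p - xs j r - of_int (cartan i j) * t / 2) =
    (1 + eps i (Suc j) * t / (z p - z r)) * (xs i p - xs j r + of_int (cartan i j) * t / 2)"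
    using z by (auto simp: eps_def cartan_def xs_def divide_simps; simp add: algebra_simps)
  show ?thesis
    using arg_cong[OF 3, of "\<lambda>x. eps i (a p) * P * x"] unfolding 1 2 by (simp only: mult_ac)
qed

end

section \<open>Partial fractions and the rational identity behind the Serre relations\<close>

lemma partial_fractions:
  fixes d z :: "'i \<Rightarrow> 'a::field"
  assumes "finite S" "inj_on z S" "u \<notin> z ` S"
  shows "(\<Prod>s\<in>S. 1 + d s / (u - z s)) =
    1 + (\<Sum>r\<in>S. d r * (\<Prod>s\<in>S - {r}. 1 + d s / (z r - z s)) / (u - z r))"
  using assms
proof (induction S arbitrary: u rule: finite_induct)
  case empty
  then show ?case by simp
next
  case (insert q S)
  let ?P = "\<lambda>r. \<Prod>s\<in>S - {r}. 1 + d s / (z r - z s)" and ?\<Phi> = "\<lambda>u. \<Prod>s\<in>S. 1 + d s / (u - z s)"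
  have inj: "inj_on z S" and q: "z q \<notin> z ` S" and u: "u \<notin> z ` S" "u \<noteq> z q"
    using insert by auto
  \<comment> \<open>The hypothesis is used at \<open>u\<close> and at the new pole
    \<open>z q\<close>, hence the induction with \<open>u\<close> arbitrary.\<close>
  have IHu: "?\<Phi> u - 1 = (\<Sum>r\<in>S. d r * ?P r / (u - z r))"
    and IHq: "?\<Phi> (z q) - 1 = (\<Sum>r\<in>S. d r * ?P r / (z q - z r))"
    using insert.IH[OF inj u(1)] insert.IH[OF inj q] by simp_all
  have "(\<Prod>s\<in>insert q S - {r}. 1 + d s / (z r - z s)) = (1 + d q / (z r - z q)) * ?P r" if "r \<in> S" for r
  proof -
    have "insert q S - {r} = insert q (S - {r})" using that insert.hyps by auto
    then show ?thesis using insert.hyps by simp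
  qed
  then have "(\<Sum>r\<in>S. d r * (\<Prod>s\<in>insert q S - {r}. 1 + d s / (z r - z s)) / (u - z r)) =
     (\<Sum>r\<in>S. d r * ((1 + d q / (z r - z q)) * ?P r) / (u - z r))"
    by (intro sum.cong) auto
  also have "\<dots> = (\<Sum>r\<in>S. d r * ?P r / (u - z r)
      + d q / (u - z q) * (d r * ?P r / (u - z r) - d r * ?P r / (z q - z r)))"
  proof (intro sum.cong refl)
    fix r assume "r \<in> S"
    then have "u \<noteq> z r" "z q \<noteq> z r" using u(1) q by (metis imageI)+
    then have "u - z r \<noteq> 0" "u - z q \<noteq> 0" "z q - z r \<noteq> 0" "z r - z q \<noteq> 0" using u(2) by auto
    then show "d r * ((1 + d q / (z r - z q)) * ?P r) / (u - z r) = d r * ?P r / (u - z r)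
      + d q / (u - z q) * (d r * ?P r / (u - z r) - d r * ?P r / (z q - z r))"
      by (simp add: divide_simps) (simp add: algebra_simps)
  qed
  also have "\<dots> = (?\<Phi> u - 1) + d q / (u - z q) * ((?\<Phi> u - 1) - (?\<Phi> (z q) - 1))"
    by (simp add: IHu IHq sum.distrib sum_subtractf sum_distrib_left right_diff_distrib)
  finally have sum: "(\<Sum>r\<in>S. d r * (\<Prod>s\<in>insert q S - {r}. 1 + d s / (z r - z s)) / (u - z r)) =
     (?\<Phi> u - 1) + d q / (u - z q) * (?\<Phi> u - ?\<Phi> (z q))" by simp
  have "(\<Prod>s\<in>insert q S - {q}. 1 + d s / (z q - z s)) = ?\<Phi> (z q)"
    using insert.hyps by (intro prod.cong) auto
  then show ?case using insert.hyps sum by (simp add: algebra_simps)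
qed

text \<open>This compares coefficients of \<open>1 / u\<close> at infinity in the partial fraction
  expansion. It will show that the lowest Cartan mode acts by the ordinary weight.\<close>

lemma residue_sum:
  fixes d z :: "'i \<Rightarrow> 'a::field"
  assumes "finite S" "inj_on z S"
  shows "(\<Sum>r\<in>S. d r * (\<Prod>s\<in>S - {r}. 1 + d s / (z r - z s))) = (\<Sum>r\<in>S. d r)"
  using assms
proof (induction S rule: finite_induct)
  case empty
  then show ?case by simp
next
  case (insert q S)
  let ?P = "\<lambda>r. \<Prod>s\<in>S - {r}. 1 + d s / (z r - z s)" and ?\<Phi> = "\<lambda>u. \<Prod>s\<in>S. 1 + d s / (u - z s)"
  have inj: "inj_on z S" and q: "z q \<notin> z ` S" using insert by auto
  have "(\<Prod>s\<in>insert q S - {r}. 1 + d s / (z r - z s)) = (1 + d q / (z r - z q)) * ?P r" if "r \<in> S" for r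
  proof -
    have "insert q S - {r} = insert q (S - {r})" using that insert.hyps by auto
    then show ?thesis using insert.hyps by simp
  qed
  then have "(\<Sum>r\<in>S. d r * (\<Prod>s\<in>insert q S - {r}. 1 + d s / (z r - z s))) =
     (\<Sum>r\<in>S. d r * ((1 + d q / (z r - z q)) * ?P r))"
    by (intro sum.cong) auto
  also have "\<dots> = (\<Sum>r\<in>S. d r * ?P r - d q * (d r * ?P r / (z q - z r)))"
  proof (intro sum.cong refl)
    fix r assume "r \<in> S"
    then have "z q \<noteq> z r" using q by (metis imageI)
    then have "z q - z r \<noteq> 0" "z r - z q \<noteq> 0" by auto
    then show "d r * ((1 + d q / (z r - z q)) * ?P r) = d r * ?P r - d q * (d r * ?P r / (z q - z r))"
      by (simp add: divide_simps) (simp add: algebra_simps)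
  qed
  also have "\<dots> = (\<Sum>r\<in>S. d r) - d q * (?\<Phi> (z q) - 1)"
    using partial_fractions[OF insert.hyps(1) inj q, of d] insert.IH[OF inj]
    by (simp add: sum_subtractf sum_distrib_left)
  finally have sum: "(\<Sum>r\<in>S. d r * (\<Prod>s\<in>insert q S - {r}. 1 + d s / (z r - z s))) =
     (\<Sum>r\<in>S. d r) - d q * (?\<Phi> (z q) - 1)" .
  have "(\<Prod>s\<in>insert q S - {q}. 1 + d s / (z q - z s)) = ?\<Phi> (z q)"
    using insert.hyps by (intro prod.cong) auto
  then show ?case using insert.hyps sum by (simp add: algebra_simps)
qed

text \<open>The six letters are the values of the six orders of two moves of one kind at sites
  \<open>p\<close>, \<open>q\<close> and one of the other kind at \<open>s\<close>, with
  \<open>x = z p - z s\<close> and \<open>y = z q - z s\<close>. At \<open>x = 0\<close> or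
  \<open>y = 0\<close> two sites coincide; the exchange relations can then not be solved for the
  products and force some of them to vanish instead.\<close>

lemma serre_scalars:
  fixes A :: "'a::field"
  assumes u: "u \<noteq> 0" "x - y \<noteq> 0" "x - y \<noteq> u" "x - y \<noteq> - u" "(2::'a) \<noteq> 0"
    and r: "y * A = (y - u) * C" "x * B = (x - u) * D" "x * C = (x - u) * G" "y * D = (y - u) * K"
      "(x - y - u) * A = (x - y + u) * B" "(x - y - u) * G = (x - y + u) * K"
  shows "A + B - 2 * C - 2 * D + G + K = 0"
proof -
  have n: "x - y + u \<noteq> 0" "x - y - u \<noteq> 0" using u by (auto simp: add_eq_0_iff2)
  consider "x = 0" | "y = 0" | "x \<noteq> 0" "y \<noteq> 0" by blast
  then show ?thesis
  proof cases
    case 1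
    then have D: "D = 0" and G: "G = 0" using r u by auto
    then have K: "K = 0" using r n by auto
    have C: "(y - u) * C = y * A" and B: "(u - y) * B = - (y + u) * A" using r 1 by (auto simp: algebra_simps)
    have "(y - u) * (A + B - 2 * C) = (y - u) * A - (u - y) * B - 2 * ((y - u) * C)"
      by (simp add: algebra_simps)
    also have "\<dots> = 0" unfolding B C by (simp add: algebra_simps)
    finally show ?thesis using n 1 by (simp add: D G K)
  next
    case 2
    then have C: "C = 0" and K: "K = 0" using r u by auto
    then have G: "G = 0" using r n by auto
    have D: "(x - u) * D = x * B" and A: "(x - u) * A = (x + u) * B" using r 2 by auto
    have "(x - u) * (A + B - 2 * D) = (x - u) * A + (x - u) * B - 2 * ((x - u) * D)"
      by (simp add: algebra_simps)
    also have "\<dots> = 0" unfolding A D by (simp add: algebra_simps)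
    finally show ?thesis using n 2 by (simp add: C G K)
  next
    case 3
    have C: "C = (x - u) * G / x" and D: "D = (y - u) * K / y"
      using r 3 by (simp_all add: field_simps)
    have A: "A = (y - u) * C / y" and B: "B = (x - u) * D / x"
      using r 3 by (simp_all add: field_simps)
    \<comment> \<open>Expressing everything through \<open>G\<close> and \<open>K\<close> leaves a
      multiple of the exchange relation between these two.\<close>
    have "x * y * (A + B - 2 * C - 2 * D + G + K) = u * ((x - y + u) * K - (x - y - u) * G)"
      unfolding A B unfolding C D using 3 by (simp add: field_simps)
    then show ?thesis using r 3 by simp
  qed
qed

section \<open>The action of the free algebra\<close>

context site_rep
begin

lemma mv_linear: "mv p q \<epsilon> r (\<lambda>a. c * u a + v a) a = c * mv p q \<epsilon> r u a + mv p q \<epsilon> r v a"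
  by (simp add: mv_def algebra_simps)

lemma act_linear: "act x (\<lambda>a. c * u a + v a) = (\<lambda>a. c * act x u a + act x v a)"
  by (cases x) (auto simp: fun_eq_iff sop_def mv_linear sum.distrib sum_distrib_left distrib_left mult.left_commute)

lemma act_diff: "act x (\<lambda>a. u a - v a) = (\<lambda>a. act x u a - act x v a)"
  using act_linear[of x "-1" v u] by (simp add: fun_eq_iff)

definition actw :: "gen list \<Rightarrow> vec \<Rightarrow> vec" where
  "actw w v = foldr act w v"

lemma actw_simps [simp]: "actw [] v = v" "actw (x # w) v = act x (actw w v)"
  by (simp_all add: actw_def)

lemma actw_append: "actw (u @ w) v = actw u (actw w v)"
  by (induction u) simp_all

lemma actw_linear: "actw w (\<lambda>a. c * u a + v a) = (\<lambda>a. c * actw w u a + actw w v a)"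
  by (induction w) (simp_all add: act_linear)

lemma actw_zero: "actw w (\<lambda>a. 0) = (\<lambda>a. 0)"
  using actw_linear[of w "-1" "\<lambda>a. 0" "\<lambda>a. 0"] by simp

lemma actw_scale: "actw w (\<lambda>a. c * u a) = (\<lambda>a. c * actw w u a)"
  using actw_linear[of w c u "\<lambda>a. 0"] by (simp add: actw_zero)

lemma actw_add: "actw w (\<lambda>a. u a + v a) = (\<lambda>a. actw w u a + actw w v a)"
  using actw_linear[of w 1 u v] by simp

definition rho :: "fel \<Rightarrow> vec \<Rightarrow> vec" where
  "rho p v = (\<lambda>a. \<Sum>w\<in>{w. p w \<noteq> 0}. poly (p w) t * actw w v a)"

lemma rho_superset:
  "finite A \<Longrightarrow> {w. p w \<noteq> 0} \<subseteq> A \<Longrightarrow> rho p v a = (\<Sum>w\<in>A. poly (p w) t * actw w v a)"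
  unfolding rho_def by (rule sum.mono_neutral_left) auto

lemma rho_add:
  assumes "finite {w. p w \<noteq> 0}" "finite {w. q w \<noteq> 0}"
  shows "rho (p + q) v = (\<lambda>a. rho p v a + rho q v a)"
proof
  fix a
  let ?A = "{w. p w \<noteq> 0} \<union> {w. q w \<noteq> 0}"
  have fin: "finite ?A" using assms by simp
  have "{w. (p + q) w \<noteq> 0} \<subseteq> ?A" by (auto simp: fun_app)
  then have "rho (p + q) v a = (\<Sum>w\<in>?A. poly (p w) t * actw w v a) + (\<Sum>w\<in>?A. poly (q w) t * actw w v a)"
    by (subst rho_superset[OF fin]) (auto simp: fun_app sum.distrib distrib_right)
  also have "\<dots> = rho p v a + rho q v a"
    by (intro arg_cong2[of _ _ _ _ "(+)"] rho_superset[OF fin, symmetric]) auto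
  finally show "rho (p + q) v a = rho p v a + rho q v a" .
qed

lemma rho_sc: "rho (sc c p) v = (\<lambda>a. poly c t * rho p v a)"
proof (cases "c = 0")
  case False
  then have "{w. sc c p w \<noteq> 0} = {w. p w \<noteq> 0}" by (simp add: sc_def)
  then show ?thesis by (simp add: rho_def sc_def sum_distrib_left mult.assoc)
qed (simp add: rho_def fun_app)

lemma rho_word: "rho (word w) v = actw w v"
  by (rule ext, subst rho_superset[of "{w}"]) (auto simp: word_def)

lemma rho_g: "rho (g x) v = act x v"
  by (simp add: g_def rho_word)

lemma rho_0: "rho 0 v = (\<lambda>a. 0)"
  by (simp add: rho_def fun_app)

lemma finite_support: "p \<in> free_alg n b' \<Longrightarrow> finite {w. p w \<noteq> 0}"
  by (simp add: free_alg_def)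

lemma rho_add': "p \<in> free_alg n b' \<Longrightarrow> q \<in> free_alg n b' \<Longrightarrow> rho (p + q) v = (\<lambda>a. rho p v a + rho q v a)"
  by (simp add: rho_add finite_support)

lemma rho_zero_vec: "rho p (\<lambda>a. 0) = (\<lambda>a. 0)"
  by (simp add: rho_def actw_zero)

lemma rho_fmul:
  assumes "p \<in> free_alg n b'" "q \<in> free_alg n b'"
  shows "rho (fmul p q) v = rho p (rho q v)"
  using assms(1)
proof (induction p rule: free_alg_induct)
  case (word c w)
  note w = word
  show ?case using assms(2)
  proof (induction q rule: free_alg_induct)
    case (word d u)
    show ?case
      by (simp add: fmul_sc_left fmul_sc_right fmul_word_word rho_sc rho_word actw_append actw_scale mult_ac)
  next
    case (add q q')
    have "sc c (word w) \<in> free_alg n b'" using w by (intro free_alg_sc free_alg_word)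
    then show ?case using add
      by (simp add: fmul_add_right rho_add'[where n = n and b' = b'] free_alg_fmul rho_sc rho_word actw_add algebra_simps)
  qed
next
  case (add p p')
  then show ?case using assms(2)
    by (simp add: fmul_add_left rho_add'[where n = n and b' = b'] free_alg_fmul)
qed

lemma rho_uminus: "rho (- p) v = (\<lambda>a. - rho p v a)"
  using rho_sc[of "-1" p v] by (simp add: sc_minus1)

lemma rho_diff:
  "p \<in> free_alg n b' \<Longrightarrow> q \<in> free_alg n b' \<Longrightarrow> rho (p - q) v = (\<lambda>a. rho p v a - rho q v a)"
  using rho_add'[OF _ free_alg_uminus, of p n b' q] by (simp add: rho_uminus)

lemma rho_comm:
  "p \<in> free_alg n b' \<Longrightarrow> q \<in> free_alg n b' \<Longrightarrow>
    rho (comm p q) v = (\<lambda>a. rho p (rho q v) a - rho q (rho p v) a)"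
  by (simp add: comm_def rho_diff[where n = n and b' = b'] rho_fmul[where n = n and b' = b'] free_alg_fmul)

lemma rho_acomm:
  "p \<in> free_alg n b' \<Longrightarrow> q \<in> free_alg n b' \<Longrightarrow>
    rho (acomm p q) v = (\<lambda>a. rho p (rho q v) a + rho q (rho p v) a)"
  by (simp add: acomm_def rho_add'[where n = n and b' = b'] rho_fmul[where n = n and b' = b'] free_alg_fmul)

lemma sop_sop_swap:
  "sop w' (mv p' q' \<epsilon>') (sop w T v) a = (\<Sum>r<k. \<Sum>s<k. w r * w' s * mv p' q' \<epsilon>' s (T r v) a)"
  unfolding sop_sop by (subst sum.swap) (simp add: mult.commute)

text \<open>The site exchange relation is summed against weights; a further factor
  \<open>x r\<close> or \<open>y s\<close> in a weight raises the mode number by one.\<close>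

lemma shift_relation:
  assumes "\<And>r s. r < k \<Longrightarrow> s < k \<Longrightarrow>
    (x r - y s - c) * mv p q \<epsilon> r (mv p' q' \<epsilon>' s v) a = (x r - y s + c) * mv p' q' \<epsilon>' s (mv p q \<epsilon> r v) a"
  shows "sop (\<lambda>r. w r * x r) (mv p q \<epsilon>) (sop w' (mv p' q' \<epsilon>') v) a
      - sop w' (mv p' q' \<epsilon>') (sop (\<lambda>r. w r * x r) (mv p q \<epsilon>) v) a
      - (sop w (mv p q \<epsilon>) (sop (\<lambda>s. w' s * y s) (mv p' q' \<epsilon>') v) a
      - sop (\<lambda>s. w' s * y s) (mv p' q' \<epsilon>') (sop w (mv p q \<epsilon>) v) a)
      - c * (sop w (mv p q \<epsilon>) (sop w' (mv p' q' \<epsilon>') v) a + sop w' (mv p' q' \<epsilon>') (sop w (mv p q \<epsilon>) v) a) = 0"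
proof -
  let ?A = "\<lambda>r s. mv p q \<epsilon> r (mv p' q' \<epsilon>' s v) a" and ?B = "\<lambda>r s. mv p' q' \<epsilon>' s (mv p q \<epsilon> r v) a"
  have "(\<Sum>r<k. \<Sum>s<k. w r * w' s * ((x r - y s - c) * ?A r s - (x r - y s + c) * ?B r s)) = 0"
    using assms by simp
  then show ?thesis
    unfolding sop_sop[of _ p q \<epsilon>] sop_sop_swap[of _ p' q' \<epsilon>']
    by (simp add: sum_distrib_left sum.distrib[symmetric] sum_subtractf[symmetric] algebra_simps)
qed

lemma sop_triple:
  "sop w1 (mv p1 q1 \<epsilon>1) (sop w2 (mv p2 q2 \<epsilon>2) (sop w3 T v)) a =
    (\<Sum>p<k. \<Sum>q<k. \<Sum>s<k. w1 p * w2 q * w3 s * mv p1 q1 \<epsilon>1 p (mv p2 q2 \<epsilon>2 q (T s v)) a)"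
proof -
  have "mv p1 q1 \<epsilon>1 p (mv p2 q2 \<epsilon>2 q (sop w3 T v)) a =
      (\<Sum>s<k. w3 s * mv p1 q1 \<epsilon>1 p (mv p2 q2 \<epsilon>2 q (T s v)) a)" for p q
    unfolding sop_def mv_sum ..
  then show ?thesis unfolding sop_sop by (simp add: sum_distrib_left mult.assoc)
qed

text \<open>\<open>serre_expr X Y p q s\<close> is the coefficient of the symmetrized Serre relation at the
  sites \<open>p, q, s\<close>.\<close>

definition serre_expr :: "(nat \<Rightarrow> vec \<Rightarrow> vec) \<Rightarrow> (nat \<Rightarrow> vec \<Rightarrow> vec) \<Rightarrow> nat \<Rightarrow> nat \<Rightarrow> nat \<Rightarrow> vec \<Rightarrow> vec" where
  "serre_expr X Y p q s v a = X p (X q (Y s v)) a + X q (X p (Y s v)) a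
     - 2 * X p (Y s (X q v)) a - 2 * X q (Y s (X p v)) a + Y s (X p (X q v)) a + Y s (X q (X p v)) a"

text \<open>Sites are renamed so that \<open>w1\<close>, \<open>w2\<close>, \<open>w3\<close> always
  belong to \<open>p\<close>, \<open>q\<close>, \<open>s\<close>. Symmetrizing over the two modes of
  \<open>X\<close> then becomes symmetrizing over its two sites.\<close>

lemma serre_sum:
  fixes i i' j j' :: nat and \<epsilon> \<epsilon>' :: complex
  defines "X \<equiv> mv i i' \<epsilon>" and "Y \<equiv> mv j j' \<epsilon>'"
  assumes "\<And>p q s. p < k \<Longrightarrow> q < k \<Longrightarrow> s < k \<Longrightarrow> serre_expr X Y p q s v a = 0"
  shows "(sop w1 X (sop w2 X (sop w3 Y v)) a - sop w1 X (sop w3 Y (sop w2 X v)) a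
      - (sop w2 X (sop w3 Y (sop w1 X v)) a - sop w3 Y (sop w2 X (sop w1 X v)) a))
    + (sop w2 X (sop w1 X (sop w3 Y v)) a - sop w2 X (sop w3 Y (sop w1 X v)) a
      - (sop w1 X (sop w3 Y (sop w2 X v)) a - sop w3 Y (sop w1 X (sop w2 X v)) a)) = 0"
proof -
  let ?S = "\<lambda>f. \<Sum>p<k. \<Sum>q<k. \<Sum>s<k. w1 p * w2 q * w3 s * (f p q s :: complex)"
  have swap: "(\<Sum>p<k. \<Sum>s<k. \<Sum>q<k. h p s q) = (\<Sum>p<k. \<Sum>q<k. \<Sum>s<k. h p s q)"
    for h :: "nat \<Rightarrow> nat \<Rightarrow> nat \<Rightarrow> complex" by (rule sum.cong[OF refl], rule sum.swap)
  have 1: "sop w1 X (sop w2 X (sop w3 Y v)) a = ?S (\<lambda>p q s. X p (X q (Y s v)) a)"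
    unfolding X_def Y_def sop_triple ..
  have 2: "sop w1 X (sop w3 Y (sop w2 X v)) a = ?S (\<lambda>p q s. X p (Y s (X q v)) a)"
    unfolding X_def Y_def sop_triple by (subst swap) (simp add: mult_ac)
  have 3: "sop w2 X (sop w3 Y (sop w1 X v)) a = ?S (\<lambda>p q s. X q (Y s (X p v)) a)"
    unfolding X_def Y_def sop_triple by (subst swap, subst sum.swap) (simp add: mult_ac)
  have 4: "sop w3 Y (sop w2 X (sop w1 X v)) a = ?S (\<lambda>p q s. Y s (X q (X p v)) a)"
    unfolding X_def Y_def sop_triple
    by (subst sum.swap, subst swap, subst sum.swap) (simp add: mult_ac)
  have 5: "sop w2 X (sop w1 X (sop w3 Y v)) a = ?S (\<lambda>p q s. X q (X p (Y s v)) a)"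
    unfolding X_def Y_def sop_triple by (subst sum.swap) (simp add: mult_ac)
  have 6: "sop w3 Y (sop w1 X (sop w2 X v)) a = ?S (\<lambda>p q s. Y s (X p (X q v)) a)"
    unfolding X_def Y_def sop_triple by (subst sum.swap, subst swap) (simp add: mult_ac)
  have "?S (\<lambda>p q s. serre_expr X Y p q s v a) = 0" using assms(3) by simp
  then show ?thesis
    unfolding 1 2 3 4 5 6 serre_expr_def
    by (simp add: sum.distrib sum_subtractf sum_distrib_left algebra_simps)
qed

end

section \<open>The Serre relations for site operators\<close>

context generic_site_rep
begin

lemma generic_diff: "r < k \<Longrightarrow> s < k \<Longrightarrow> r \<noteq> s \<Longrightarrow> z r - z s \<noteq> 0"
  "r < k \<Longrightarrow> s < k \<Longrightarrow> z r - z s \<noteq> t" "r < k \<Longrightarrow> s < k \<Longrightarrow> z r - z s \<noteq> - t"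
  using distinct[of r s] generic[of r s] generic[of s r] by (auto simp: algebra_simps)

text \<open>For \<open>p \<noteq> q\<close> the exchange relations feed
  \<open>serre_scalars\<close>. For \<open>p = q\<close> only \<open>X p (Y s (X p v))\<close> could
  survive; exchanging \<open>Y s\<close> with one of its neighbours removes it, which neighbour
  depending on whether \<open>p = s\<close>.\<close>

lemma serre_expr_I:
  fixes i i' j j' :: nat and \<epsilon> \<epsilon>' u :: complex
  defines "X \<equiv> mv i i' \<epsilon>" and "Y \<equiv> mv j j' \<epsilon>'"
  assumes u: "u = t \<or> u = - t"
    and XY: "\<And>p s v a. p < k \<Longrightarrow> s < k \<Longrightarrow> (z p - z s) * X p (Y s v) a = (z p - z s - u) * Y s (X p v) a"
    and XX: "\<And>p q v a. p < k \<Longrightarrow> q < k \<Longrightarrow> (z p - z q - u) * X p (X q v) a = (z p - z q + u) * X q (X p v) a"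
    and XX0: "\<And>p v a. X p (X p v) a = 0"
    and k: "p < k" "q < k" "s < k"
  shows "serre_expr X Y p q s v a = 0"
proof -
  have X: "c * X p w a = c' * X p w' a" if "\<And>a. c * w a = c' * w' a" for c c' p w w' a
    using that unfolding X_def mv_scale[symmetric] by simp
  have Y: "c * Y p w a = c' * Y p w' a" if "\<And>a. c * w a = c' * w' a" for c c' p w w' a
    using that unfolding Y_def mv_scale[symmetric] by simp
  have Y0: "Y s (X p (X p v)) a = 0" and X0: "X p (X p (Y s v)) a = 0" for p v a
    using XX0 by (simp_all add: Y_def mv_def)
  have u0: "u \<noteq> 0" using u t_nz by auto
  show ?thesis
  proof (cases "p = q")
    case True
    have "X p (Y s (X p v)) a = 0"
    proof (cases "p = s")
      case True
      have "(z p - z s) * X p (X p (Y s v)) a = (z p - z s - u) * X p (Y s (X p v)) a"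
        by (rule X[OF XY[OF k(1,3)]])
      then show ?thesis using True u0 by simp
    next
      case False
      then show ?thesis using XY[OF k(1,3), of "X p v" a] Y0[of p v a] generic_diff(1)[OF k(1,3)] by simp
    qed
    then show ?thesis using True by (simp add: serre_expr_def X0 Y0)
  next
    case False
    have "X p (X q (Y s v)) a + X q (X p (Y s v)) a - 2 * X p (Y s (X q v)) a - 2 * X q (Y s (X p v)) a
        + Y s (X p (X q v)) a + Y s (X q (X p v)) a = 0"
    proof (rule serre_scalars)
      show "u \<noteq> 0" by (rule u0)
      show "(z p - z s) - (z q - z s) \<noteq> 0" "(z p - z s) - (z q - z s) \<noteq> u" "(z p - z s) - (z q - z s) \<noteq> - u"
        using u generic_diff[OF k(1,2)] False by auto
      show "(z q - z s) * X p (X q (Y s v)) a = (z q - z s - u) * X p (Y s (X q v)) a"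
        by (rule X[OF XY[OF k(2,3)]])
      show "(z p - z s) * X q (X p (Y s v)) a = (z p - z s - u) * X q (Y s (X p v)) a"
        by (rule X[OF XY[OF k(1,3)]])
      show "(z p - z s) * X p (Y s (X q v)) a = (z p - z s - u) * Y s (X p (X q v)) a"
        by (rule XY[OF k(1,3)])
      show "(z q - z s) * X q (Y s (X p v)) a = (z q - z s - u) * Y s (X q (X p v)) a"
        by (rule XY[OF k(2,3)])
      show "(z p - z s - (z q - z s) - u) * X p (X q (Y s v)) a = (z p - z s - (z q - z s) + u) * X q (X p (Y s v)) a"
        using XX[OF k(1,2)] by simp
      show "(z p - z s - (z q - z s) - u) * Y s (X p (X q v)) a = (z p - z s - (z q - z s) + u) * Y s (X q (X p v)) a"
        using Y[OF XX[OF k(1,2)]] by simp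
    qed simp
    then show ?thesis by (simp add: serre_expr_def)
  qed
qed

text \<open>The mirror image of \<open>serre_expr_I\<close>, with the products read in the opposite
  order and \<open>u\<close> replaced by \<open>- u\<close>. Whether \<open>j = Suc i\<close> or
  \<open>i = Suc j\<close> decides which of the two applies, and the roles are swapped between
  \<open>me\<close> and \<open>mf\<close>.\<close>

lemma serre_expr_II:
  fixes i i' j j' :: nat and \<epsilon> \<epsilon>' u :: complex
  defines "X \<equiv> mv i i' \<epsilon>" and "Y \<equiv> mv j j' \<epsilon>'"
  assumes u: "u = t \<or> u = - t"
    and XY: "\<And>p s v a. p < k \<Longrightarrow> s < k \<Longrightarrow> (z p - z s + u) * X p (Y s v) a = (z p - z s) * Y s (X p v) a"
    and XX: "\<And>p q v a. p < k \<Longrightarrow> q < k \<Longrightarrow> (z p - z q - u) * X p (X q v) a = (z p - z q + u) * X q (X p v) a"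
    and XX0: "\<And>p v a. X p (X p v) a = 0"
    and k: "p < k" "q < k" "s < k"
  shows "serre_expr X Y p q s v a = 0"
proof -
  have X: "c * X p w a = c' * X p w' a" if "\<And>a. c * w a = c' * w' a" for c c' p w w' a
    using that unfolding X_def mv_scale[symmetric] by simp
  have Y: "c * Y p w a = c' * Y p w' a" if "\<And>a. c * w a = c' * w' a" for c c' p w w' a
    using that unfolding Y_def mv_scale[symmetric] by simp
  have Y0: "Y s (X p (X p v)) a = 0" and X0: "X p (X p (Y s v)) a = 0" for p v a
    using XX0 by (simp_all add: Y_def mv_def)
  have u0: "u \<noteq> 0" using u t_nz by auto
  show ?thesis
  proof (cases "p = q")
    case True
    have "X p (Y s (X p v)) a = 0"
    proof (cases "p = s")
      case True
      then show ?thesis using XY[OF k(1,3), of "X p v" a] u0 by simp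
    next
      case False
      have "(z p - z s + u) * X p (X p (Y s v)) a = (z p - z s) * X p (Y s (X p v)) a"
        by (rule X[OF XY[OF k(1,3)]])
      then show ?thesis using X0[of p v a] generic_diff(1)[OF k(1,3) False] by simp
    qed
    then show ?thesis using True by (simp add: serre_expr_def X0 Y0)
  next
    case False
    have "Y s (X q (X p v)) a + Y s (X p (X q v)) a - 2 * X q (Y s (X p v)) a - 2 * X p (Y s (X q v)) a
        + X q (X p (Y s v)) a + X p (X q (Y s v)) a = 0"
    proof (rule serre_scalars)
      show "- u \<noteq> 0" using u0 by simp
      show "(z p - z s) - (z q - z s) \<noteq> 0" "(z p - z s) - (z q - z s) \<noteq> - u" "(z p - z s) - (z q - z s) \<noteq> - (- u)"
        using u generic_diff[OF k(1,2)] False by auto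
      show "(z q - z s) * Y s (X q (X p v)) a = (z q - z s - - u) * X q (Y s (X p v)) a"
        using XY[OF k(2,3)] by simp
      show "(z p - z s) * Y s (X p (X q v)) a = (z p - z s - - u) * X p (Y s (X q v)) a"
        using XY[OF k(1,3)] by simp
      show "(z p - z s) * X q (Y s (X p v)) a = (z p - z s - - u) * X q (X p (Y s v)) a"
        using X[OF XY[OF k(1,3)]] by simp
      show "(z q - z s) * X p (Y s (X q v)) a = (z q - z s - - u) * X p (X q (Y s v)) a"
        using X[OF XY[OF k(2,3)]] by simp
      show "(z p - z s - (z q - z s) - - u) * Y s (X q (X p v)) a = (z p - z s - (z q - z s) + - u) * Y s (X p (X q v)) a"
        using Y[OF XX[OF k(1,2)]] by simp
      show "(z p - z s - (z q - z s) - - u) * X q (X p (Y s v)) a = (z p - z s - (z q - z s) + - u) * X p (X q (Y s v)) a"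
        using XX[OF k(1,2)] by simp
    qed simp
    then show ?thesis by (simp add: serre_expr_def algebra_simps)
  qed
qed

lemma me_self: assumes "p < k" "q < k"
  shows "(z p - z q - t) * me i p (me i q v) a = (z p - z q + t) * me i q (me i p v) a"
  using me_me[OF assms, of i i v a] by (simp add: cartan_def xs_def)

lemma mf_self: assumes "p < k" "q < k"
  shows "(z p - z q - - t) * mf i p (mf i q v) a = (z p - z q + - t) * mf i q (mf i p v) a"
  using mf_mf[OF assms, of i i v a] by (simp add: cartan_def xs_def)

lemma serre_me:
  assumes "cartan i j = -1" "p < k" "q < k" "s < k"
  shows "serre_expr (me i) (me j) p q s v a = 0"
proof -
  consider "j = Suc i" | "i = Suc j" using assms(1) by (auto simp: cartan_def split: if_splits)
  then show ?thesis
  proof cases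
    case 1
    show ?thesis
    proof (rule serre_expr_I[of t])
      show "(z p - z s) * me i p (me j s v) a = (z p - z s - t) * me j s (me i p v) a"
        if "p < k" "s < k" for p s v a
      proof -
        have "xs i p - xs j s - of_int (cartan i j) * t / 2 = z p - z s"
          "xs i p - xs j s + of_int (cartan i j) * t / 2 = z p - z s - t"
          using 1 by (simp_all add: cartan_def xs_def field_simps)
        with me_me[OF that, of i j v a] show ?thesis by simp
      qed
    qed (use assms me_self in \<open>simp_all add: mv_same\<close>)
  next
    case 2
    show ?thesis
    proof (rule serre_expr_II[of t])
      show "(z p - z s + t) * me i p (me j s v) a = (z p - z s) * me j s (me i p v) a"
        if "p < k" "s < k" for p s v a
      proof -
        have "xs i p - xs j s - of_int (cartan i j) * t / 2 = z p - z s + t"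
          "xs i p - xs j s + of_int (cartan i j) * t / 2 = z p - z s"
          using 2 by (simp_all add: cartan_def xs_def field_simps)
        with me_me[OF that, of i j v a] show ?thesis by simp
      qed
    qed (use assms me_self in \<open>simp_all add: mv_same\<close>)
  qed
qed

lemma serre_mf:
  assumes "cartan i j = -1" "p < k" "q < k" "s < k"
  shows "serre_expr (mf i) (mf j) p q s v a = 0"
proof -
  consider "j = Suc i" | "i = Suc j" using assms(1) by (auto simp: cartan_def split: if_splits)
  then show ?thesis
  proof cases
    case 1
    show ?thesis
    proof (rule serre_expr_II[of "- t"])
      show "(z p - z s + - t) * mf i p (mf j s v) a = (z p - z s) * mf j s (mf i p v) a"
        if "p < k" "s < k" for p s v a
      proof -
        have "xs i p - xs j s + of_int (cartan i j) * t / 2 = z p - z s + - t"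
          "xs i p - xs j s - of_int (cartan i j) * t / 2 = z p - z s"
          using 1 by (simp_all add: cartan_def xs_def field_simps)
        with mf_mf[OF that, of i j v a] show ?thesis by simp
      qed
    qed (use assms mf_self in \<open>simp_all add: mv_same\<close>)
  next
    case 2
    show ?thesis
    proof (rule serre_expr_I[of "- t"])
      show "(z p - z s) * mf i p (mf j s v) a = (z p - z s - - t) * mf j s (mf i p v) a"
        if "p < k" "s < k" for p s v a
      proof -
        have "xs i p - xs j s + of_int (cartan i j) * t / 2 = z p - z s"
          "xs i p - xs j s - of_int (cartan i j) * t / 2 = z p - z s - - t"
          using 2 by (simp_all add: cartan_def xs_def field_simps)
        with mf_mf[OF that, of i j v a] show ?thesis by simp
      qed
    qed (use assms mf_self in \<open>simp_all add: mv_same\<close>)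
  qed
qed

text \<open>The residues add up by \<open>residue_sum\<close>; a common factor \<open>t\<close> is
  cancelled, using \<open>t \<noteq> 0\<close>.\<close>

lemma lam_0: "lam i 0 a = (\<Sum>r<k. eps i (a r))"
proof -
  have "inj_on z {..<k}" using distinct by (auto simp: inj_on_def)
  from residue_sum[OF _ this, of "\<lambda>r. eps i (a r) * t"]
  have "(\<Sum>r<k. eps i (a r) * t * (\<Prod>s\<in>{..<k} - {r}. 1 + eps i (a s) * t / (z r - z s))) = (\<Sum>r<k. eps i (a r) * t)"
    by simp
  then have "t * lam i 0 a = t * (\<Sum>r<k. eps i (a r))"
    by (simp add: lam_def eta_def sum_distrib_left mult_ac)
  then show ?thesis using t_nz by simp
qed

lemma lam_0_move:
  assumes "r < k" "a r = j"
  shows "lam i 0 a - lam i 0 (a(r := Suc j)) = of_int (cartan i j)"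
proof -
  have "(\<Sum>s<k. eps i (a s)) - (\<Sum>s<k. eps i ((a(r := Suc j)) s)) = eps i j - eps i (Suc j)"
    using assms by (simp add: sum.remove[of "{..<k}" r])
  then show ?thesis by (auto simp: lam_0 eps_def cartan_def)
qed

lemma lam_Suc_move:
  assumes "r < k" "a r = j"
  shows "lam i (Suc m) a - lam i (Suc m) (a(r := Suc j)) - xs j r * (lam i m a - lam i m (a(r := Suc j)))
    - of_int (cartan i j) * t / 2 * (lam i m a + lam i m (a(r := Suc j))) = 0"
proof -
  let ?c = "of_int (cartan i j) * t / 2"
  have "(\<Sum>p<k. xs i p ^ m * (eta i a p * (xs i p - xs j r - ?c)
      - eta i (a(r := Suc j)) p * (xs i p - xs j r + ?c))) = 0"
    using eta_move[of _ r a j i] assms by simp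
  then show ?thesis
    unfolding lam_def
    by (simp add: sum_distrib_left sum.distrib[symmetric] sum_subtractf[symmetric] algebra_simps del: fun_upd_apply)
qed

end

section \<open>Verification of the defining relations\<close>

context generic_site_rep
begin

lemma mv_mult: "mv p q \<epsilon> r (\<lambda>a. f a * v a) a = f (a(r := p)) * mv p q \<epsilon> r v a"
  by (simp add: mv_def)

lemma sop_mult: "sop w (mv p q \<epsilon>) (\<lambda>a. f a * v a) a = (\<Sum>r<k. w r * (f (a(r := p)) * mv p q \<epsilon> r v a))"
  by (simp add: sop_def mv_mult)

lemma act_ef:
  "act (E i m) (act (F j m') v) a - act (F j m') (act (E i m) v) a =
    (if i = j then act (H i (int m + int m')) v a else 0)"
proof -
  have "act (E i m) (act (F j m') v) a - act (F j m') (act (E i m) v) a =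
     (\<Sum>r<k. \<Sum>s<k. xs i r ^ m * xs j s ^ (m' + b j) * (me i r (mf j s v) a - mf j s (me i r v) a))"
    by (simp only: act.simps sop_sop[of _ "Suc i"] sop_sop_swap[of _ j] sum_subtractf right_diff_distrib)
  also have "\<dots> = (\<Sum>r<k. \<Sum>s<k. if s = r then
      (if i = j then xs i r ^ m * xs j r ^ (m' + b j) * (eta i a r * v a) else 0) else 0)"
    by (intro sum.cong refl) (auto simp: me_mf)
  also have "\<dots> = (\<Sum>r<k. if i = j then xs i r ^ m * xs j r ^ (m' + b j) * (eta i a r * v a) else 0)"
    by (intro sum.cong refl) simp
  also have "\<dots> = (if i = j then act (H i (int m + int m')) v a else 0)"
  proof (cases "i = j")
    case True
    have "nat (int m + int m' + int (b j)) = m + (m' + b j)" by simp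
    then show ?thesis using True
      by (simp add: lam_def sum_distrib_right power_add mult.assoc)
  qed simp
  finally show ?thesis .
qed

lemma act_he_0:
  "act (H i (- int (b i))) (act (E j m) v) a - act (E j m) (act (H i (- int (b i))) v) a =
    of_int (cartan i j) * act (E j m) v a"
proof -
  have "act (H i (- int (b i))) (act (E j m) v) a - act (E j m) (act (H i (- int (b i))) v) a =
    (\<Sum>r<k. xs j r ^ m * ((lam i 0 a - lam i 0 (a(r := Suc j))) * me j r v a))"
    by (simp add: sop_mult) (simp add: sop_def sum_distrib_left sum_subtractf algebra_simps)
  also have "\<dots> = (\<Sum>r<k. xs j r ^ m * (of_int (cartan i j) * me j r v a))"
  proof (intro sum.cong refl)
    fix r assume "r \<in> {..<k}"
    then show "xs j r ^ m * ((lam i 0 a - lam i 0 (a(r := Suc j))) * me j r v a) =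
        xs j r ^ m * (of_int (cartan i j) * me j r v a)"
      using lam_0_move[of r a j i] by (cases "a r = j") (simp_all add: mv_def)
  qed
  also have "\<dots> = of_int (cartan i j) * act (E j m) v a"
    by (simp add: sop_def sum_distrib_left mult.left_commute)
  finally show ?thesis .
qed

lemma act_hf_0:
  "act (H i (- int (b i))) (act (F j m) v) a - act (F j m) (act (H i (- int (b i))) v) a =
    - of_int (cartan i j) * act (F j m) v a"
proof -
  have "act (H i (- int (b i))) (act (F j m) v) a - act (F j m) (act (H i (- int (b i))) v) a =
    (\<Sum>r<k. xs j r ^ (m + b j) * ((lam i 0 a - lam i 0 (a(r := j))) * mf j r v a))"
    by (simp add: sop_mult) (simp add: sop_def sum_distrib_left sum_subtractf algebra_simps)
  also have "\<dots> = (\<Sum>r<k. xs j r ^ (m + b j) * (- of_int (cartan i j) * mf j r v a))"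
  proof (intro sum.cong refl)
    fix r assume r: "r \<in> {..<k}"
    show "xs j r ^ (m + b j) * ((lam i 0 a - lam i 0 (a(r := j))) * mf j r v a) =
        xs j r ^ (m + b j) * (- of_int (cartan i j) * mf j r v a)"
    proof (cases "a r = Suc j")
      case True
      then have "lam i 0 a - lam i 0 (a(r := j)) = - of_int (cartan i j)"
        using lam_0_move[of r "a(r := j)" j i] r by (simp add: fun_upd_idem algebra_simps)
      then show ?thesis by simp
    qed (simp add: mv_def)
  qed
  also have "\<dots> = - of_int (cartan i j) * act (F j m) v a"
    by (simp add: sop_def sum_distrib_left mult.left_commute sum_negf)
  finally show ?thesis .
qed

lemma act_he_shift:
  assumes "s \<ge> - int (b i)"
  shows "act (H i (s + 1)) (act (E j m) v) a - act (E j m) (act (H i (s + 1)) v) a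
     - (act (H i s) (act (E j (Suc m)) v) a - act (E j (Suc m)) (act (H i s) v) a)
     - of_int (cartan i j) * t / 2 * (act (H i s) (act (E j m) v) a + act (E j m) (act (H i s) v) a) = 0"
proof -
  define l where "l = nat (s + int (b i))"
  have l: "nat (s + 1 + int (b i)) = Suc l" "nat (s + int (b i)) = l" using assms by (auto simp: l_def)
  let ?c = "of_int (cartan i j) * t / 2"
  have zero: "(lam i (Suc l) a - lam i (Suc l) (a(r := Suc j)) - xs j r * (lam i l a - lam i l (a(r := Suc j)))
    - ?c * (lam i l a + lam i l (a(r := Suc j)))) * me j r v a = 0" if "r < k" for r
    using lam_Suc_move[of r a j i l] that by (cases "a r = j") (simp_all add: mv_def)
  have "(\<Sum>r<k. xs j r ^ m * ((lam i (Suc l) a - lam i (Suc l) (a(r := Suc j))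
    - xs j r * (lam i l a - lam i l (a(r := Suc j)))
    - ?c * (lam i l a + lam i l (a(r := Suc j)))) * me j r v a)) = 0"
    by (intro sum.neutral ballI) (simp only: zero lessThan_iff mult_zero_right)
  then show ?thesis
    unfolding act.simps l sop_mult
    by (simp add: sop_def sum_distrib_left sum.distrib[symmetric] sum_subtractf[symmetric] algebra_simps)
qed

lemma act_hf_shift:
  assumes "s \<ge> - int (b i)"
  shows "act (H i (s + 1)) (act (F j m) v) a - act (F j m) (act (H i (s + 1)) v) a
     - (act (H i s) (act (F j (Suc m)) v) a - act (F j (Suc m)) (act (H i s) v) a)
     + of_int (cartan i j) * t / 2 * (act (H i s) (act (F j m) v) a + act (F j m) (act (H i s) v) a) = 0"
proof -
  define l where "l = nat (s + int (b i))"
  have l: "nat (s + 1 + int (b i)) = Suc l" "nat (s + int (b i)) = l" using assms by (auto simp: l_def)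
  let ?c = "of_int (cartan i j) * t / 2"
  have zero: "(lam i (Suc l) a - lam i (Suc l) (a(r := j)) - xs j r * (lam i l a - lam i l (a(r := j)))
    + ?c * (lam i l a + lam i l (a(r := j)))) * mf j r v a = 0" if "r < k" for r
  proof (cases "a r = Suc j")
    case True
    then have "lam i (Suc l) a - lam i (Suc l) (a(r := j)) - xs j r * (lam i l a - lam i l (a(r := j)))
      + ?c * (lam i l a + lam i l (a(r := j))) = 0"
      using lam_Suc_move[of r "a(r := j)" j i l] that by (simp add: fun_upd_idem algebra_simps)
    then show ?thesis by simp
  qed (simp add: mv_def)
  have "(\<Sum>r<k. xs j r ^ (m + b j) * ((lam i (Suc l) a - lam i (Suc l) (a(r := j))
    - xs j r * (lam i l a - lam i l (a(r := j)))
    + ?c * (lam i l a + lam i l (a(r := j)))) * mf j r v a)) = 0"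
    by (intro sum.neutral ballI) (simp only: zero lessThan_iff mult_zero_right)
  then show ?thesis
    unfolding act.simps l sop_mult
    by (simp add: sop_def sum_distrib_left sum.distrib[symmetric] sum_subtractf[symmetric] algebra_simps)
qed

lemma act_ee_shift:
  "act (E i (Suc m)) (act (E j m') v) a - act (E j m') (act (E i (Suc m)) v) a
     - (act (E i m) (act (E j (Suc m')) v) a - act (E j (Suc m')) (act (E i m) v) a)
     - of_int (cartan i j) * t / 2 * (act (E i m) (act (E j m') v) a + act (E j m') (act (E i m) v) a) = 0"
  using shift_relation[of "xs i" "xs j" "of_int (cartan i j) * t / 2" "Suc i" i 1 "Suc j" j 1 v a
      "\<lambda>r. xs i r ^ m" "\<lambda>r. xs j r ^ m'", OF me_me]
  by (simp add: mult.commute)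

lemma act_ff_shift:
  "act (F i (Suc m)) (act (F j m') v) a - act (F j m') (act (F i (Suc m)) v) a
     - (act (F i m) (act (F j (Suc m')) v) a - act (F j (Suc m')) (act (F i m) v) a)
     + of_int (cartan i j) * t / 2 * (act (F i m) (act (F j m') v) a + act (F j m') (act (F i m) v) a) = 0"
  using shift_relation[of "xs i" "xs j" "- (of_int (cartan i j) * t / 2)" i "Suc i" "-1" j "Suc j" "-1" v a
      "\<lambda>r. xs i r ^ (m + b i)" "\<lambda>r. xs j r ^ (m' + b j)"] mf_mf[of _ _ i j v a]
  by (simp add: mult.commute)

lemma act_ee_far:
  assumes "cartan i j = 0"
  shows "act (E i m) (act (E j m') v) a - act (E j m') (act (E i m) v) a = 0"
proof -
  have ij: "i \<noteq> j" "j \<noteq> Suc i" "i \<noteq> Suc j" using assms by (auto simp: cartan_def split: if_splits)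
  have "me i r (me j s v) a = me j s (me i r v) a" if "r < k" "s < k" for r s
  proof (cases "r = s")
    case True
    then show ?thesis using ij by (simp add: mv_same)
  next
    case False
    from that False show ?thesis
      by (rule mv_pair[of r s "Suc i" i 1 "Suc j" j 1 v a]) (use ij in auto)
  qed
  then show ?thesis
    by (simp only: act.simps sop_sop[of _ "Suc i"] sop_sop_swap[of _ "Suc j"]) simp
qed

lemma act_ff_far:
  assumes "cartan i j = 0"
  shows "act (F i m) (act (F j m') v) a - act (F j m') (act (F i m) v) a = 0"
proof -
  have ij: "i \<noteq> j" "j \<noteq> Suc i" "i \<noteq> Suc j" using assms by (auto simp: cartan_def split: if_splits)
  have "mf i r (mf j s v) a = mf j s (mf i r v) a" if "r < k" "s < k" for r s
  proof (cases "r = s")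
    case True
    then show ?thesis using ij by (simp add: mv_same)
  next
    case False
    from that False show ?thesis
      by (rule mv_pair[of r s i "Suc i" "-1" j "Suc j" "-1" v a]) (use ij in auto)
  qed
  then show ?thesis
    by (simp only: act.simps sop_sop[of _ i] sop_sop_swap[of _ j]) simp
qed

lemma poly_hb2: "poly hb2 t = t / 2"
  by (simp add: hb2_def)

lemma rho_rels:
  assumes "x \<in> rels n b"
  shows "rho x v a = 0"
proof -
  note rs = rho_comm[where n = n and b' = b] rho_acomm[where n = n and b' = b] rho_diff[where n = n and b' = b]
    rho_add'[where n = n and b' = b] rho_sc rho_g rho_0 free_alg_closed act_diff poly_hb2
  show ?thesis
    using assms unfolding rels_def
  proof (elim UnE CollectE exE conjE, goal_cases)
    case (1 i j s s')
    then show ?case by (simp add: rs)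
  next
    case (2 i j r r')
    then show ?case using act_ef[of i r j r' v a] by (auto simp: rs simp del: act.simps)
  next
    case (3 i j r)
    then show ?case using act_he_0[of i j r v a] by (simp add: rs del: act.simps)
  next
    case (4 i j s r)
    then show ?case using act_he_shift[of i s j r v a] by (simp add: rs del: act.simps)
  next
    case (5 i j r)
    then show ?case using act_hf_0[of i j r v a] by (simp add: rs del: act.simps)
  next
    case (6 i j s r)
    then show ?case using act_hf_shift[of i s j r v a] by (simp add: rs del: act.simps)
  next
    case (7 i j r r')
    then show ?case using act_ee_shift[of i r j r' v a] by (simp add: rs del: act.simps)
  next
    case (8 i j r r')
    then show ?case using act_ff_shift[of i r j r' v a] by (simp add: rs del: act.simps)
  next
    case (9 i j r r')
    then show ?case using act_ee_far[of i j r r' v a] by (simp add: rs del: act.simps)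
  next
    case (10 i j r r')
    then show ?case using act_ff_far[of i j r r' v a] by (simp add: rs del: act.simps)
  next
    case (11 i j r1 r2 r')
    have "rho x v a =
       act (E i r1) (act (E i r2) (act (E j r') v)) a - act (E i r1) (act (E j r') (act (E i r2) v)) a
      - (act (E i r2) (act (E j r') (act (E i r1) v)) a - act (E j r') (act (E i r2) (act (E i r1) v)) a)
      + (act (E i r2) (act (E i r1) (act (E j r') v)) a - act (E i r2) (act (E j r') (act (E i r1) v)) a
      - (act (E i r1) (act (E j r') (act (E i r2) v)) a - act (E j r') (act (E i r1) (act (E i r2) v)) a))"
      using 11 by (simp add: rs del: act.simps)
    also have "\<dots> = 0" unfolding act.simps by (rule serre_sum[OF serre_me]) (use 11 in auto)
    finally show ?case .
  next
    case (12 i j r1 r2 r')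
    have "rho x v a =
       act (F i r1) (act (F i r2) (act (F j r') v)) a - act (F i r1) (act (F j r') (act (F i r2) v)) a
      - (act (F i r2) (act (F j r') (act (F i r1) v)) a - act (F j r') (act (F i r2) (act (F i r1) v)) a)
      + (act (F i r2) (act (F i r1) (act (F j r') v)) a - act (F i r2) (act (F j r') (act (F i r1) v)) a
      - (act (F i r1) (act (F j r') (act (F i r2) v)) a - act (F j r') (act (F i r1) (act (F i r2) v)) a))"
      using 12 by (simp add: rs del: act.simps)
    also have "\<dots> = 0" unfolding act.simps by (rule serre_sum[OF serre_mf]) (use 12 in auto)
    finally show ?case .
  qed
qed

theorem rho_rel_ideal: "x \<in> rel_ideal n b \<Longrightarrow> rho x v = (\<lambda>a. 0)"
proof -
  assume "x \<in> rel_ideal n b"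
  then have "x \<in> tideal n b (rels n b)" by (simp add: rel_ideal_def)
  then show ?thesis
  proof (induction arbitrary: v)
    case (base r)
    then show ?case by (simp add: rho_rels)
  next
    case (add x y)
    then have "x \<in> free_alg n b" "y \<in> free_alg n b"
      by (auto intro: rel_ideal_free_alg simp: rel_ideal_def)
    then show ?case using add.IH by (simp add: rho_add'[where n = n and b' = b])
  next
    case (lmul x a)
    then have "x \<in> free_alg n b" by (auto intro: rel_ideal_free_alg simp: rel_ideal_def)
    then show ?case using lmul by (simp add: rho_fmul[where n = n and b' = b] rho_zero_vec)
  next
    case (rmul x a)
    then have "x \<in> free_alg n b" by (auto intro: rel_ideal_free_alg simp: rel_ideal_def)
    then show ?case using rmul by (simp add: rho_fmul[where n = n and b' = b])
  qed (simp_all add: rho_0 rho_sc)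
qed

end

section \<open>Independence at parameter zero\<close>

text \<open>The power of the evaluation point with which a basis element acts at a site. Each
  \<open>f l\<close> contributes \<open>b l\<close>, so a negative root vector collects the sum of
  \<open>b\<close> over its support.\<close>

fun pexp :: "(nat \<Rightarrow> nat) \<Rightarrow> pbw \<Rightarrow> nat" where
  "pexp b (PE j i r) = r"
| "pexp b (PF j i r) = r + (\<Sum>l=j..i. b l)"
| "pexp b (PH i s) = nat (s + int (b i))"

text \<open>The vector representation on functions of one label: matrix units with entry in row
  \<open>j\<close> and column \<open>Suc i\<close>, their transposes, and the Cartan
  elements.\<close>

fun mact :: "pbw \<Rightarrow> (nat \<Rightarrow> complex) \<Rightarrow> nat \<Rightarrow> complex" where
  "mact (PE j i r) \<phi> y = (if y = j then \<phi> (Suc i) else 0)"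
| "mact (PF j i r) \<phi> y = (if y = Suc i then \<phi> j else 0)"
| "mact (PH i s) \<phi> y = (if y = i then \<phi> y else if y = Suc i then - \<phi> y else 0)"

definition mactw :: "pbw list \<Rightarrow> (nat \<Rightarrow> complex) \<Rightarrow> nat \<Rightarrow> complex" where
  "mactw ps \<phi> = foldr mact ps \<phi>"

lemma mactw_simps [simp]: "mactw [] \<phi> = \<phi>" "mactw (p # ps) \<phi> = mact p (mactw ps \<phi>)"
  by (simp_all add: mactw_def)

lemma mact_linear: "mact p (\<lambda>y. c * f y + h y) x = c * mact p f x + mact p h x"
  by (cases p) (auto simp: algebra_simps)

lemma mact_scale: "mact p (\<lambda>y. c * f y) x = c * mact p f x"
  by (cases p) auto

definition cop :: "nat \<Rightarrow> (nat \<Rightarrow> complex) \<Rightarrow> (nat \<Rightarrow> nat) \<Rightarrow> pbw \<Rightarrow> vec \<Rightarrow> vec" where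
  "cop k z b p v = (\<lambda>a. \<Sum>r<k. z r ^ pexp b p * mact p (\<lambda>y. v (a(r := y))) (a r))"

definition copw :: "nat \<Rightarrow> (nat \<Rightarrow> complex) \<Rightarrow> (nat \<Rightarrow> nat) \<Rightarrow> pbw list \<Rightarrow> vec \<Rightarrow> vec" where
  "copw k z b ps v = foldr (cop k z b) ps v"

lemma copw_simps [simp]:
  "copw k z b [] v = v" "copw k z b (p # ps) v = cop k z b p (copw k z b ps v)"
  by (simp_all add: copw_def)

lemma cop_linear: "cop k z b p (\<lambda>a. c * u a + v a) a = c * cop k z b p u a + cop k z b p v a"
  by (simp add: cop_def mact_linear sum.distrib sum_distrib_left distrib_left mult.left_commute)

lemma cop_zero: "cop k z b p (\<lambda>a. 0) a = 0"
  using cop_linear[of k z b p "-1" "\<lambda>a. 0" "\<lambda>a. 0" a] by simp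

lemma cop_sum_list:
  "cop k z b p (\<lambda>a. \<Sum>x\<leftarrow>L. c x * f x a) a = (\<Sum>x\<leftarrow>L. c x * cop k z b p (f x) a)"
  by (induction L) (simp_all add: cop_zero cop_linear)

text \<open>The coproduct, which describes the action on a tensor product with one new site.\<close>

fun splits :: "'p list \<Rightarrow> ('p list \<times> 'p list) list" where
  "splits [] = [([], [])]"
| "splits (p # ps) = map (\<lambda>x. (p # fst x, snd x)) (splits ps) @ map (\<lambda>x. (fst x, p # snd x)) (splits ps)"

lemma splits_mset: "(s, c) \<in> set (splits ps) \<Longrightarrow> mset s + mset c = mset ps"
  by (induction ps arbitrary: s c) fastforce+

lemma splits_nil: "(\<Sum>(s, c)\<leftarrow>splits ps. if s = [] then f c else 0) = f ps"
  for f :: "'p list \<Rightarrow> 'a::comm_monoid_add"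
proof (induction ps arbitrary: f)
  case (Cons p ps)
  from Cons[of "\<lambda>c. f (p # c)"] show ?case
    by (simp add: o_def case_prod_beta cong: if_cong)
qed simp

lemma splits_single:
  "(\<Sum>(s, c)\<leftarrow>splits ps. if s = [p] then 1 else (0 :: complex)) = of_nat (count (mset ps) p)"
proof (induction ps)
  case (Cons q ps)
  have "(\<Sum>x\<leftarrow>splits ps. if q = p \<and> fst x = [] then 1 else (0 :: complex)) = (if q = p then 1 else 0)"
    using splits_nil[of "\<lambda>_. 1 :: complex" ps] unfolding case_prod_beta by (cases "q = p") (simp_all add: case_prod_beta)
  then show ?case using Cons
    by (simp add: o_def case_prod_beta cong: if_cong)
qed simp

text \<open>A vector for \<open>k\<close> sites is still a function of all labels; resetting the
  label at site \<open>k\<close> to \<open>\<kappa>\<close> removes the dependence of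
  \<open>u\<close> on the new site.\<close>

definition tens :: "nat \<Rightarrow> nat \<Rightarrow> (nat \<Rightarrow> complex) \<Rightarrow> vec \<Rightarrow> vec" where
  "tens k \<kappa> \<phi> u = (\<lambda>a. \<phi> (a k) * u (a(k := \<kappa>)))"

lemma cop_tens:
  "cop (Suc k) z b p (tens k \<kappa> \<phi> u) a =
    tens k \<kappa> \<phi> (cop k z b p u) a + z k ^ pexp b p * tens k \<kappa> (mact p \<phi>) u a"
proof -
  have "mact p (\<lambda>y. tens k \<kappa> \<phi> u (a(r := y))) (a r) =
      \<phi> (a k) * mact p (\<lambda>y. u ((a(k := \<kappa>))(r := y))) ((a(k := \<kappa>)) r)" if "r < k" for r
    using that by (simp add: tens_def fun_upd_twist mact_scale)
  moreover have "mact p (\<lambda>y. tens k \<kappa> \<phi> u (a(k := y))) (a k) = mact p \<phi> (a k) * u (a(k := \<kappa>))"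
    using mact_scale[of p "u (a(k := \<kappa>))" \<phi> "a k"] by (simp add: tens_def mult.commute)
  ultimately show ?thesis
    unfolding cop_def by (simp add: tens_def sum_distrib_left mult_ac)
qed

lemma copw_tens:
  "copw (Suc k) z b ps (tens k \<kappa> \<phi> u) a =
    (\<Sum>(s, c)\<leftarrow>splits ps. z k ^ (\<Sum>p\<leftarrow>s. pexp b p) * tens k \<kappa> (mactw s \<phi>) (copw k z b c u) a)"
proof (induction ps arbitrary: a)
  case (Cons p ps)
  have "copw (Suc k) z b ps (tens k \<kappa> \<phi> u) = (\<lambda>a. \<Sum>x\<leftarrow>splits ps. z k ^ (\<Sum>p\<leftarrow>fst x. pexp b p) *
       tens k \<kappa> (mactw (fst x) \<phi>) (copw k z b (snd x) u) a)"
    using Cons by (simp add: fun_eq_iff case_prod_beta)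
  then have "copw (Suc k) z b (p # ps) (tens k \<kappa> \<phi> u) a =
     cop (Suc k) z b p (\<lambda>a. \<Sum>x\<leftarrow>splits ps. z k ^ (\<Sum>p\<leftarrow>fst x. pexp b p) *
       tens k \<kappa> (mactw (fst x) \<phi>) (copw k z b (snd x) u) a) a"
    by simp
  then show ?case
    unfolding cop_sum_list
    by (simp add: cop_tens case_prod_beta o_def distrib_left sum_list_addf power_add mult_ac)
qed simp

definition delta :: "nat \<Rightarrow> nat \<Rightarrow> complex" where
  "delta q y = (if y = q then 1 else 0)"

text \<open>A triple \<open>(\<alpha>, q, y)\<close> stands for \<open>\<alpha>\<close> times the matrix entry in row \<open>y\<close> and column \<open>q\<close>. The
  resulting functional vanishes on the identity and is dual to \<open>p\<close> among the basis elements with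
  the same exponent; for the Cartan elements it is a partial trace minus a multiple of the trace.\<close>

fun dual :: "nat \<Rightarrow> pbw \<Rightarrow> (complex \<times> nat \<times> nat) list" where
  "dual n (PE j i r) = [(1, Suc i, j)]"
| "dual n (PF j i r) = [(1, j, Suc i)]"
| "dual n (PH i s) = map (\<lambda>y. (1, y, y)) [1..<Suc i] @ map (\<lambda>y. (- of_nat i / of_nat n, y, y)) [1..<Suc n]"

definition pairing :: "nat \<Rightarrow> pbw \<Rightarrow> pbw list \<Rightarrow> complex" where
  "pairing n p s = (\<Sum>(\<alpha>, q, y)\<leftarrow>dual n p. \<alpha> * mactw s (delta q) y)"

lemma pairing_nil:
  assumes "valid_pbw n b p"
  shows "pairing n p [] = 0"
proof (cases p)
  case (PH i s)
  then have "n > 0" using assms by (auto simp: idx_def)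
  then show ?thesis
    using PH by (simp add: pairing_def delta_def o_def sum_list_triv del: upt_Suc)
qed (use assms in \<open>auto simp: pairing_def delta_def\<close>)

lemma sum_list_upt: "(\<Sum>y\<leftarrow>[1..<Suc m]. f y) = (\<Sum>y\<in>{1..m}. f y)" for f :: "nat \<Rightarrow> complex"
  by (simp add: interv_sum_list_conv_sum_set_nat atLeastLessThanSuc_atLeastAtMost del: upt_Suc)

lemma pairing_single:
  assumes p: "valid_pbw n b p" and q: "valid_pbw n b q" and e: "pexp b p = pexp b q"
  shows "pairing n p [q] = (if p = q then 1 else 0)"
proof (cases p)
  case (PE j i r)
  then show ?thesis using assms by (cases q) (auto simp: pairing_def delta_def)
next
  case (PF j i r)
  then show ?thesis using assms by (cases q) (auto simp: pairing_def delta_def)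
next
  case (PH i s)
  have i: "1 \<le> i" "i \<le> n - 1" using p PH by (auto simp: idx_def)
  show ?thesis
  proof (cases q)
    case (PE j' i' r')
    then have "mact q (delta y) y = 0" for y using q by (auto simp: delta_def)
    then show ?thesis using PH PE by (simp add: pairing_def o_def)
  next
    case (PF j' i' r')
    then have "mact q (delta y) y = 0" for y using q by (auto simp: delta_def)
    then show ?thesis using PH PF by (simp add: pairing_def o_def)
  next
    case q': (PH i' s')
    have i': "1 \<le> i'" "i' \<le> n - 1" using q q' by (auto simp: idx_def)
    have "(\<Sum>y\<in>{1..m}. mact q (delta y) y) =
        (\<Sum>y\<in>{1..m}. if y = i' then 1 else 0) - (\<Sum>y\<in>{1..m}. if y = Suc i' then 1 else 0)" for m
      unfolding q' sum_subtractf[symmetric] by (intro sum.cong) (auto simp: delta_def)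
    \<comment> \<open>The diagonal entries are 1 at \<open>i'\<close> and -1 at
      \<open>Suc i'\<close>, so a partial trace sees them only when it stops between the two; the
      full trace vanishes because \<open>i' < n\<close>.\<close>
    then have S: "(\<Sum>y\<in>{1..m}. mact q (delta y) y) = (if m = i' then 1 else 0)" for m
      using i' by (auto simp: sum.delta)
    have "pairing n p [q] = (\<Sum>y\<in>{1..i}. mact q (delta y) y) - of_nat i / of_nat n * (\<Sum>y\<in>{1..n}. mact q (delta y) y)"
      unfolding PH pairing_def
      by (simp add: o_def sum_list_upt[unfolded One_nat_def] sum_list_const_mult sum_distrib_left sum_negf del: upt_Suc)
    then have "pairing n p [q] = (if i = i' then 1 else 0)"
      unfolding S using i' by auto
    \<comment> \<open>Equal exponents determine \<open>s\<close> from \<open>i\<close>, which is why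
      the functional is dual only among elements of one exponent.\<close>
    moreover have "p = q \<longleftrightarrow> i = i'"
      using e p q PH q' by auto
    ultimately show ?thesis by simp
  qed
qed

lemma sum_list_swap: "(\<Sum>x\<leftarrow>xs. \<Sum>y\<leftarrow>ys. f x y) = (\<Sum>y\<leftarrow>ys. \<Sum>x\<leftarrow>xs. f x y)"
  for f :: "'a \<Rightarrow> 'b \<Rightarrow> 'c::comm_monoid_add"
  by (induction xs) (simp_all add: sum_list_addf)

lemma sum_list_concat_map: "(\<Sum>x\<leftarrow>concat (map h xs). f x) = (\<Sum>y\<leftarrow>xs. \<Sum>x\<leftarrow>h y. f x)"
  for f :: "'a \<Rightarrow> 'c::comm_monoid_add"
  by (induction xs) simp_all

text \<open>The sum is a polynomial in \<open>\<zeta>\<close> vanishing off a finite set, hence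
  identically; \<open>A\<close> will be the set of evaluation points already in use.\<close>

lemma coefficient_extraction:
  fixes L :: "'x list" and f :: "'x \<Rightarrow> complex" and e :: "'x \<Rightarrow> nat"
  assumes "finite A" "\<And>\<zeta>. \<zeta> \<notin> A \<Longrightarrow> (\<Sum>x\<leftarrow>L. \<zeta> ^ e x * f x) = 0"
  shows "(\<Sum>x\<leftarrow>L. if e x = D then f x else 0) = 0"
proof -
  define P where "P = (\<Sum>x\<leftarrow>L. monom (f x) (e x))"
  have poly: "poly P \<zeta> = (\<Sum>x\<leftarrow>L. \<zeta> ^ e x * f x)" for \<zeta>
    unfolding P_def by (induction L) (simp_all add: poly_monom mult.commute)
  have "P = 0"
  proof (rule ccontr)
    assume "P \<noteq> 0"
    then have "finite {\<zeta>. poly P \<zeta> = 0}" by (rule poly_roots_finite)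
    moreover have "- A \<subseteq> {\<zeta>. poly P \<zeta> = 0}" using assms(2) by (auto simp: poly)
    ultimately have "finite (A \<union> - A)" using assms(1) by (metis finite_Un finite_subset)
    then show False using infinite_UNIV_char_0[where 'a = complex] by (simp add: Compl_partition)
  qed
  moreover have "coeff P D = (\<Sum>x\<leftarrow>L. if e x = D then f x else 0)"
    unfolding P_def by (induction L) simp_all
  ultimately show ?thesis by simp
qed

text \<open>Lists with repetition, since splitting produces the same monomial several times;
  coefficients of equal multisets are added up only in the conclusion.\<close>

type_synonym comb = "(complex \<times> pbw list) list"

text \<open>The number of sites is quantified inside, so that vanishing on \<open>Suc k\<close>
  sites can be used to derive vanishing on \<open>k\<close> sites.\<close>

definition kills :: "(nat \<Rightarrow> nat) \<Rightarrow> comb \<Rightarrow> bool" where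
  "kills b T \<longleftrightarrow> (\<forall>k z v a. inj_on z {..<k} \<longrightarrow> (\<Sum>x\<leftarrow>T. fst x * copw k z b (snd x) v a) = 0)"

lemma killsD: "kills b T \<Longrightarrow> inj_on z {..<k} \<Longrightarrow> (\<Sum>x\<leftarrow>T. fst x * copw k z b (snd x) v a) = 0"
  unfolding kills_def by blast

definition split_comb :: "comb \<Rightarrow> (complex \<times> pbw list \<times> pbw list) list" where
  "split_comb T = concat (map (\<lambda>x. map (Pair (fst x)) (splits (snd x))) T)"

lemma sum_split_comb:
  "(\<Sum>x\<leftarrow>split_comb T. f x) = (\<Sum>x\<leftarrow>T. \<Sum>y\<leftarrow>splits (snd x). f (fst x, y))" for f :: "_ \<Rightarrow> complex"
  by (simp add: split_comb_def sum_list_concat_map o_def)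

abbreviation pexpw :: "(nat \<Rightarrow> nat) \<Rightarrow> pbw list \<Rightarrow> nat" where
  "pexpw b s \<equiv> (\<Sum>p\<leftarrow>s. pexp b p)"

lemma kills_pairing:
  assumes "kills b T" "inj_on z {..<k}"
  shows "(\<Sum>(cf, s, c)\<leftarrow>split_comb T. if pexpw b s = D then cf * pairing n p s * copw k z b c u a else 0) = 0"
proof -
  have main: "(\<Sum>x\<leftarrow>split_comb T. \<zeta> ^ pexpw b (fst (snd x)) *
      (fst x * pairing n p (fst (snd x)) * copw k z b (snd (snd x)) u a)) = 0" if "\<zeta> \<notin> z ` {..<k}" for \<zeta>
  proof -
    \<comment> \<open>The new site receives the variable point; the old operators do not see it,
      because they sum over \<open>r < k\<close>.\<close>
    define z' where "z' = z(k := \<zeta>)"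
    have inj: "inj_on z' {..<Suc k}"
      using assms(2) that unfolding z'_def lessThan_Suc
      by (auto simp: inj_on_def)
    have cop_eq: "cop k z' b = cop k z b"
      by (intro ext) (simp add: cop_def z'_def)
    have copw_eq: "copw k z' b = copw k z b"
      by (intro ext) (simp add: copw_def cop_eq)
    have site: "(\<Sum>x\<leftarrow>split_comb T. \<zeta> ^ pexpw b (fst (snd x)) * (fst x *
        (mactw (fst (snd x)) \<phi> y * copw k z b (snd (snd x)) u a))) = 0" for \<phi> y
    proof -
      \<comment> \<open>With base label \<open>a k\<close> and configuration
        \<open>a(k := y)\<close>, the tensor evaluates to the value at \<open>y\<close> on the new
        site times the old vector at \<open>a\<close>.\<close>
      have "(\<Sum>x\<leftarrow>T. fst x * copw (Suc k) z' b (snd x) (tens k (a k) \<phi> u) (a(k := y))) = 0"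
        using assms(1) inj by (rule killsD)
      then show ?thesis
        unfolding copw_tens sum_split_comb copw_eq
        by (simp add: tens_def z'_def case_prod_beta mult_ac flip: sum_list_const_mult)
    qed
    have "(\<Sum>x\<leftarrow>split_comb T. \<zeta> ^ pexpw b (fst (snd x)) *
      (fst x * pairing n p (fst (snd x)) * copw k z b (snd (snd x)) u a)) =
      (\<Sum>x\<leftarrow>split_comb T. \<Sum>w\<leftarrow>dual n p. fst w * (\<zeta> ^ pexpw b (fst (snd x)) * (fst x *
        (mactw (fst (snd x)) (delta (fst (snd w))) (snd (snd w)) * copw k z b (snd (snd x)) u a))))"
      by (simp add: pairing_def case_prod_beta mult_ac flip: sum_list_const_mult sum_list_mult_const)
    also have "\<dots> = 0"
      unfolding sum_list_swap[of _ "dual n p"] sum_list_const_mult site by simp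
    finally show ?thesis .
  qed
  from coefficient_extraction[where D = D and A = "z ` {..<k}", OF _ main] show ?thesis
    by (simp add: case_prod_unfold)
qed

text \<open>The pairing acts like a partial derivative in \<open>p\<close>: to reach the multiset
  \<open>\<nu>\<close> of maximal size only one factor can be split off, it must be
  \<open>p\<close>, and there are \<open>count \<mu> p\<close> choices. This count is nonzero, so
  the coefficient sum for \<open>\<mu>\<close> vanishes.\<close>

theorem classical_independence:
  assumes "kills b T" "\<And>cf ps. (cf, ps) \<in> set T \<Longrightarrow> set ps \<subseteq> pbw_gens n b \<and> length ps \<le> d"
    and "size \<mu> = d" "set_mset \<mu> \<subseteq> pbw_gens n b"
  shows "(\<Sum>(cf, ps)\<leftarrow>T. if mset ps = \<mu> then cf else 0) = 0"
  using assms
proof (induction d arbitrary: T \<mu>)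
  case 0
  \<comment> \<open>All monomials are empty here, so acting on the constant function reads off the
    coefficient even without sites.\<close>
  have "(\<Sum>x\<leftarrow>T. fst x * copw 0 (\<lambda>_. 0) b (snd x) (\<lambda>_. 1) (\<lambda>_. 0)) = 0"
    using "0.prems"(1) by (rule killsD) simp
  also have "(\<Sum>x\<leftarrow>T. fst x * copw 0 (\<lambda>_. 0) b (snd x) (\<lambda>_. 1) (\<lambda>_. 0)) =
      (\<Sum>(cf, ps)\<leftarrow>T. if mset ps = \<mu> then cf else 0)"
  proof (intro arg_cong[of _ _ sum_list] map_cong refl)
    fix x assume "x \<in> set T"
    then have "snd x = []" using "0.prems"(2)[of "fst x" "snd x"] by simp
    then show "fst x * copw 0 (\<lambda>_. 0) b (snd x) (\<lambda>_. 1) (\<lambda>_. 0) =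
        (case x of (cf, ps) \<Rightarrow> if mset ps = \<mu> then cf else 0)"
      using "0.prems"(3) by (simp add: case_prod_beta)
  qed
  finally show ?case .
next
  case (Suc d)
  obtain p where p: "p \<in># \<mu>" using Suc.prems(3) by (metis size_empty nat.distinct(1) multiset_nonemptyE)
  then have vp: "valid_pbw n b p" using Suc.prems(4) by (auto simp: pbw_gens_def)
  define \<nu> where "\<nu> = \<mu> - {#p#}"
  have \<mu>: "\<mu> = add_mset p \<nu>" using p by (simp add: \<nu>_def)
  \<comment> \<open>The pairing vanishes on the empty list, so demanding a nonempty split-off part
    loses nothing and makes the remaining monomials strictly shorter.\<close>
  define Q where "Q = (\<lambda>x :: complex \<times> pbw list \<times> pbw list.
    fst (snd x) \<noteq> [] \<and> pexpw b (fst (snd x)) = pexp b p)"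
  define T' where "T' = map (\<lambda>x. (fst x * pairing n p (fst (snd x)), snd (snd x))) (filter Q (split_comb T))"
  have split_mem: "(cf, mset s + mset c) \<in> (\<lambda>x. (fst x, mset (snd x))) ` set T"
    if "(cf, s, c) \<in> set (split_comb T)" for cf s c
    using that splits_mset by (force simp: split_comb_def)
  have T': "(\<Sum>x\<leftarrow>T'. f x) = (\<Sum>x\<leftarrow>split_comb T. if Q x then
      f (fst x * pairing n p (fst (snd x)), snd (snd x)) else 0)" for f :: "_ \<Rightarrow> complex"
    unfolding T'_def by (simp add: sum_list_map_filter' o_def)
  have "kills b T'"
    unfolding kills_def
  proof (intro allI impI)
    fix k and z :: "nat \<Rightarrow> complex" and v :: vec and a
    assume "inj_on z {..<k}"
    from kills_pairing[OF Suc.prems(1) this, of "pexp b p" n p v a]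
    have "(\<Sum>(cf, s, c)\<leftarrow>split_comb T. if pexpw b s = pexp b p then cf * pairing n p s * copw k z b c v a else 0) = 0" .
    also have "(\<Sum>(cf, s, c)\<leftarrow>split_comb T. if pexpw b s = pexp b p then cf * pairing n p s * copw k z b c v a else 0)
      = (\<Sum>x\<leftarrow>T'. fst x * copw k z b (snd x) v a)"
      unfolding T' using pairing_nil[OF vp]
      by (intro arg_cong[of _ _ sum_list] map_cong refl) (auto simp: Q_def)
    finally show "(\<Sum>x\<leftarrow>T'. fst x * copw k z b (snd x) v a) = 0" .
  qed
  moreover have "set ps \<subseteq> pbw_gens n b \<and> length ps \<le> d" if "(cf, ps) \<in> set T'" for cf ps
  proof -
    from that obtain cf' s where s: "(cf', s, ps) \<in> set (split_comb T)" "s \<noteq> []"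
      by (auto simp: T'_def Q_def)
    from split_mem[OF s(1)] obtain ws where ws: "(cf', ws) \<in> set T" "mset s + mset ps = mset ws" by auto
    have "set ps \<subseteq> set ws" using arg_cong[OF ws(2), of set_mset] by auto
    moreover have "length ps < length ws" using arg_cong[OF ws(2), of size] s(2) by (cases s) auto
    ultimately show ?thesis using Suc.prems(2)[OF ws(1)] by auto
  qed
  moreover have "size \<nu> = d" "set_mset \<nu> \<subseteq> pbw_gens n b" using Suc.prems(3,4) \<mu> by auto
  ultimately have "(\<Sum>(cf, ps)\<leftarrow>T'. if mset ps = \<nu> then cf else 0) = 0"
    by (intro Suc.IH)
  also have "(\<Sum>(cf, ps)\<leftarrow>T'. if mset ps = \<nu> then cf else 0) =
    (\<Sum>x\<leftarrow>T. \<Sum>y\<leftarrow>splits (snd x). if Q (fst x, y) \<and> mset (snd y) = \<nu> then fst x * pairing n p (fst y) else 0)"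
    unfolding T' sum_split_comb
    by (intro arg_cong[of _ _ sum_list] map_cong refl) (simp add: case_prod_beta)
  also have "\<dots> = (\<Sum>x\<leftarrow>T. of_nat (count \<mu> p) * (if mset (snd x) = \<mu> then fst x else 0))"
  proof (intro arg_cong[of _ _ sum_list] map_cong refl)
    fix x assume x: "x \<in> set T"
    then have val: "set (snd x) \<subseteq> pbw_gens n b" and len: "length (snd x) \<le> Suc d"
      using Suc.prems(2)[of "fst x" "snd x"] by auto
    have "(if Q (fst x, y) \<and> mset (snd y) = \<nu> then fst x * pairing n p (fst y) else 0) =
        (if mset (snd x) = \<mu> then fst x else 0) * (if fst y = [p] then 1 else 0)"
      if y: "y \<in> set (splits (snd x))" for y
    proof -
      have ms: "mset (fst y) + mset (snd y) = mset (snd x)" using splits_mset y by (metis prod.collapse)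
      have sub: "set (fst y) \<subseteq> set (snd x)" using arg_cong[OF ms, of set_mset] by auto
      have ln: "length (fst y) + length (snd y) = length (snd x)" using arg_cong[OF ms, of size] by auto
      show ?thesis
      proof (cases "fst y = [p]")
        case True
        then have "mset (snd y) = \<nu> \<longleftrightarrow> mset (snd x) = \<mu>" using ms by (auto simp: \<mu>)
        then show ?thesis using True pairing_single[OF vp vp refl] by (simp add: Q_def)
      next
        case False
        have "pairing n p (fst y) = 0" if "Q (fst x, y)" "mset (snd y) = \<nu>"
        proof -
          have "length (snd y) = d" using that(2) \<open>size \<nu> = d\<close> by (metis size_mset)
          then have "length (fst y) \<le> 1" "fst y \<noteq> []" using that(1) ln len by (auto simp: Q_def)
          then obtain q where q: "fst y = [q]" by (cases "fst y") auto
          then have "valid_pbw n b q" "pexp b p = pexp b q"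
            using sub val that(1) by (auto simp: pbw_gens_def Q_def)
          then show ?thesis using pairing_single[OF vp] q False by auto
        qed
        then show ?thesis using False by auto
      qed
    qed
    then have "(\<Sum>y\<leftarrow>splits (snd x). if Q (fst x, y) \<and> mset (snd y) = \<nu> then fst x * pairing n p (fst y) else 0) =
      (\<Sum>y\<leftarrow>splits (snd x). (if mset (snd x) = \<mu> then fst x else 0) * (if fst y = [p] then 1 else 0))"
      by (intro arg_cong[of _ _ sum_list] map_cong refl)
    also have "\<dots> = (if mset (snd x) = \<mu> then fst x else 0) * of_nat (count (mset (snd x)) p)"
      using splits_single[of p "snd x"] unfolding case_prod_unfold sum_list_const_mult by simp
    finally show "(\<Sum>y\<leftarrow>splits (snd x). if Q (fst x, y) \<and> mset (snd y) = \<nu> then fst x * pairing n p (fst y) else 0) =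
        of_nat (count \<mu> p) * (if mset (snd x) = \<mu> then fst x else 0)"
      by auto
  qed
  also have "\<dots> = of_nat (count \<mu> p) * (\<Sum>(cf, ps)\<leftarrow>T. if mset ps = \<mu> then cf else 0)"
    by (simp add: sum_list_const_mult case_prod_unfold)
  finally show ?case using p by (auto simp: case_prod_unfold count_eq_zero_iff)
qed

section \<open>The classical limit\<close>

definition unit_op :: "nat \<Rightarrow> (nat \<Rightarrow> complex) \<Rightarrow> nat \<Rightarrow> nat \<Rightarrow> nat \<Rightarrow> vec \<Rightarrow> vec" where
  "unit_op k z l m d v = (\<lambda>a. \<Sum>r<k. z r ^ d * (if a r = l then v (a(r := m)) else 0))"

text \<open>Operators at different sites commute, so only coinciding sites contribute; there
  \<open>q \<noteq> l\<close> removes the second product, as for matrix units.\<close>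

lemma unit_op_comm:
  assumes "q \<noteq> l"
  shows "unit_op k z l m d (unit_op k z m q d' v) a - unit_op k z m q d' (unit_op k z l m d v) a
    = unit_op k z l q (d + d') v a"
proof -
  let ?L = "\<lambda>r s. if a r = l then if (a(r := m)) s = m then v (a(r := m, s := q)) else 0 else 0"
  let ?R = "\<lambda>r s. if a s = m then if (a(s := q)) r = l then v (a(s := q, r := m)) else 0 else 0"
  have L: "unit_op k z l m d (unit_op k z m q d' v) a = (\<Sum>r<k. \<Sum>s<k. z r ^ d * z s ^ d' * ?L r s)"
    unfolding unit_op_def by (intro sum.cong refl) (simp add: sum_distrib_left mult.assoc)
  have "unit_op k z m q d' (unit_op k z l m d v) a = (\<Sum>s<k. \<Sum>r<k. z r ^ d * z s ^ d' * ?R r s)"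
    unfolding unit_op_def by (intro sum.cong refl) (simp add: sum_distrib_left mult_ac)
  also have "\<dots> = (\<Sum>r<k. \<Sum>s<k. z r ^ d * z s ^ d' * ?R r s)"
    by (rule sum.swap)
  finally have "unit_op k z l m d (unit_op k z m q d' v) a - unit_op k z m q d' (unit_op k z l m d v) a =
      (\<Sum>r<k. \<Sum>s<k. z r ^ d * z s ^ d' * (?L r s - ?R r s))"
    by (simp only: L sum_subtractf right_diff_distrib)
  also have "\<dots> = (\<Sum>r<k. \<Sum>s<k. if s = r then z r ^ (d + d') * (if a r = l then v (a(r := q)) else 0) else 0)"
  proof (intro sum.cong refl)
    fix r s
    have "?L r s - ?R r s = (if s = r then if a r = l then v (a(r := q)) else 0 else 0)"
      using assms by (cases "s = r") (auto simp: fun_upd_twist)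
    then show "z r ^ d * z s ^ d' * (?L r s - ?R r s) =
        (if s = r then z r ^ (d + d') * (if a r = l then v (a(r := q)) else 0) else 0)"
      by (simp add: power_add)
  qed
  also have "\<dots> = unit_op k z l q (d + d') v a"
    by (simp add: unit_op_def)
  finally show ?thesis .
qed

lemma cop_unit: "cop k z b (PE j i r) v = unit_op k z j (Suc i) r v"
  "cop k z b (PF j i r) v = unit_op k z (Suc i) j (r + (\<Sum>l=j..i. b l)) v"
  by (simp_all add: cop_def unit_op_def)

lemma eroot_Suc: "j \<le> i \<Longrightarrow> eroot j (Suc i) r = comm (eroot j i r) (g (E (Suc i) 0))"
  and froot_Suc: "j \<le> i \<Longrightarrow> froot j (Suc i) r = comm (g (F (Suc i) 0)) (froot j i r)"
  by (simp_all add: eroot_def froot_def)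

context
  fixes k :: nat and z :: "nat \<Rightarrow> complex" and b :: "nat \<Rightarrow> nat"
begin

text \<open>At \<open>t = 0\<close> the operators are computed directly;
  \<open>generic_site_rep\<close> excludes this value, so information about the relation ideal
  arrives through a limit.\<close>

interpretation cl: site_rep k z b 0 .

lemma act_classical:
  "cl.act (E i m) v = unit_op k z i (Suc i) m v"
  "cl.act (F i m) v = unit_op k z (Suc i) i (m + b i) v"
  "cl.act (H i s) v = cop k z b (PH i s) v"
  by (auto simp: fun_eq_iff cl.sop_def cl.mv_def cl.weight_def cl.xs_def unit_op_def cl.lam_def cop_def
      cl.eta_def cl.eps_def sum_distrib_right sum_distrib_left mult_ac fun_upd_idem cong: if_cong intro!: sum.cong)

lemma rho_eroot:
  assumes "j \<le> i" "1 \<le> j" "i \<le> n - 1"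
  shows "cl.rho (eroot j i r) v = unit_op k z j (Suc i) r v"
  using assms
proof (induction i arbitrary: v rule: dec_induct)
  case base
  then show ?case by (simp add: eroot_def cl.rho_g act_classical del: cl.act.simps)
next
  case (step i)
  have "eroot j i r \<in> free_alg n b" "g (E (Suc i) 0) \<in> free_alg n b"
    using step by (auto intro!: eroot_free_alg free_alg_g simp: idx_def)
  then show ?case
    using step unit_op_comm[of "Suc (Suc i)" j k z "Suc i" r 0]
    by (simp add: eroot_Suc cl.rho_comm[where n = n and b' = b] cl.rho_g act_classical del: cl.act.simps)
qed

lemma rho_froot:
  assumes "j \<le> i" "1 \<le> j" "i \<le> n - 1"
  shows "cl.rho (froot j i r) v = unit_op k z (Suc i) j (r + (\<Sum>l=j..i. b l)) v"
  using assms
proof (induction i arbitrary: v rule: dec_induct)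
  case base
  then show ?case by (simp add: froot_def cl.rho_g act_classical del: cl.act.simps)
next
  case (step i)
  have "froot j i r \<in> free_alg n b" "g (F (Suc i) 0) \<in> free_alg n b"
    using step by (auto intro!: froot_free_alg free_alg_g simp: idx_def)
  then show ?case
    using step unit_op_comm[of j "Suc (Suc i)" k z "Suc i" "b (Suc i)" "r + (\<Sum>l=j..i. b l)"]
    by (simp add: froot_Suc cl.rho_comm[where n = n and b' = b] cl.rho_g act_classical add_ac del: cl.act.simps)
qed

lemma rho_pbw_el: "valid_pbw n b p \<Longrightarrow> cl.rho (pbw_el p) v = cop k z b p v"
  by (cases p) (simp_all add: cop_unit rho_eroot[where n = n] rho_froot[where n = n] cl.rho_g act_classical del: cl.act.simps)

lemma rho_pbw_mon: "set ps \<subseteq> pbw_gens n b \<Longrightarrow> cl.rho (pbw_mon ps) v = copw k z b ps v"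
proof (induction ps)
  case Nil
  then show ?case by (simp add: fone_eq_word cl.rho_word)
next
  case (Cons p ps)
  then have "valid_pbw n b p" "pbw_el p \<in> free_alg n b" "pbw_mon ps \<in> free_alg n b"
    using pbw_mon_free_alg[of ps n b] by (auto simp: pbw_gens_def pbw_el_free_alg)
  then show ?case using Cons by (simp add: cl.rho_fmul[where n = n and b' = b] rho_pbw_el)
qed

end

text \<open>All denominators are differences of evaluation points and independent of
  \<open>t\<close>. The vector is allowed to vary with \<open>t\<close>, so that the statement can
  be iterated along a word.\<close>

lemma tendsto_site_act:
  assumes "\<And>a. ((\<lambda>t. v t a) \<longlongrightarrow> v 0 a) (at (0 :: complex))"
  shows "((\<lambda>t. site_rep.act k z b t x (v t) a) \<longlongrightarrow> site_rep.act k z b 0 x (v 0) a) (at 0)"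
proof -
  have w: "((\<lambda>t. site_rep.weight z t p \<epsilon> S r a) \<longlongrightarrow> site_rep.weight z 0 p \<epsilon> S r a) (at 0)" for p \<epsilon> S r a
    unfolding site_rep.weight_def by (intro tendsto_prod) (auto simp: divide_inverse intro!: tendsto_eq_intros)
  have m: "((\<lambda>t. site_rep.mv k z t p q \<epsilon> r (v t) a) \<longlongrightarrow> site_rep.mv k z 0 p q \<epsilon> r (v 0) a) (at 0)" for p q \<epsilon> r a
    unfolding site_rep.mv_def using tendsto_mult[OF w assms] by auto
  have x: "((\<lambda>t. site_rep.xs z t i r) \<longlongrightarrow> site_rep.xs z 0 i r) (at 0)" for i r
    unfolding site_rep.xs_def by (auto intro!: tendsto_eq_intros)
  have e: "((\<lambda>t. site_rep.eta k z t i a r) \<longlongrightarrow> site_rep.eta k z 0 i a r) (at 0)" for i a r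
    unfolding site_rep.eta_def
    by (intro tendsto_mult tendsto_prod tendsto_const) (auto simp: divide_inverse intro!: tendsto_eq_intros)
  show ?thesis
  proof (cases x)
    case (E i m')
    then show ?thesis unfolding E site_rep.act.simps site_rep.sop_def
      by (intro tendsto_sum tendsto_mult tendsto_power x m)
  next
    case (F i m')
    then show ?thesis unfolding F site_rep.act.simps site_rep.sop_def
      by (intro tendsto_sum tendsto_mult tendsto_power x m)
  next
    case (H i s)
    then show ?thesis unfolding H site_rep.act.simps site_rep.lam_def
      by (intro tendsto_sum tendsto_mult tendsto_power x e assms)
  qed
qed

lemma tendsto_actw:
  "((\<lambda>t. site_rep.actw k z b t w v a) \<longlongrightarrow> site_rep.actw k z b 0 w v a) (at 0)"
proof (induction w arbitrary: a)
  case Nil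
  then show ?case by (simp add: site_rep.actw_simps)
next
  case (Cons x w)
  then show ?case unfolding site_rep.actw_simps
    using tendsto_site_act[of "\<lambda>t. site_rep.actw k z b t w v"] by blast
qed

lemma tendsto_rho:
  "((\<lambda>t. site_rep.rho k z b t p v a) \<longlongrightarrow> site_rep.rho k z b 0 p v a) (at 0)"
  unfolding site_rep.rho_def
  by (intro tendsto_sum tendsto_mult tendsto_actw) (rule isContD[OF poly_isCont])

text \<open>Only finitely many nonzero differences have to be avoided, and they stay away from 0;
  the difference 0 is excluded by the punctured neighbourhood.\<close>

lemma eventually_generic:
  fixes z :: "nat \<Rightarrow> complex"
  assumes "inj_on z {..<k}"
  shows "eventually (\<lambda>t. generic_site_rep k z t) (at 0)"
proof -
  let ?S = "(\<lambda>(r, s). z r - z s) ` ({..<k} \<times> {..<k}) - {0}"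
  have "open (- ?S)" by (intro open_Compl finite_imp_closed) auto
  then have "eventually (\<lambda>t. t \<in> - ?S) (at 0)"
    by (intro eventually_at_topological[THEN iffD2] exI[of _ "- ?S"]) auto
  moreover have "eventually (\<lambda>t::complex. t \<noteq> 0) (at 0)"
    by (simp add: eventually_at_filter)
  ultimately show ?thesis
  proof eventually_elim
    case (elim t)
    show ?case
    proof
      show "z r \<noteq> z s" if "r < k" "s < k" "r \<noteq> s" for r s
        using assms that by (auto simp: inj_on_def)
      show "z r - z s \<noteq> t" if "r < k" "s < k" for r s
        using elim that by force
    qed (use elim in auto)
  qed
qed

section \<open>Independence of ordered monomials\<close>

lemma rho_sum_list:
  assumes "\<And>m. m \<in> set ms \<Longrightarrow> p m \<in> free_alg n b"
  shows "site_rep.rho k z b' t (\<Sum>m\<leftarrow>ms. sc (c m) (p m)) v a = (\<Sum>m\<leftarrow>ms. poly (c m) t * site_rep.rho k z b' t (p m) v a)"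
  using assms
proof (induction ms)
  case Nil
  then show ?case by (simp add: site_rep.rho_0)
next
  case (Cons m ms)
  have "(\<Sum>m\<leftarrow>ms. sc (c m) (p m)) \<in> free_alg n b"
    using Cons.prems by (induction ms) (auto intro: free_alg_add free_alg_sc)
  then show ?case using Cons
    by (simp add: site_rep.rho_add'[where n = n and b' = b] site_rep.rho_sc free_alg_sc)
qed

lemma divide_common_power:
  fixes c :: "'m \<Rightarrow> complex poly"
  assumes "finite A" "\<exists>m\<in>A. c m \<noteq> 0"
  obtains e c' where "\<And>m. m \<in> A \<Longrightarrow> c m = [:0, 1:] ^ e * c' m" "\<exists>m\<in>A. coeff (c' m) 0 \<noteq> 0"
proof -
  \<comment> \<open>The least order of vanishing at 0 among the nonzero coefficients; dividing by
    this power leaves some coefficient with a nonzero constant term.\<close>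
  define e where "e = Min ((\<lambda>m. order 0 (c m)) ` {m \<in> A. c m \<noteq> 0})"
  have fin: "finite ((\<lambda>m. order 0 (c m)) ` {m \<in> A. c m \<noteq> 0})" using assms(1) by simp
  have "e \<in> (\<lambda>m. order 0 (c m)) ` {m \<in> A. c m \<noteq> 0}"
    unfolding e_def using fin assms(2) by (intro Min_in) auto
  then obtain m0 where m0: "m0 \<in> A" "c m0 \<noteq> 0" "order 0 (c m0) = e" by auto
  have "[:0, 1:] ^ e dvd c m" if "m \<in> A" for m
  proof (cases "c m = 0")
    case False
    then have "e \<le> order 0 (c m)" unfolding e_def using that fin by (intro Min_le) auto
    then show ?thesis using order_1[of 0 "c m"] by (metis dvd_trans le_imp_power_dvd minus_zero)
  qed simp
  then obtain c' where c': "\<And>m. m \<in> A \<Longrightarrow> c m = [:0, 1:] ^ e * c' m"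
    unfolding dvd_def by metis
  have "coeff (c' m0) 0 \<noteq> 0"
  proof
    assume "coeff (c' m0) 0 = 0"
    then have "[:0, 1:] dvd c' m0" by (simp add: poly_0_coeff_0 dvd_iff_poly_eq_0)
    then have "[:0, 1:] ^ Suc e dvd c m0" using c'[OF m0(1)]
      by (metis mult.commute mult_dvd_mono dvd_refl power_Suc)
    then show False using order_2[OF m0(2), of 0] m0(3) by simp
  qed
  then show thesis using that c' m0(1) by blast
qed

text \<open>This identifies an ordered monomial with its multiset, which is all that the leading
  coefficient argument can see.\<close>

lemma sorted_wrt_mset_unique:
  assumes "sorted_wrt P xs" "sorted_wrt P ys" "mset xs = mset ys" "\<And>x y. P x y \<Longrightarrow> P y x \<Longrightarrow> x = y"
  shows "xs = ys"
  using assms(1-3)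
proof (induction xs arbitrary: ys)
  case (Cons x xs)
  then obtain y ys' where ys: "ys = y # ys'" by (cases ys) auto
  have "set (x # xs) = set (y # ys')" using Cons.prems(3) ys by (metis set_mset_mset)
  then have "x = y \<or> P y x" "y = x \<or> P x y" using Cons.prems(1,2) ys by auto
  then have "x = y" using assms(4) by blast
  then show ?case using Cons ys by simp
qed simp

theorem pbw_independence:
  assumes ord: "linear_order_on (pbw_gens n b) ord"
    and fin: "finite {m. c m \<noteq> 0}" and ordered: "\<forall>m. c m \<noteq> 0 \<longrightarrow> ordered_pbw n b ord m"
    and rel: "(\<Sum>m\<in>{m. c m \<noteq> 0}. sc (c m) (pbw_mon m)) \<in> rel_ideal n b"
  shows "c m = 0"
proof (rule ccontr)
  assume "c m \<noteq> 0"
  define A where "A = {m. c m \<noteq> 0}"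
  have A: "finite A" "\<exists>m\<in>A. c m \<noteq> 0" using fin \<open>c m \<noteq> 0\<close> by (auto simp: A_def)
  obtain e c' where c': "\<And>m. m \<in> A \<Longrightarrow> c m = [:0, 1:] ^ e * c' m" "\<exists>m\<in>A. coeff (c' m) 0 \<noteq> 0"
    using divide_common_power[OF A] by blast
  \<comment> \<open>Only these monomials survive at \<open>hbar = 0\<close>; the maximal length is
    later taken among them and not among all of \<open>A\<close>.\<close>
  define B where "B = {m \<in> A. coeff (c' m) 0 \<noteq> 0}"
  have B: "finite B" "B \<noteq> {}" "B \<subseteq> A" using A(1) c'(2) by (auto simp: B_def)
  have gens: "set m \<subseteq> pbw_gens n b" and sorted: "sorted_wrt (\<lambda>x y. (x, y) \<in> ord) m" if "m \<in> A" for m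
    using ordered that by (auto simp: A_def ordered_pbw_def)
  obtain ms where ms: "set ms = B" "distinct ms" using finite_distinct_list[OF B(1)] by blast
  define T where "T = map (\<lambda>m. (coeff (c' m) 0, m)) ms"
  have "kills b T"
    unfolding kills_def
  proof (intro allI impI)
    fix k and z :: "nat \<Rightarrow> complex" and v :: vec and a
    assume inj: "inj_on z {..<k}"
    have "eventually (\<lambda>t. (\<Sum>m\<in>A. poly (c' m) t * site_rep.rho k z b t (pbw_mon m) v a) = 0) (at 0)"
      using eventually_generic[OF inj]
    proof eventually_elim
      case (elim t)
      interpret generic_site_rep k z b t by (rule elim)
      obtain xs' where xs': "set xs' = A" "distinct xs'" using finite_distinct_list[OF A(1)] by blast
      have "(\<Sum>m\<leftarrow>xs'. sc (c m) (pbw_mon m)) \<in> rel_ideal n b"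
        using rel xs' unfolding A_def[symmetric] by (simp add: sum_list_distinct_conv_sum_set)
      then have "rho (\<Sum>m\<leftarrow>xs'. sc (c m) (pbw_mon m)) v a = 0"
        using rho_rel_ideal by simp
      then have "(\<Sum>m\<in>A. poly (c m) t * rho (pbw_mon m) v a) = 0"
        using xs' gens
        by (subst (asm) rho_sum_list[where n = n and b = b])
          (auto simp: sum_list_distinct_conv_sum_set pbw_mon_free_alg)
      also have "(\<Sum>m\<in>A. poly (c m) t * rho (pbw_mon m) v a) =
          t ^ e * (\<Sum>m\<in>A. poly (c' m) t * rho (pbw_mon m) v a)"
        using c'(1) by (simp add: sum_distrib_left mult.assoc)
      \<comment> \<open>The common power of \<open>t\<close> is cancelled at nonzero
        \<open>t\<close>, before the limit is taken.\<close>
      finally show ?case using t_nz by simp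
    qed
    then have "((\<lambda>t. \<Sum>m\<in>A. poly (c' m) t * site_rep.rho k z b t (pbw_mon m) v a) \<longlongrightarrow> 0) (at 0)"
      by (rule tendsto_eventually)
    moreover have "((\<lambda>t. \<Sum>m\<in>A. poly (c' m) t * site_rep.rho k z b t (pbw_mon m) v a) \<longlongrightarrow>
        (\<Sum>m\<in>A. poly (c' m) 0 * site_rep.rho k z b 0 (pbw_mon m) v a)) (at 0)"
      by (intro tendsto_sum tendsto_mult tendsto_rho) (rule isContD[OF poly_isCont])
    ultimately have "(\<Sum>m\<in>A. poly (c' m) 0 * site_rep.rho k z b 0 (pbw_mon m) v a) = 0"
      by (rule tendsto_unique[OF at_neq_bot, symmetric])
    also have "(\<Sum>m\<in>A. poly (c' m) 0 * site_rep.rho k z b 0 (pbw_mon m) v a) =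
        (\<Sum>m\<in>A. coeff (c' m) 0 * copw k z b m v a)"
      by (intro sum.cong refl) (simp add: poly_0_coeff_0 rho_pbw_mon[OF gens])
    also have "\<dots> = (\<Sum>m\<in>B. coeff (c' m) 0 * copw k z b m v a)"
      using A(1) by (intro sum.mono_neutral_right) (auto simp: B_def)
    finally show "(\<Sum>x\<leftarrow>T. fst x * copw k z b (snd x) v a) = 0"
      using ms by (simp add: T_def o_def sum_list_distinct_conv_sum_set)
  qed
  define d where "d = Max (length ` B)"
  have "d \<in> length ` B" unfolding d_def using B by (intro Max_in) auto
  \<comment> \<open>Independence at parameter zero gives information about multisets of top size, so
    the contradiction is sought at a longest monomial of \<open>B\<close>.\<close>
  then obtain m1 where m1: "m1 \<in> B" "length m1 = d" by auto
  have "(\<Sum>(cf, ps)\<leftarrow>T. if mset ps = mset m1 then cf else 0) = 0"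
  proof (rule classical_independence[OF \<open>kills b T\<close>])
    show "set ps \<subseteq> pbw_gens n b \<and> length ps \<le> d" if "(cf, ps) \<in> set T" for cf ps
      using that ms gens B unfolding d_def T_def by (auto intro: Max_ge)
  qed (use m1 gens B in auto)
  also have "(\<Sum>(cf, ps)\<leftarrow>T. if mset ps = mset m1 then cf else 0) =
      (\<Sum>m\<in>B. if mset m = mset m1 then coeff (c' m) 0 else 0)"
    using ms by (simp add: T_def o_def sum_list_distinct_conv_sum_set)
  also have "\<dots> = (\<Sum>m\<in>B. if m = m1 then coeff (c' m) 0 else 0)"
  proof (intro sum.cong refl)
    fix m assume m: "m \<in> B"
    have "m = m1" if "mset m = mset m1"
      using sorted_wrt_mset_unique[OF _ _ that] sorted m m1(1) B(3) ord
      unfolding order_on_defs antisym_def by blast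
    then show "(if mset m = mset m1 then coeff (c' m) 0 else 0) = (if m = m1 then coeff (c' m) 0 else 0)" by auto
  qed
  also have "\<dots> = coeff (c' m1) 0" using B(1) m1(1) by simp
  finally show False using m1(1) by (simp add: B_def)
qed

theorem theorem2p29:
  fixes n :: nat and b :: "nat \<Rightarrow> nat" and ord :: "(pbw \<times> pbw) set"
  assumes "n \<ge> 2"
    and "linear_order_on (pbw_gens n b) ord"
  shows "(\<forall>x \<in> free_alg n b. \<exists>c :: pbw list \<Rightarrow> complex poly.
            finite {m. c m \<noteq> 0} \<and> (\<forall>m. c m \<noteq> 0 \<longrightarrow> ordered_pbw n b ord m) \<and>
            x - (\<Sum>m\<in>{m. c m \<noteq> 0}. sc (c m) (pbw_mon m)) \<in> rel_ideal n b)
       \<and> (\<forall>c :: pbw list \<Rightarrow> complex poly.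
            finite {m. c m \<noteq> 0} \<and> (\<forall>m. c m \<noteq> 0 \<longrightarrow> ordered_pbw n b ord m) \<and>
            (\<Sum>m\<in>{m. c m \<noteq> 0}. sc (c m) (pbw_mon m)) \<in> rel_ideal n b
            \<longrightarrow> (\<forall>m. c m = 0))"
  using pspan_coefficients[OF spanning[OF assms(2)]] pbw_independence[OF assms(2)] by blast

end
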